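(* Let $(X,d)$ be a discrete metric space of bounded geometry. Then $\mathrm{trnudim}\,C^*_u(X)\leq\mathrm{trasdim}\,X$.
   Context: Conventions: $\mathbb{N}=\{0,1,2,\dots\}$; every ordinal is $<\infty$, so the inequality is vacuous if the right side is $\infty$. "c.p." means completely positive, "c.p.c." means completely positive contractive. A c.p. map $\phi:A\to B$ between $C^*$-algebras has order zero if $\phi(a)\phi(b)=\phi(b)\phi(a)=0$ for all $a,b\in A_+$ with $ab=ba=0$. Metric notions. $(X,d)$ has bounded geometry if for every $r>0$, $\sup_{x\in X}|\{y\in X:d(x,y)\leq r\}|<\infty$. A family $\mathcal U$ of subsets of $X$ is uniformly bounded if $\sup_{U\in\mathcal U}\mathrm{diam}\,U<\infty$, and $r$-disjoint if $d(U,V)=\inf\{d(x,y):x\in U,y\in V\}\geq r$ for all $U\neq V$ in $\mathcal U$. Uniform Roe algebra. For $T\in\mathfrak B(\ell^2(X))$ with matrix entries $T_{x,y}=\langle T\delta_y,\delta_x\rangle$, $T$ has finite propagation if $\sup\{d(x,y):T_{x,y}\neq0\}<\infty$. $C^*_u(X)$ is the operator norm closure in $\mathfrak B(\ell^2(X))$ of the $*$-algebra of all finite propagation operators. Ordinal number $\mathrm{Ord}$. For a set $L$ let $\mathrm{Fin}\,L$ be the collection of all finite non-empty subsets of $L$. For $M\subseteq\mathrm{Fin}\,L$ and $a\in L$ put $M^a=\{\tau\in\mathrm{Fin}\,L:\tau\cup\{a\}\in M,\ a\notin\tau\}$. Define $\mathrm{Ord}\,M$ (an ordinal or $\infty$)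 inductively: $\mathrm{Ord}\,M=0$ iff $M=\varnothing$; $\mathrm{Ord}\,M\leq\alpha$ iff $\mathrm{Ord}\,M^a<\alpha$ for all $a\in L$ (for $\alpha>0$); $\mathrm{Ord}\,M=\alpha$ iff $\mathrm{Ord}\,M\leq\alpha$ and $\mathrm{Ord}\,M<\alpha$ is not true; $\mathrm{Ord}\,M=\infty$ iff $\mathrm{Ord}\,M\leq\alpha$ holds for no ordinal $\alpha$. Transfinite asymptotic dimension. $A(X,d)\subseteq\mathrm{Fin}\,\mathbb{N}$ consists of those $\sigma=\{t_0,\dots,t_n\}$ (distinct elements) for which there are no uniformly bounded families $\mathcal U_0,\dots,\mathcal U_n$ of subsets of $X$ such that $\bigcup_{i=0}^n\mathcal U_i$ covers $X$ and each $\mathcal U_i$ is $t_i$-disjoint. $\mathrm{trasdim}\,X=\mathrm{Ord}\,A(X,d)$. The set $N(\mathcal F,q)$. For a $C^*$-algebra $A$, a finite subset $\mathcal F\subseteq A$ and an integer $q\geq1$, $N(\mathcal F,q)\subseteq\mathrm{Fin}\,\mathbb{N}$ consists of those $\sigma=\{t_0<t_1<\cdots<t_n\}$ such that $t_0\geq q$ and there does not exist $(F,\psi,\phi)$ where (a) $F=F^{(0)}\oplus\cdots\oplus F^{(n)}$ is a finite-dimensional $C^*$-algebra; (b) $\psi=\psi^{(0)}\oplus\cdots\oplus\psi^{(n)}:A\to F$ is c.p.c. with $\psi^{(i)}:A\to F^{(i)}$; (c) $\phi:F\to A$ is c.p. and each restriction $\phi^{(i)}:=\phi|_{F^{(i)}}:F^{(i)}\to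 A$ is contractive and order zero; satisfying: (1) for any $i=0,\dots,n$ and $a,b\in\mathcal F$ there exist $a',b'\in A$ with $\|a-a'\|<1/q$, $\|b-b'\|<1/q$ and $\|\psi^{(i)}(a')\psi^{(i)}(b')\|<1/t_i+\|a'b'\|$; (2) $\|\phi\circ\psi(a)-a\|<1/q$ for all $a\in\mathcal F$. Transfinite nuclear dimension. For an ordinal $\alpha$, $\mathrm{trnudim}\,A\leq\alpha$ means $\mathrm{Ord}\,N(\mathcal F,q)\leq\alpha$ for every integer $q\geq1$ and every finite $\mathcal F\subseteq A$. *)

theory Defs
  imports "HOL-Analysis.Analysis"
begin

section \<open>The ordinal number Ord\<close>

definition Fin :: "'l set \<Rightarrow> 'l set set" where
  "Fin L = {\<tau>. \<tau> \<subseteq> L \<and> finite \<tau> \<and> \<tau> \<noteq> {}}"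

text \<open>The ground set is the whole type \<^typ>\<open>'l\<close>.\<close>

definition Ord_link :: "'l set set \<Rightarrow> 'l \<Rightarrow> 'l set set" where
  "Ord_link M a = {\<tau> \<in> Fin UNIV. insert a \<tau> \<in> M \<and> a \<notin> \<tau>}"

text \<open>
  An ordinal is an element of an arbitrary well-ordered type: \<open>\<alpha>\<close> stands for the order type
  of \<open>{\<beta>. \<beta> < \<alpha>}\<close>. In particular the ordinal 0 is the least element, and \<open>\<alpha> > 0\<close> means that
  some \<open>\<beta> < \<alpha>\<close> exists. The type of ordinals is left polymorphic, so that a statement about all
  \<open>\<alpha> :: 'o::wellorder\<close> is not confined to one fixed stock of ordinals.
  \<open>Ord_le M \<alpha>\<close>, \<open>Ord_less M \<alpha>\<close>, \<open>Ord_eq M \<alpha>\<close> stand for \<open>Ord M \<le> \<alpha>\<close>, \<open>Ord M < \<alpha>\<close>, \<open>Ord M = \<alpha>\<close>;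
  \<open>Ord M = \<infinity>\<close> means that \<open>Ord_le M \<alpha>\<close> never holds.
\<close>

context
  notes conj_cong [fundef_cong]
begin

function Ord_le :: "'l set set \<Rightarrow> 'o::wellorder \<Rightarrow> bool" where
  "Ord_le M \<alpha> =
     (if (\<exists>\<beta>. \<beta> < \<alpha>) then (\<forall>a. \<exists>\<beta>. \<beta> < \<alpha> \<and> Ord_le (Ord_link M a) \<beta>) else M = {})"
  by pat_completeness auto
termination
  by (relation "inv_image {(x, y). x < y} snd") (auto intro: wf)

end

declare Ord_le.simps [simp del]

definition Ord_less :: "'l set set \<Rightarrow> 'o::wellorder \<Rightarrow> bool" where
  "Ord_less M \<alpha> \<longleftrightarrow> (\<exists>\<beta><\<alpha>. Ord_le M \<beta>)"

definition Ord_eq :: "'l set set \<Rightarrow> 'o::wellorder \<Rightarrow> bool" where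
  "Ord_eq M \<alpha> \<longleftrightarrow> Ord_le M \<alpha> \<and> \<not> Ord_less M \<alpha>"


section \<open>Metric notions\<close>

text \<open>The metric space \<open>X\<close> is the type \<^typ>\<open>'x\<close>.\<close>

definition bounded_geometry :: "'x::metric_space itself \<Rightarrow> bool" where
  "bounded_geometry _ \<longleftrightarrow>
     (\<forall>r>0. \<exists>N::nat. \<forall>x::'x. finite (cball x r) \<and> card (cball x r) \<le> N)"

definition uniformly_bounded :: "'x::metric_space set set \<Rightarrow> bool" where
  "uniformly_bounded \<U> \<longleftrightarrow> (\<exists>R. \<forall>U\<in>\<U>. \<forall>x\<in>U. \<forall>y\<in>U. dist x y \<le> R)"

text \<open>\<open>d(U,V) \<ge> r\<close> is spelled out pointwise, so that an infimum over the empty set is \<open>\<infinity>\<close>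
  (whereas \<^const>\<open>setdist\<close> would give 0).\<close>

definition r_disjoint :: "real \<Rightarrow> 'x::metric_space set set \<Rightarrow> bool" where
  "r_disjoint r \<U> \<longleftrightarrow> (\<forall>U\<in>\<U>. \<forall>V\<in>\<U>. U \<noteq> V \<longrightarrow> (\<forall>x\<in>U. \<forall>y\<in>V. r \<le> dist x y))"

text \<open>Here and in \<open>nudim_set\<close> below, what belongs to \<open>t\<^sub>0, \<dots>, t\<^sub>n\<close> is indexed by the
  elements \<open>t \<in> \<sigma>\<close> themselves instead of the positions \<open>0, \<dots>, n\<close>.\<close>

definition asdim_set :: "'x::metric_space itself \<Rightarrow> nat set set" where
  "asdim_set _ = {\<sigma> \<in> Fin UNIV.
     \<not> (\<exists>\<U> :: nat \<Rightarrow> 'x set set.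
          (\<forall>t\<in>\<sigma>. uniformly_bounded (\<U> t) \<and> r_disjoint (real t) (\<U> t)) \<and>
          (\<Union>t\<in>\<sigma>. \<Union>(\<U> t)) = UNIV)}"

definition trasdim_eq :: "'x::metric_space itself \<Rightarrow> 'o::wellorder \<Rightarrow> bool" where
  "trasdim_eq X \<alpha> \<longleftrightarrow> Ord_eq (asdim_set X) \<alpha>"


section \<open>C*-algebras\<close>

record 'a star_alg =
  car :: "'a set"
  nul :: "'a"  (\<open>\<zero>\<index>\<close>)
  pls :: "'a \<Rightarrow> 'a \<Rightarrow> 'a"  (infixl \<open>\<oplus>\<index>\<close> 65)
  scl :: "complex \<Rightarrow> 'a \<Rightarrow> 'a"  (infixr \<open>\<odot>\<index>\<close> 75)
  tms :: "'a \<Rightarrow> 'a \<Rightarrow> 'a"  (infixl \<open>\<otimes>\<index>\<close> 70)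
  adj :: "'a \<Rightarrow> 'a"
  nrm :: "'a \<Rightarrow> real"

definition mns :: "('a, 'b) star_alg_scheme \<Rightarrow> 'a \<Rightarrow> 'a \<Rightarrow> 'a"  (infixl \<open>\<ominus>\<index>\<close> 65) where
  "x \<ominus>\<^bsub>A\<^esub> y = x \<oplus>\<^bsub>A\<^esub> ((-1) \<odot>\<^bsub>A\<^esub> y)"

locale cstar_algebra =
  fixes A :: "('a, 'b) star_alg_scheme" (structure)
  assumes nul_closed: "\<zero> \<in> car A"
    and pls_closed: "\<lbrakk>x \<in> car A; y \<in> car A\<rbrakk> \<Longrightarrow> x \<oplus> y \<in> car A"
    and scl_closed: "x \<in> car A \<Longrightarrow> c \<odot> x \<in> car A"
    and tms_closed: "\<lbrakk>x \<in> car A; y \<in> car A\<rbrakk> \<Longrightarrow> x \<otimes> y \<in> car A"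
    and adj_closed: "x \<in> car A \<Longrightarrow> adj A x \<in> car A"
    and pls_assoc: "\<lbrakk>x \<in> car A; y \<in> car A; z \<in> car A\<rbrakk> \<Longrightarrow> (x \<oplus> y) \<oplus> z = x \<oplus> (y \<oplus> z)"
    and pls_commute: "\<lbrakk>x \<in> car A; y \<in> car A\<rbrakk> \<Longrightarrow> x \<oplus> y = y \<oplus> x"
    and pls_nul: "x \<in> car A \<Longrightarrow> x \<oplus> \<zero> = x"
    and mns_self: "x \<in> car A \<Longrightarrow> x \<ominus> x = \<zero>"
    and scl_one: "x \<in> car A \<Longrightarrow> 1 \<odot> x = x"
    and scl_scl: "x \<in> car A \<Longrightarrow> c \<odot> d \<odot> x = (c * d) \<odot> x"
    and scl_pls_left: "x \<in> car A \<Longrightarrow> (c + d) \<odot> x = c \<odot> x \<oplus> d \<odot> x"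
    and scl_pls_right: "\<lbrakk>x \<in> car A; y \<in> car A\<rbrakk> \<Longrightarrow> c \<odot> (x \<oplus> y) = c \<odot> x \<oplus> c \<odot> y"
    and tms_assoc: "\<lbrakk>x \<in> car A; y \<in> car A; z \<in> car A\<rbrakk> \<Longrightarrow> (x \<otimes> y) \<otimes> z = x \<otimes> (y \<otimes> z)"
    and tms_pls_left: "\<lbrakk>x \<in> car A; y \<in> car A; z \<in> car A\<rbrakk> \<Longrightarrow> (x \<oplus> y) \<otimes> z = x \<otimes> z \<oplus> y \<otimes> z"
    and tms_pls_right: "\<lbrakk>x \<in> car A; y \<in> car A; z \<in> car A\<rbrakk> \<Longrightarrow> x \<otimes> (y \<oplus> z) = x \<otimes> y \<oplus> x \<otimes> z"
    and tms_scl_left: "\<lbrakk>x \<in> car A; y \<in> car A\<rbrakk> \<Longrightarrow> (c \<odot> x) \<otimes> y = c \<odot> (x \<otimes> y)"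
    and tms_scl_right: "\<lbrakk>x \<in> car A; y \<in> car A\<rbrakk> \<Longrightarrow> x \<otimes> (c \<odot> y) = c \<odot> (x \<otimes> y)"
    and adj_adj: "x \<in> car A \<Longrightarrow> adj A (adj A x) = x"
    and adj_pls: "\<lbrakk>x \<in> car A; y \<in> car A\<rbrakk> \<Longrightarrow> adj A (x \<oplus> y) = adj A x \<oplus> adj A y"
    and adj_scl: "x \<in> car A \<Longrightarrow> adj A (c \<odot> x) = cnj c \<odot> adj A x"
    and adj_tms: "\<lbrakk>x \<in> car A; y \<in> car A\<rbrakk> \<Longrightarrow> adj A (x \<otimes> y) = adj A y \<otimes> adj A x"
    and nrm_nonneg: "x \<in> car A \<Longrightarrow> 0 \<le> nrm A x"
    and nrm_eq_0_iff: "x \<in> car A \<Longrightarrow> nrm A x = 0 \<longleftrightarrow> x = \<zero>"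
    and nrm_triangle: "\<lbrakk>x \<in> car A; y \<in> car A\<rbrakk> \<Longrightarrow> nrm A (x \<oplus> y) \<le> nrm A x + nrm A y"
    and nrm_scl: "x \<in> car A \<Longrightarrow> nrm A (c \<odot> x) = cmod c * nrm A x"
    and nrm_tms: "\<lbrakk>x \<in> car A; y \<in> car A\<rbrakk> \<Longrightarrow> nrm A (x \<otimes> y) \<le> nrm A x * nrm A y"
    and cstar_identity: "x \<in> car A \<Longrightarrow> nrm A (adj A x \<otimes> x) = (nrm A x)\<^sup>2"
    and complete:
      "\<lbrakk>\<And>n::nat. s n \<in> car A;
        \<And>e. e > 0 \<Longrightarrow> \<exists>N. \<forall>m\<ge>N. \<forall>n\<ge>N. nrm A (s m \<ominus> s n) < e\<rbrakk>
       \<Longrightarrow> \<exists>x\<in>car A. (\<lambda>n. nrm A (s n \<ominus> x)) \<longlonglongrightarrow> 0"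

primrec alg_sum :: "('a, 'b) star_alg_scheme \<Rightarrow> (nat \<Rightarrow> 'a) \<Rightarrow> nat \<Rightarrow> 'a" where
  "alg_sum A f 0 = \<zero>\<^bsub>A\<^esub>"
| "alg_sum A f (Suc n) = alg_sum A f n \<oplus>\<^bsub>A\<^esub> f n"

definition finite_dimensional :: "('a, 'b) star_alg_scheme \<Rightarrow> bool" where
  "finite_dimensional A \<longleftrightarrow>
     (\<exists>n b. (\<forall>k<n. b k \<in> car A) \<and>
            (\<forall>x\<in>car A. \<exists>c. x = alg_sum A (\<lambda>k. c k \<odot>\<^bsub>A\<^esub> b k) n))"

definition positive :: "('a, 'b) star_alg_scheme \<Rightarrow> 'a \<Rightarrow> bool" where
  "positive A x \<longleftrightarrow> (\<exists>b\<in>car A. x = adj A b \<otimes>\<^bsub>A\<^esub> b)"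

text \<open>Positivity in the matrix algebra \<open>M\<^sub>n(A)\<close>: the matrix \<open>(x\<^sub>i\<^sub>j)\<^sub>i\<^sub>,\<^sub>j\<^sub><\<^sub>n\<close> is \<open>b\<^sup>* b\<close> for some
  \<open>b \<in> M\<^sub>n(A)\<close>; entries with an index \<open>\<ge> n\<close> are ignored.\<close>

definition positive_mat :: "('a, 'b) star_alg_scheme \<Rightarrow> nat \<Rightarrow> (nat \<Rightarrow> nat \<Rightarrow> 'a) \<Rightarrow> bool" where
  "positive_mat A n x \<longleftrightarrow>
     (\<exists>b. (\<forall>i<n. \<forall>j<n. b i j \<in> car A) \<and>
          (\<forall>i<n. \<forall>j<n. x i j = alg_sum A (\<lambda>k. adj A (b k i) \<otimes>\<^bsub>A\<^esub> b k j) n))"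

definition linear_map ::
    "('a, 'c) star_alg_scheme \<Rightarrow> ('b, 'd) star_alg_scheme \<Rightarrow> ('a \<Rightarrow> 'b) \<Rightarrow> bool" where
  "linear_map A B \<phi> \<longleftrightarrow>
     (\<forall>x\<in>car A. \<phi> x \<in> car B) \<and>
     (\<forall>x\<in>car A. \<forall>y\<in>car A. \<phi> (x \<oplus>\<^bsub>A\<^esub> y) = \<phi> x \<oplus>\<^bsub>B\<^esub> \<phi> y) \<and>
     (\<forall>c. \<forall>x\<in>car A. \<phi> (c \<odot>\<^bsub>A\<^esub> x) = c \<odot>\<^bsub>B\<^esub> \<phi> x)"

definition completely_positive ::
    "('a, 'c) star_alg_scheme \<Rightarrow> ('b, 'd) star_alg_scheme \<Rightarrow> ('a \<Rightarrow> 'b) \<Rightarrow> bool" where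
  "completely_positive A B \<phi> \<longleftrightarrow>
     linear_map A B \<phi> \<and>
     (\<forall>n x. positive_mat A n x \<longrightarrow> positive_mat B n (\<lambda>i j. \<phi> (x i j)))"

definition contractive ::
    "('a, 'c) star_alg_scheme \<Rightarrow> ('b, 'd) star_alg_scheme \<Rightarrow> ('a \<Rightarrow> 'b) \<Rightarrow> bool" where
  "contractive A B \<phi> \<longleftrightarrow> (\<forall>x\<in>car A. nrm B (\<phi> x) \<le> nrm A x)"

definition order_zero ::
    "('a, 'c) star_alg_scheme \<Rightarrow> ('b, 'd) star_alg_scheme \<Rightarrow> ('a \<Rightarrow> 'b) \<Rightarrow> bool" where
  "order_zero A B \<phi> \<longleftrightarrow>
     completely_positive A B \<phi> \<and>
     (\<forall>a b. positive A a \<and> positive A b \<and> a \<otimes>\<^bsub>A\<^esub> b = \<zero>\<^bsub>A\<^esub> \<and> b \<otimes>\<^bsub>A\<^esub> a = \<zero>\<^bsub>A\<^esub> \<longrightarrow>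
        \<phi> a \<otimes>\<^bsub>B\<^esub> \<phi> b = \<zero>\<^bsub>B\<^esub> \<and> \<phi> b \<otimes>\<^bsub>B\<^esub> \<phi> a = \<zero>\<^bsub>B\<^esub>)"

text \<open>Only meant for finite nonempty \<open>I\<close>: otherwise the maximum in the norm is meaningless.\<close>

definition direct_sum :: "'i set \<Rightarrow> ('i \<Rightarrow> 'a star_alg) \<Rightarrow> ('i \<Rightarrow> 'a) star_alg" where
  "direct_sum I F =
     \<lparr>car = (\<Pi>\<^sub>E i\<in>I. car (F i)),
      nul = (\<lambda>i\<in>I. nul (F i)),
      pls = (\<lambda>x y. \<lambda>i\<in>I. pls (F i) (x i) (y i)),
      scl = (\<lambda>c x. \<lambda>i\<in>I. scl (F i) c (x i)),
      tms = (\<lambda>x y. \<lambda>i\<in>I. tms (F i) (x i) (y i)),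
      adj = (\<lambda>x. \<lambda>i\<in>I. adj (F i) (x i)),
      nrm = (\<lambda>x. MAX i\<in>I. nrm (F i) (x i))\<rparr>"

definition summand_incl :: "'i set \<Rightarrow> ('i \<Rightarrow> 'a star_alg) \<Rightarrow> 'i \<Rightarrow> 'a \<Rightarrow> ('i \<Rightarrow> 'a)" where
  "summand_incl I F i x = (\<lambda>j\<in>I. if j = i then x else nul (F j))"


section \<open>Transfinite nuclear dimension\<close>

text \<open>
  The summands range over all finite-dimensional C*-algebras with elements taken from
  \<^typ>\<open>nat \<Rightarrow> complex\<close>. This is no restriction: coordinates with respect to a basis give an
  isomorphic copy of any finite-dimensional C*-algebra there.
\<close>

definition nudim_set :: "'a star_alg \<Rightarrow> 'a set \<Rightarrow> nat \<Rightarrow> nat set set" where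
  "nudim_set A \<F> q = {\<sigma> \<in> Fin UNIV. (\<forall>t\<in>\<sigma>. q \<le> t) \<and>
     \<not> (\<exists>(F :: nat \<Rightarrow> (nat \<Rightarrow> complex) star_alg) \<psi> \<phi>.
          (\<forall>t\<in>\<sigma>. cstar_algebra (F t) \<and> finite_dimensional (F t)) \<and>
          completely_positive A (direct_sum \<sigma> F) \<psi> \<and>
          contractive A (direct_sum \<sigma> F) \<psi> \<and>
          completely_positive (direct_sum \<sigma> F) A \<phi> \<and>
          (\<forall>t\<in>\<sigma>. contractive (F t) A (\<phi> \<circ> summand_incl \<sigma> F t) \<and>
                 order_zero (F t) A (\<phi> \<circ> summand_incl \<sigma> F t)) \<and>
          (\<forall>t\<in>\<sigma>. \<forall>a\<in>\<F>. \<forall>b\<in>\<F>. \<exists>a'\<in>car A. \<exists>b'\<in>car A.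
             nrm A (a \<ominus>\<^bsub>A\<^esub> a') < 1 / real q \<and>
             nrm A (b \<ominus>\<^bsub>A\<^esub> b') < 1 / real q \<and>
             nrm (F t) (\<psi> a' t \<otimes>\<^bsub>F t\<^esub> \<psi> b' t) < 1 / real t + nrm A (a' \<otimes>\<^bsub>A\<^esub> b')) \<and>
          (\<forall>a\<in>\<F>. nrm A (\<phi> (\<psi> a) \<ominus>\<^bsub>A\<^esub> a) < 1 / real q))}"

definition trnudim_le :: "'a star_alg \<Rightarrow> 'o::wellorder \<Rightarrow> bool" where
  "trnudim_le A \<alpha> \<longleftrightarrow>
     (\<forall>q\<ge>1. \<forall>\<F>. finite \<F> \<and> \<F> \<subseteq> car A \<longrightarrow> Ord_le (nudim_set A \<F> q) \<alpha>)"


section \<open>The Hilbert space of square summable functions\<close>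

typedef 'x ell2 = "{f :: 'x \<Rightarrow> complex. (\<lambda>x. (cmod (f x))\<^sup>2) summable_on UNIV}"
  morphisms ell2_nth Abs_ell2
  by (rule exI [of _ "\<lambda>_. 0"]) simp

setup_lifting type_definition_ell2

lemma ell2_summable: "(\<lambda>x. (cmod (ell2_nth f x))\<^sup>2) summable_on UNIV"
  using ell2_nth [of f] by simp

lemma ell2_summable_add:
  fixes f g :: "'x \<Rightarrow> complex"
  assumes "(\<lambda>x. (cmod (f x))\<^sup>2) summable_on UNIV" "(\<lambda>x. (cmod (g x))\<^sup>2) summable_on UNIV"
  shows "(\<lambda>x. (cmod (f x + g x))\<^sup>2) summable_on UNIV"
proof (rule summable_on_comparison_test)
  show "(\<lambda>x. 2 * ((cmod (f x))\<^sup>2 + (cmod (g x))\<^sup>2)) summable_on UNIV"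
    using assms by (intro summable_on_cmult_right summable_on_add)
  fix x
  have "(cmod (f x + g x))\<^sup>2 \<le> (cmod (f x) + cmod (g x))\<^sup>2"
    by (intro power_mono norm_triangle_ineq) simp
  also have "\<dots> \<le> 2 * ((cmod (f x))\<^sup>2 + (cmod (g x))\<^sup>2)"
    using sum_squares_bound [of "cmod (f x)" "cmod (g x)"] by (simp add: power2_sum)
  finally show "(cmod (f x + g x))\<^sup>2 \<le> 2 * ((cmod (f x))\<^sup>2 + (cmod (g x))\<^sup>2)" .
qed auto

lemma ell2_summable_scale:
  fixes f :: "'x \<Rightarrow> complex"
  assumes "(\<lambda>x. (cmod (f x))\<^sup>2) summable_on UNIV"
  shows "(\<lambda>x. (cmod (c * f x))\<^sup>2) summable_on UNIV"
  using summable_on_cmult_right [OF assms, of "(cmod c)\<^sup>2"]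
  by (simp add: norm_mult power_mult_distrib)

lift_definition ell2_scale :: "complex \<Rightarrow> 'x ell2 \<Rightarrow> 'x ell2" is "\<lambda>c f x. c * f x"
  by (simp add: ell2_summable_scale)

lift_definition cinner :: "'x ell2 \<Rightarrow> 'x ell2 \<Rightarrow> complex" is
  "\<lambda>f g. \<Sum>\<^sub>\<infinity>x. f x * cnj (g x)" .

lemma cinner_summable: "(\<lambda>x. ell2_nth f x * cnj (ell2_nth g x)) summable_on UNIV"
proof -
  have "(\<lambda>x. norm (ell2_nth f x * cnj (ell2_nth g x))) summable_on UNIV"
  proof (rule summable_on_comparison_test)
    show "(\<lambda>x. (cmod (ell2_nth f x))\<^sup>2 + (cmod (ell2_nth g x))\<^sup>2) summable_on UNIV"
      by (intro summable_on_add ell2_summable)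
    fix x
    have "2 * (cmod (ell2_nth f x) * cmod (ell2_nth g x))
        \<le> (cmod (ell2_nth f x))\<^sup>2 + (cmod (ell2_nth g x))\<^sup>2"
      using sum_squares_bound [of "cmod (ell2_nth f x)" "cmod (ell2_nth g x)"] by simp
    moreover have "0 \<le> cmod (ell2_nth f x) * cmod (ell2_nth g x)"
      by simp
    ultimately show "norm (ell2_nth f x * cnj (ell2_nth g x))
        \<le> (cmod (ell2_nth f x))\<^sup>2 + (cmod (ell2_nth g x))\<^sup>2"
      unfolding norm_mult complex_mod_cnj by linarith
  qed auto
  then show ?thesis
    by (rule abs_summable_summable)
qed

instantiation ell2 :: (type) real_vector
begin

lift_definition zero_ell2 :: "'a ell2" is "\<lambda>_. 0"
  by simp
lift_definition plus_ell2 :: "'a ell2 \<Rightarrow> 'a ell2 \<Rightarrow> 'a ell2" is "\<lambda>f g x. f x + g x"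
  by (simp add: ell2_summable_add)
lift_definition uminus_ell2 :: "'a ell2 \<Rightarrow> 'a ell2" is "\<lambda>f x. - f x"
  by simp
definition minus_ell2 :: "'a ell2 \<Rightarrow> 'a ell2 \<Rightarrow> 'a ell2" where
  "minus_ell2 f g = f + - g"
definition scaleR_ell2 :: "real \<Rightarrow> 'a ell2 \<Rightarrow> 'a ell2" where
  "scaleR_ell2 r = ell2_scale (of_real r)"

instance
  by standard
    (unfold minus_ell2_def scaleR_ell2_def, (transfer, simp add: algebra_simps fun_eq_iff)+)

end

instantiation ell2 :: (type) real_inner
begin

definition inner_ell2 :: "'a ell2 \<Rightarrow> 'a ell2 \<Rightarrow> real" where
  "inner_ell2 f g = Re (cinner f g)"
definition norm_ell2 :: "'a ell2 \<Rightarrow> real" where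
  "norm_ell2 f = sqrt (inner f f)"
definition dist_ell2 :: "'a ell2 \<Rightarrow> 'a ell2 \<Rightarrow> real" where
  "dist_ell2 f g = norm (f - g)"
definition sgn_ell2 :: "'a ell2 \<Rightarrow> 'a ell2" where
  "sgn_ell2 f = f /\<^sub>R norm f"
definition uniformity_ell2 :: "('a ell2 \<times> 'a ell2) filter" where
  "uniformity_ell2 = (INF e\<in>{0 <..}. principal {(f, g). dist f g < e})"
definition open_ell2 :: "'a ell2 set \<Rightarrow> bool" where
  "open_ell2 U = (\<forall>f\<in>U. eventually (\<lambda>(f', g). f' = f \<longrightarrow> g \<in> U) uniformity)"

instance
proof
  fix f g h :: "'a ell2" and r :: real
  have self: "inner f f = (\<Sum>\<^sub>\<infinity>x. (cmod (ell2_nth f x))\<^sup>2)" for f :: "'a ell2"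
  proof -
    have "inner f f = (\<Sum>\<^sub>\<infinity>x. Re (ell2_nth f x * cnj (ell2_nth f x)))"
      unfolding inner_ell2_def cinner.rep_eq by (rule infsum_Re [OF cinner_summable, symmetric])
    then show ?thesis
      by (simp add: complex_mult_cnj cmod_power2)
  qed
  show "dist f g = norm (f - g)" by (rule dist_ell2_def)
  show "sgn f = f /\<^sub>R norm f" by (rule sgn_ell2_def)
  show "uniformity = (INF e\<in>{0 <..}. principal {(f, g :: 'a ell2). dist f g < e})"
    by (rule uniformity_ell2_def)
  show "open U = (\<forall>f\<in>U. eventually (\<lambda>(f', g). f' = f \<longrightarrow> g \<in> U) uniformity)"
    for U :: "'a ell2 set" by (rule open_ell2_def)
  have "cinner f g = cnj (cinner g f)"
    unfolding cinner.rep_eq infsum_cnj [symmetric] by (simp add: mult.commute)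
  then show "inner f g = inner g f"
    by (simp add: inner_ell2_def)
  show "inner (f + g) h = inner f h + inner g h"
    unfolding inner_ell2_def cinner.rep_eq plus_ell2.rep_eq
    by (simp add: distrib_right infsum_add cinner_summable)
  show "inner (r *\<^sub>R f) g = r * inner f g"
    unfolding inner_ell2_def cinner.rep_eq scaleR_ell2_def ell2_scale.rep_eq
    by (simp add: mult.assoc infsum_cmult_right')
  show "0 \<le> inner f f"
    unfolding self by (intro infsum_nonneg) simp
  show "inner f f = 0 \<longleftrightarrow> f = 0"
  proof
    assume "inner f f = 0"
    then have "(cmod (ell2_nth f x))\<^sup>2 = 0" for x
      using nonneg_infsum_le_0D [OF _ ell2_summable, of f x] by (simp add: self)
    then show "f = 0"
      by (simp add: ell2_nth_inject [symmetric] fun_eq_iff zero_ell2.rep_eq)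
  qed (simp add: self zero_ell2.rep_eq)
  show "norm f = sqrt (inner f f)" by (rule norm_ell2_def)
qed

end

lift_definition delta :: "'x \<Rightarrow> 'x ell2" is "\<lambda>y x. if x = y then 1 else 0"
proof -
  fix y :: 'x
  have "(\<lambda>x. (cmod (if x = y then 1 else 0 :: complex))\<^sup>2) summable_on UNIV
      \<longleftrightarrow> (\<lambda>x. (cmod (if x = y then 1 else 0 :: complex))\<^sup>2) summable_on {y}"
    by (rule summable_on_cong_neutral) auto
  then show "(\<lambda>x. (cmod (if x = y then 1 else 0 :: complex))\<^sup>2) summable_on UNIV"
    by simp
qed


section \<open>The uniform Roe algebra\<close>

text \<open>\<^typ>\<open>'x ell2 \<Rightarrow>\<^sub>L 'x ell2\<close> consists of the bounded \<^emph>\<open>real\<close>-linear operators, with the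
  operator norm; the complex-linear ones among them form \<open>B(\<ell>\<^sup>2(X))\<close>, a closed subspace.\<close>

type_synonym 'x operator = "'x ell2 \<Rightarrow>\<^sub>L 'x ell2"

definition complex_linear :: "'x operator \<Rightarrow> bool" where
  "complex_linear T \<longleftrightarrow>
     (\<forall>c f. blinfun_apply T (ell2_scale c f) = ell2_scale c (blinfun_apply T f))"

definition mat_entry :: "'x operator \<Rightarrow> 'x \<Rightarrow> 'x \<Rightarrow> complex" where
  "mat_entry T x y = cinner (blinfun_apply T (delta y)) (delta x)"

definition finite_propagation :: "'x::metric_space operator \<Rightarrow> bool" where
  "finite_propagation T \<longleftrightarrow> (\<exists>R. \<forall>x y. mat_entry T x y \<noteq> 0 \<longrightarrow> dist x y \<le> R)"

lemma bounded_linear_ell2_scale: "bounded_linear (ell2_scale c :: 'x ell2 \<Rightarrow> 'x ell2)"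
proof (rule bounded_linear_intro)
  fix f g :: "'x ell2" and r :: real
  show "ell2_scale c (f + g) = ell2_scale c f + ell2_scale c g"
    by transfer (simp add: algebra_simps)
  show "ell2_scale c (r *\<^sub>R f) = r *\<^sub>R ell2_scale c f"
    unfolding scaleR_ell2_def by transfer (simp add: algebra_simps)
  have "cinner (ell2_scale c f) (ell2_scale c f)
      = (\<Sum>\<^sub>\<infinity>x. (c * cnj c) * (ell2_nth f x * cnj (ell2_nth f x)))"
    unfolding cinner.rep_eq ell2_scale.rep_eq by (intro infsum_cong) (simp add: algebra_simps)
  also have "\<dots> = of_real ((cmod c)\<^sup>2) * cinner f f"
    unfolding cinner.rep_eq
    by (simp add: infsum_cmult_right' flip: complex_norm_square)
  finally have "inner (ell2_scale c f) (ell2_scale c f) = (cmod c)\<^sup>2 * inner f f"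
    by (simp add: inner_ell2_def)
  then show "norm (ell2_scale c f) \<le> norm f * cmod c"
    by (simp add: norm_ell2_def real_sqrt_mult)
qed

definition scale_operator :: "complex \<Rightarrow> 'x operator \<Rightarrow> 'x operator" where
  "scale_operator c T = Blinfun (\<lambda>f. ell2_scale c (blinfun_apply T f))"

lemma scale_operator_apply:
  "blinfun_apply (scale_operator c T) f = ell2_scale c (blinfun_apply T f)"
  unfolding scale_operator_def
  by (simp add: bounded_linear_Blinfun_apply blinfun.bounded_linear_right
      bounded_linear_compose [OF bounded_linear_ell2_scale])

definition operator_adj :: "'x operator \<Rightarrow> 'x operator" where
  "operator_adj T =
     (THE S. \<forall>f g. cinner (blinfun_apply T f) g = cinner f (blinfun_apply S g))"

definition uniform_Roe :: "'x::metric_space operator star_alg" where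
  "uniform_Roe =
     \<lparr>car = closure {T. complex_linear T \<and> finite_propagation T},
      nul = 0,
      pls = (+),
      scl = scale_operator,
      tms = (o\<^sub>L),
      adj = operator_adj,
      nrm = norm\<rparr>"

end

theory Submission
  imports Defs
begin


text \<open>
  Uniformly bounded families \<open>\<U>\<^sub>t\<close> (\<open>t \<in> \<sigma>\<close>) that cover \<open>X\<close>, with \<open>\<U>\<^sub>t\<close> being \<open>g(t)\<close>-disjoint for
  a fast growing \<open>g\<close>, give functions \<open>k\<^sub>t\<close> with \<open>\<Sum> k\<^sub>t\<^sup>2 = 1\<close> that vary slowly and whose supports
  split into bounded, well separated blocks. Compressing \<open>a\<close> to \<open>k\<^sub>t a k\<^sub>t\<close> on these blocks and
  adding up over \<open>t\<close> changes an operator of small propagation only a little, and it is almost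
  multiplicative on such operators because \<open>k\<^sub>t\<close> almost commutes with them. There are infinitely
  many blocks, but by bounded geometry only finitely many of them look different to the finitely
  many given operators, up to a small error; so \<open>\<psi>\<close> records the compressions to finitely many model
  blocks and \<open>\<phi>\<close> copies each model block to all the blocks that look like it. Hence
  \<open>\<sigma> \<in> N(\<F>, q)\<close> implies \<open>g(\<sigma>) \<in> A(X, d)\<close>, and \<open>Ord\<close> is monotone under such injections \<open>g\<close>.
  Complete positivity of the sum \<open>\<phi>\<close> of homomorphisms rests on square roots of positive elements in
  matrix algebras over \<open>C\<^sup>*\<^sub>u(X)\<close>.
\<close>

section \<open>Square summable functions\<close>

text \<open>\<open>Ord\<close> compares sets element by element, so \<open>g\<close> has to be fixed
  from \<open>\<F>\<close> and \<open>q\<close> before any \<open>\<sigma>\<close> is known, and no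
  estimate may degrade with the number of summands. Hence the errors attached to the index
  \<open>t\<close> are proportional to \<open>(1/2) ^ t\<close>: this is summable over all
  \<open>t\<close>, and it lies below the tolerance \<open>1 / t\<close> that is granted for
  products. Entrywise estimates need finite propagation, but the members of \<open>\<F>\<close> are
  only norm limits of such operators. In condition (1) the approximants may serve as
  \<open>a'\<close> and \<open>b'\<close>. In condition (2) the remainder has to be controlled by
  its norm alone; here \<open>\<Sum> k\<^sub>t\<^sup>2 = 1\<close> is essential, because it bounds
  the sum over \<open>t\<close> without counting its terms. A positive matrix of size
  \<open>n\<close> is one with a single factor of the same size \<open>n\<close>. Adding two such
  matrices therefore requires a square root, and compressing one to finite blocks requires a finite
  dimensional factor of its Gram matrix.\<close>

lemma ell2_eqI: "(\<And>x. ell2_nth f x = ell2_nth g x) \<Longrightarrow> f = g"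
  by (simp add: ell2_nth_inject[symmetric] fun_eq_iff)

lemma ell2_nth_zero [simp]: "ell2_nth 0 x = 0"
  by (simp add: zero_ell2.rep_eq)

lemma ell2_nth_plus [simp]: "ell2_nth (f + g) x = ell2_nth f x + ell2_nth g x"
  by (simp add: plus_ell2.rep_eq)

lemma ell2_nth_uminus [simp]: "ell2_nth (- f) x = - ell2_nth f x"
  by (simp add: uminus_ell2.rep_eq)

lemma ell2_nth_minus [simp]: "ell2_nth (f - g) x = ell2_nth f x - ell2_nth g x"
  by (simp only: minus_ell2_def ell2_nth_plus ell2_nth_uminus diff_conv_add_uminus)

lemma ell2_nth_scale [simp]: "ell2_nth (ell2_scale c f) x = c * ell2_nth f x"
  by (simp add: ell2_scale.rep_eq)

lemma ell2_nth_scaleR [simp]: "ell2_nth (r *\<^sub>R f) x = of_real r * ell2_nth f x"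
  by (simp add: scaleR_ell2_def)

lemma ell2_nth_delta: "ell2_nth (delta y) x = (if x = y then 1 else 0)"
  by (simp add: delta.rep_eq)

lemma ell2_nth_sum: "ell2_nth (\<Sum>i\<in>I. f i) x = (\<Sum>i\<in>I. ell2_nth (f i) x)"
  by (induction I rule: infinite_finite_induct) auto

lemma cinner_delta_right [simp]: "cinner f (delta x) = ell2_nth f x"
proof -
  have "cinner f (delta x) = (\<Sum>\<^sub>\<infinity>y\<in>{x}. ell2_nth f y)"
    unfolding cinner.rep_eq ell2_nth_delta by (rule infsum_cong_neutral) auto
  then show ?thesis by simp
qed

lemma cinner_commute: "cinner f g = cnj (cinner g f)"
  unfolding cinner.rep_eq infsum_cnj [symmetric] by (simp add: mult.commute)

lemma cinner_delta_left [simp]: "cinner (delta x) f = cnj (ell2_nth f x)"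
  by (metis cinner_commute cinner_delta_right)

lemma cinner_add_left: "cinner (f + g) h = cinner f h + cinner g h"
  unfolding cinner.rep_eq by (simp add: distrib_right infsum_add cinner_summable)

lemma cinner_add_right: "cinner h (f + g) = cinner h f + cinner h g"
  by (metis cinner_add_left cinner_commute complex_cnj_add)

lemma cinner_scale_left: "cinner (ell2_scale c f) g = c * cinner f g"
  unfolding cinner.rep_eq by (simp add: mult.assoc infsum_cmult_right')

lemma cinner_scale_right: "cinner g (ell2_scale c f) = cnj c * cinner g f"
  by (metis cinner_scale_left cinner_commute complex_cnj_mult)

lemma cinner_scaleR_left: "cinner (r *\<^sub>R f) g = of_real r * cinner f g"
  by (simp add: scaleR_ell2_def cinner_scale_left)

lemma cinner_scaleR_right: "cinner f (r *\<^sub>R g) = of_real r * cinner f g"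
  by (simp add: scaleR_ell2_def cinner_scale_right)

lemma cinner_zero_left [simp]: "cinner 0 f = 0"
  using cinner_add_left[of 0 0 f] by simp

lemma cinner_zero_right [simp]: "cinner f 0 = 0"
  using cinner_add_right[of f 0 0] by simp

lemma cinner_minus_left: "cinner (f - g) h = cinner f h - cinner g h"
  using cinner_add_left[of "f - g" g h] by simp

lemma cinner_minus_right: "cinner h (f - g) = cinner h f - cinner h g"
  using cinner_add_right[of h "f - g" g] by simp

lemma cinner_sum_left: "cinner (\<Sum>i\<in>I. f i) h = (\<Sum>i\<in>I. cinner (f i) h)"
  by (induction I rule: infinite_finite_induct) (auto simp: cinner_add_left)

lemma cinner_sum_right: "cinner h (\<Sum>i\<in>I. f i) = (\<Sum>i\<in>I. cinner h (f i))"
  by (induction I rule: infinite_finite_induct) (auto simp: cinner_add_right)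

lemma cinner_self: "cinner f f = of_real ((norm f)\<^sup>2)"
proof (rule complex_eqI)
  show "Re (cinner f f) = Re (of_real ((norm f)\<^sup>2))"
    by (simp add: power2_norm_eq_inner inner_ell2_def)
  show "Im (cinner f f) = Im (of_real ((norm f)\<^sup>2))"
    using arg_cong[OF cinner_commute[of f f], of Im] by simp
qed

lemma norm_ell2_sq: "(norm f)\<^sup>2 = (\<Sum>\<^sub>\<infinity>x. (cmod (ell2_nth f x))\<^sup>2)"
proof -
  have "(norm f)\<^sup>2 = (\<Sum>\<^sub>\<infinity>x. Re (ell2_nth f x * cnj (ell2_nth f x)))"
    unfolding power2_norm_eq_inner inner_ell2_def cinner.rep_eq
    by (rule infsum_Re [OF cinner_summable, symmetric])
  then show ?thesis
    by (simp add: complex_mult_cnj cmod_power2)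
qed

lemma norm_delta [simp]: "norm (delta x) = 1"
  using cinner_self[of "delta x"] norm_ge_zero[of "delta x"]
  by (simp add: ell2_nth_delta power2_eq_1_iff del: norm_ge_zero flip: of_real_power)

lemma sum_le_norm_ell2_sq:
  "finite E \<Longrightarrow> (\<Sum>x\<in>E. (cmod (ell2_nth f x))\<^sup>2) \<le> (norm f)\<^sup>2"
  unfolding norm_ell2_sq
  using infsum_mono_neutral[of "\<lambda>x. (cmod (ell2_nth f x))\<^sup>2" E "\<lambda>x. (cmod (ell2_nth f x))\<^sup>2" UNIV]
  by (simp add: ell2_summable)

lemma ell2_nth_le_norm: "cmod (ell2_nth f x) \<le> norm f"
  using sum_le_norm_ell2_sq[of "{x}" f] by (simp add: power2_le_iff_abs_le)

lemma Cauchy_Schwarz_cinner: "cmod (cinner f g) \<le> norm f * norm g"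
proof -
  \<comment> \<open>Rotation by the unimodular \<open>u\<close> turns the inner product into a
    nonnegative real, to which the real Cauchy-Schwarz inequality for \<open>inner\<close>
    applies.\<close>
  obtain u where u: "cmod u = 1" "of_real (cmod (cinner f g)) = u * cinner f g"
  proof (cases "cinner f g = 0")
    case False
    then show ?thesis
      using that[of "of_real (cmod (cinner f g)) / cinner f g"] by (simp add: norm_divide)
  qed (use that[of 1] in simp)
  have n: "norm (ell2_scale u f) = norm f"
  proof -
    have "of_real ((norm (ell2_scale u f))\<^sup>2) = (of_real ((norm f)\<^sup>2) :: complex)"
      unfolding cinner_self[symmetric] cinner_scale_left cinner_scale_right
      using u(1) complex_norm_square[of u] by (simp add: mult.commute mult.left_commute)
    then show ?thesis
      by (simp flip: of_real_power)
  qed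
  have "cmod (cinner f g) = Re (cinner (ell2_scale u f) g)"
    unfolding cinner_scale_left using u(2) by (metis Re_complex_of_real)
  also have "\<dots> = inner (ell2_scale u f) g"
    by (simp add: inner_ell2_def)
  also have "\<dots> \<le> norm f * norm g"
    using norm_cauchy_schwarz[of "ell2_scale u f" g] n by simp
  finally show ?thesis .
qed

lemma norm_ell2_scale [simp]: "norm (ell2_scale c f) = cmod c * norm f"
proof -
  have "of_real ((norm (ell2_scale c f))\<^sup>2) = (of_real ((cmod c * norm f)\<^sup>2) :: complex)"
    unfolding cinner_self[symmetric] cinner_scale_left cinner_scale_right
    using complex_norm_square[of c] by (simp add: cinner_self power_mult_distrib mult.commute)
  then have "(norm (ell2_scale c f))\<^sup>2 = (cmod c * norm f)\<^sup>2"
    using of_real_eq_iff by blast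
  then show ?thesis by simp
qed

text \<open>Bounded finite partial sums give summability and the norm bound at once. Vectors
  prescribed by coordinates (limits, adjoints, images under a matrix) are produced this way, so that
  only finite sums have to be estimated.\<close>

lemma ell2_of_bound:
  assumes "C \<ge> 0" and "\<And>E. finite E \<Longrightarrow> (\<Sum>x\<in>E. (cmod (g x))\<^sup>2) \<le> C\<^sup>2"
  obtains h where "\<And>x. ell2_nth h x = g x" "norm h \<le> C"
proof
  have "(\<lambda>x. (cmod (g x))\<^sup>2) summable_on UNIV"
    by (rule nonneg_bdd_above_summable_on) (use assms(2) in \<open>auto intro!: bdd_aboveI2\<close>)
  then show nth: "ell2_nth (Abs_ell2 g) x = g x" for x
    by (simp add: Abs_ell2_inverse)
  then have "(norm (Abs_ell2 g))\<^sup>2 \<le> C\<^sup>2"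
    unfolding norm_ell2_sq
    by (intro infsum_le_finite_sums ell2_summable) (use assms(2) in simp)
  then show "norm (Abs_ell2 g) \<le> C"
    using assms(1) by (rule power2_le_imp_le)
qed

lemma ell2_finite_approx:
  assumes "e > 0"
  obtains E where "finite E" "norm (f - (\<Sum>x\<in>E. ell2_scale (ell2_nth f x) (delta x))) < e"
proof -
  let ?g = "\<lambda>x. (cmod (ell2_nth f x))\<^sup>2"
  have "(sum ?g \<longlongrightarrow> infsum ?g UNIV) (finite_subsets_at_top UNIV)"
    using ell2_summable has_sum_infsum has_sum_def by blast
  then have "\<forall>\<^sub>F E in finite_subsets_at_top UNIV. dist (sum ?g E) (infsum ?g UNIV) < e\<^sup>2"
    using assms by (intro tendstoD) auto
  then obtain E where E: "finite E" "dist (sum ?g E) (infsum ?g UNIV) < e\<^sup>2"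
    by (auto simp: eventually_finite_subsets_at_top)
  define h where "h = f - (\<Sum>x\<in>E. ell2_scale (ell2_nth f x) (delta x))"
  have h: "ell2_nth h x = (if x \<in> E then 0 else ell2_nth f x)" for x
  proof -
    have "(\<Sum>y\<in>E. ell2_nth f y * (if x = y then 1 else 0)) = (\<Sum>y\<in>E. if x = y then ell2_nth f y else 0)"
      by (rule sum.cong) auto
    then show ?thesis
      using \<open>finite E\<close> by (simp add: h_def ell2_nth_sum ell2_nth_delta)
  qed
  have "(norm h)\<^sup>2 = infsum ?g (UNIV - E)"
    unfolding norm_ell2_sq by (rule infsum_cong_neutral) (auto simp: h)
  also have "\<dots> = infsum ?g UNIV - sum ?g E"
    using \<open>finite E\<close> infsum_Diff[OF ell2_summable[of f], of E] by simp
  finally have "(norm h)\<^sup>2 < e\<^sup>2"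
    using E(2) by (simp add: dist_real_def)
  then have "norm h < e"
    using assms by (simp add: power_less_imp_less_base)
  then show ?thesis
    using that E(1) h_def by blast
qed

instance ell2 :: (type) banach
proof
  fix X :: "nat \<Rightarrow> 'a ell2"
  assume X: "Cauchy X"
  have "Cauchy (\<lambda>n. ell2_nth (X n) x)" for x
  proof (rule CauchyI)
    fix e :: real assume "e > 0"
    then obtain N where N: "\<And>m n. m \<ge> N \<Longrightarrow> n \<ge> N \<Longrightarrow> norm (X m - X n) < e"
      using CauchyD[OF X] by blast
    show "\<exists>M. \<forall>m\<ge>M. \<forall>n\<ge>M. norm (ell2_nth (X m) x - ell2_nth (X n) x) < e"
      using N ell2_nth_le_norm[of "X _ - X _" x] by (metis ell2_nth_minus order_le_less_trans)
  qed
  then have lim: "(\<lambda>n. ell2_nth (X n) x) \<longlonglongrightarrow> lim (\<lambda>n. ell2_nth (X n) x)" for x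
    using Cauchy_convergent convergent_LIMSEQ_iff by blast
  define g where "g x = lim (\<lambda>n. ell2_nth (X n) x)" for x
  \<comment> \<open>The Cauchy estimate survives the coordinatewise limit because it is tested on a
    finite \<open>E\<close>, where the sum depends continuously on the coordinates.\<close>
  have tail: "(\<Sum>x\<in>E. (cmod (g x - ell2_nth (X n) x))\<^sup>2) \<le> e\<^sup>2"
    if "finite E" "e > 0" "\<And>m. m \<ge> n \<Longrightarrow> norm (X m - X n) \<le> e" for E e n
  proof (rule LIMSEQ_le_const2)
    show "(\<lambda>m. \<Sum>x\<in>E. (cmod (ell2_nth (X m) x - ell2_nth (X n) x))\<^sup>2)
        \<longlonglongrightarrow> (\<Sum>x\<in>E. (cmod (g x - ell2_nth (X n) x))\<^sup>2)"
      unfolding g_def by (intro tendsto_intros lim)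
    have "(\<Sum>x\<in>E. (cmod (ell2_nth (X m) x - ell2_nth (X n) x))\<^sup>2) \<le> e\<^sup>2" if "m \<ge> n" for m
    proof -
      have "(\<Sum>x\<in>E. (cmod (ell2_nth (X m - X n) x))\<^sup>2) \<le> (norm (X m - X n))\<^sup>2"
        by (rule sum_le_norm_ell2_sq) fact
      also have "\<dots> \<le> e\<^sup>2"
        using \<open>\<And>m. m \<ge> n \<Longrightarrow> norm (X m - X n) \<le> e\<close>[OF that] by (intro power_mono) auto
      finally show ?thesis by simp
    qed
    then show "\<exists>N. \<forall>m\<ge>N. (\<Sum>x\<in>E. (cmod (ell2_nth (X m) x - ell2_nth (X n) x))\<^sup>2) \<le> e\<^sup>2"
      by blast
  qed
  have diff: "\<exists>h. (\<forall>x. ell2_nth h x = g x - ell2_nth (X n) x) \<and> norm h \<le> e"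
    if "e > 0" "\<And>m. m \<ge> n \<Longrightarrow> norm (X m - X n) \<le> e" for e n
    by (rule ell2_of_bound[of e "\<lambda>x. g x - ell2_nth (X n) x"]) (use that tail in auto)
  \<comment> \<open>\<open>g\<close> is not yet known to be square summable, but its difference from
    one late \<open>X N\<close> is; the limit vector arises by adding \<open>X N\<close>
    back.\<close>
  obtain N where N: "\<And>m. m \<ge> N \<Longrightarrow> norm (X m - X N) \<le> 1"
    using CauchyD[OF X, of 1] by force
  obtain h where h: "\<And>x. ell2_nth h x = g x - ell2_nth (X N) x"
    using diff[of 1 N] N by auto
  define l where "l = h + X N"
  have l: "ell2_nth l x = g x" for x
    by (simp add: l_def h)
  have "X \<longlonglongrightarrow> l"
  proof (rule LIMSEQ_I)
    fix r :: real assume "r > 0"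
    then obtain M where M: "\<And>m n. m \<ge> M \<Longrightarrow> n \<ge> M \<Longrightarrow> norm (X m - X n) < r / 2"
      using CauchyD[OF X, of "r / 2"] by auto
    have "norm (X n - l) < r" if n: "n \<ge> M" for n
    proof -
      obtain k where k: "\<And>x. ell2_nth k x = g x - ell2_nth (X n) x" "norm k \<le> r / 2"
        using diff[of "r / 2" n] M[OF _ n] n \<open>r > 0\<close> by (force intro: less_imp_le)
      have "k = l - X n"
        by (rule ell2_eqI) (simp add: k l)
      then show ?thesis
        using k(2) \<open>r > 0\<close> by (simp add: norm_minus_commute)
    qed
    then show "\<exists>no. \<forall>n\<ge>no. norm (X n - l) < r" by blast
  qed
  then show "convergent X"
    by (auto simp: convergent_def)
qed


section \<open>Operators and their matrices\<close>

lemma of_real_eq_imp_eq_cmod: "of_real s = z \<Longrightarrow> 0 \<le> s \<Longrightarrow> s = cmod z"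
  by auto

lemma le_of_mult_self_le: "a * a \<le> b * a \<Longrightarrow> 0 \<le> a \<Longrightarrow> 0 \<le> b \<Longrightarrow> a \<le> (b::real)"
  by (metis mult_right_le_imp_le order_le_less)

lemma bounded_linear_cinner_left: "bounded_linear (\<lambda>f. cinner f g)"
  by (rule bounded_linear_intro[where K = "norm g"])
    (auto simp: cinner_add_left cinner_scaleR_left scaleR_conv_of_real Cauchy_Schwarz_cinner)

lemma bounded_linear_cinner_right: "bounded_linear (\<lambda>f. cinner g f)"
  by (rule bounded_linear_intro[where K = "norm g"])
    (auto simp: cinner_add_right cinner_scaleR_right scaleR_conv_of_real
      Cauchy_Schwarz_cinner mult.commute[of "norm _" "norm g"])

text \<open>\<open>\<phi>\<close> is merely real-linear, so vanishing is asked for on all complex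
  multiples of basis vectors. Their finite sums are dense and \<open>\<phi>\<close> is
  continuous.\<close>

lemma bounded_linear_eq_0_ell2:
  assumes \<phi>: "bounded_linear \<phi>" and z: "\<And>c x. \<phi> (ell2_scale c (delta x)) = 0"
  shows "\<phi> f = 0"
proof -
  obtain K where K: "K > 0" "\<And>f. norm (\<phi> f) \<le> norm f * K"
    using bounded_linear.pos_bounded[OF \<phi>] by blast
  have "norm (\<phi> f) \<le> e" if e: "e > 0" for e
  proof -
    obtain E where E: "norm (f - (\<Sum>x\<in>E. ell2_scale (ell2_nth f x) (delta x))) < e / K"
      by (rule ell2_finite_approx[of "e / K" f]) (use K(1) e in auto)
    have "\<phi> f = \<phi> (f - (\<Sum>x\<in>E. ell2_scale (ell2_nth f x) (delta x)))"
      using \<phi> z by (simp add: linear_diff linear_sum bounded_linear.linear)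
    also have "norm \<dots> \<le> (e / K) * K"
      using E K by (meson less_imp_le mult_right_mono order_trans)
    finally show ?thesis
      using K(1) by simp
  qed
  then have "norm (\<phi> f) \<le> 0"
    by (rule field_le_epsilon[where y = 0, simplified])
  then show ?thesis by simp
qed

section \<open>Matrix entries and complex linearity\<close>

lemma mat_entry_nth: "mat_entry T x y = ell2_nth (blinfun_apply T (delta y)) x"
  by (simp add: mat_entry_def)

lemma mat_entry_zero [simp]: "mat_entry 0 x y = 0"
  by (simp add: mat_entry_nth)

lemma mat_entry_add [simp]: "mat_entry (T + S) x y = mat_entry T x y + mat_entry S x y"
  by (simp add: mat_entry_nth blinfun.add_left)

lemma mat_entry_diff [simp]: "mat_entry (T - S) x y = mat_entry T x y - mat_entry S x y"
  by (simp add: mat_entry_nth blinfun.diff_left)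

lemma mat_entry_scale [simp]: "mat_entry (scale_operator c T) x y = c * mat_entry T x y"
  by (simp add: mat_entry_nth scale_operator_apply)

lemma mat_entry_sum: "mat_entry (\<Sum>i\<in>I. T i) x y = (\<Sum>i\<in>I. mat_entry (T i) x y)"
  by (induction I rule: infinite_finite_induct) auto

lemma mat_entry_id: "mat_entry id_blinfun x y = (if x = y then 1 else 0)"
  by (simp add: mat_entry_nth ell2_nth_delta)

lemma norm_mat_entry_le: "cmod (mat_entry T x y) \<le> norm T"
  unfolding mat_entry_nth
  using ell2_nth_le_norm[of "blinfun_apply T (delta y)" x] norm_blinfun[of T "delta y"] by simp

lemma bounded_linear_mat_entry: "bounded_linear (\<lambda>T. mat_entry T x y)"
proof (rule bounded_linear_intro[where K = 1])
  show "mat_entry (r *\<^sub>R T) x y = r *\<^sub>R mat_entry T x y" for r T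
    by (simp add: mat_entry_nth blinfun.scaleR_left scaleR_conv_of_real)
qed (auto simp: norm_mat_entry_le)

lemma complex_linear_scale:
  "complex_linear T \<Longrightarrow> blinfun_apply T (ell2_scale c f) = ell2_scale c (blinfun_apply T f)"
  by (simp add: complex_linear_def)

lemma ell2_scale_add_right: "ell2_scale c (f + g) = ell2_scale c f + ell2_scale c g"
  by (rule ell2_eqI) (simp add: algebra_simps)

lemma ell2_scale_diff_right: "ell2_scale c (f - g) = ell2_scale c f - ell2_scale c g"
  by (rule ell2_eqI) (simp add: algebra_simps)

lemma ell2_scale_scale: "ell2_scale c (ell2_scale d f) = ell2_scale (c * d) f"
  by (rule ell2_eqI) (simp add: algebra_simps)

lemma ell2_scale_zero [simp]: "ell2_scale c 0 = 0"
  by (rule ell2_eqI) simp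

lemma ell2_scale_scaleR: "ell2_scale c (r *\<^sub>R f) = r *\<^sub>R ell2_scale c f"
  by (rule ell2_eqI) simp

lemma complex_linear_zero [simp]: "complex_linear 0"
  by (simp add: complex_linear_def)

lemma complex_linear_id [simp]: "complex_linear id_blinfun"
  by (simp add: complex_linear_def)

lemma complex_linear_add [intro]: "complex_linear T \<Longrightarrow> complex_linear S \<Longrightarrow> complex_linear (T + S)"
  by (simp add: complex_linear_def blinfun.add_left ell2_scale_add_right)

lemma complex_linear_diff [intro]: "complex_linear T \<Longrightarrow> complex_linear S \<Longrightarrow> complex_linear (T - S)"
  by (simp add: complex_linear_def blinfun.diff_left ell2_scale_diff_right)

lemma complex_linear_scaleR [intro]: "complex_linear T \<Longrightarrow> complex_linear (r *\<^sub>R T)"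
  by (simp add: complex_linear_def blinfun.scaleR_left ell2_scale_scaleR)

lemma complex_linear_scale_operator [intro]: "complex_linear T \<Longrightarrow> complex_linear (scale_operator c T)"
  by (simp add: complex_linear_def scale_operator_apply ell2_scale_scale mult.commute)

lemma complex_linear_comp [intro]: "complex_linear T \<Longrightarrow> complex_linear S \<Longrightarrow> complex_linear (T o\<^sub>L S)"
  by (simp add: complex_linear_def)

lemma complex_linear_sum: "(\<And>i. i \<in> I \<Longrightarrow> complex_linear (T i)) \<Longrightarrow> complex_linear (\<Sum>i\<in>I. T i)"
  by (induction I rule: infinite_finite_induct) auto

lemma closed_complex_linear: "closed {T :: 'x operator. complex_linear T}"
proof -
  have "{T :: 'x operator. complex_linear T} = (\<Inter>c. \<Inter>f. {T. blinfun_apply T (ell2_scale c f) - ell2_scale c (blinfun_apply T f) = 0})"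
    by (auto simp: complex_linear_def)
  also have "closed \<dots>"
    by (intro closed_INT ballI closed_Collect_eq continuous_intros
        bounded_linear.continuous_on[OF bounded_linear_ell2_scale])
  finally show ?thesis .
qed

text \<open>Entries see the values at \<open>delta y\<close> only; complex linearity extends them to
  imaginary multiples, and density does the rest. Most operator identities below are checked on
  entries by this rule.\<close>

lemma operator_eqI:
  assumes "complex_linear T" "complex_linear S" "\<And>x y. mat_entry T x y = mat_entry S x y"
  shows "T = S"
proof (rule blinfun_eqI)
  fix f
  have "blinfun_apply (T - S) f = 0"
  proof (rule bounded_linear_eq_0_ell2[OF blinfun.bounded_linear_right])
    fix c x
    have "blinfun_apply (T - S) (delta x) = 0"
      by (rule ell2_eqI) (use assms(3) in \<open>simp add: mat_entry_nth blinfun.diff_left\<close>)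
    then show "blinfun_apply (T - S) (ell2_scale c (delta x)) = 0"
      using complex_linear_diff[OF assms(1,2)] by (simp add: complex_linear_scale)
  qed
  then show "blinfun_apply T f = blinfun_apply S f"
    by (simp add: blinfun.diff_left)
qed

text \<open>The value \<open>S g\<close> of the adjoint is prescribed on the basis vectors; that it is square
  summable follows by testing against the finitely supported truncations of \<open>S g\<close> itself.\<close>

lemma operator_adj_exists:
  assumes T: "complex_linear T"
  obtains S where "\<And>f g. cinner (blinfun_apply T f) g = cinner f (blinfun_apply S g)"
    "complex_linear S" "norm S \<le> norm T"
proof -
  have "\<exists>h. (\<forall>x. ell2_nth h x = cinner g (blinfun_apply T (delta x))) \<and> norm h \<le> norm g * norm T" for g
  proof -
    define k where "k x = cinner g (blinfun_apply T (delta x))" for x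
    have "(\<Sum>x\<in>E. (cmod (k x))\<^sup>2) \<le> (norm g * norm T)\<^sup>2" if E: "finite E" for E
    proof -
      define s where "s = (\<Sum>x\<in>E. (cmod (k x))\<^sup>2)"
      define f where "f = (\<Sum>x\<in>E. ell2_scale (k x) (delta x))"
      have s0: "s \<ge> 0" by (simp add: s_def sum_nonneg)
      have fE: "ell2_nth f x = (if x \<in> E then k x else 0)" for x
      proof -
        have "(\<Sum>y\<in>E. k y * (if x = y then 1 else 0)) = (\<Sum>y\<in>E. if x = y then k y else 0)"
          by (rule sum.cong) auto
        then show ?thesis
          using E by (simp add: f_def ell2_nth_sum ell2_nth_delta)
      qed
      have "of_real ((norm f)\<^sup>2) = cinner f (\<Sum>x\<in>E. ell2_scale (k x) (delta x))"
        unfolding cinner_self[symmetric] by (simp flip: f_def)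
      also have "\<dots> = (\<Sum>x\<in>E. cnj (k x) * k x)"
        by (simp add: cinner_sum_right cinner_scale_right fE)
      also have "\<dots> = of_real s"
        unfolding s_def of_real_sum complex_norm_square by (simp add: mult.commute)
      finally have nf: "(norm f)\<^sup>2 = s"
        using of_real_eq_iff by blast
      have "cinner g (blinfun_apply T f) = (\<Sum>x\<in>E. cnj (k x) * k x)"
        by (simp add: f_def blinfun.sum_right T complex_linear_scale cinner_sum_right
            cinner_scale_right k_def)
      also have "\<dots> = of_real s"
        unfolding s_def of_real_sum complex_norm_square by (simp add: mult.commute)
      finally have "s = cmod (cinner g (blinfun_apply T f))"
        using s0 by simp
      also have "\<dots> \<le> norm g * (norm T * norm f)"
        by (rule order_trans[OF Cauchy_Schwarz_cinner]) (intro mult_left_mono norm_blinfun norm_ge_zero)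
      finally have "norm f * norm f \<le> (norm g * norm T) * norm f"
        using nf by (simp add: power2_eq_square mult.assoc)
      then have "norm f \<le> norm g * norm T"
        by (rule le_of_mult_self_le) auto
      then have "(norm f)\<^sup>2 \<le> (norm g * norm T)\<^sup>2"
        by (intro power_mono) auto
      then show ?thesis
        using nf by (simp add: s_def)
    qed
    then obtain h where "\<And>x. ell2_nth h x = k x" "norm h \<le> norm g * norm T"
      using ell2_of_bound[of "norm g * norm T" k] by (metis mult_nonneg_nonneg norm_ge_zero)
    then show ?thesis
      by (auto simp: k_def)
  qed
  then obtain S0 where S0: "\<And>g x. ell2_nth (S0 g) x = cinner g (blinfun_apply T (delta x))"
    "\<And>g. norm (S0 g) \<le> norm g * norm T"
    by metis
  have bl: "bounded_linear S0"
  proof (rule bounded_linear_intro)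
    show "S0 (f + g) = S0 f + S0 g" for f g
      by (rule ell2_eqI) (simp add: S0 cinner_add_left)
    show "S0 (r *\<^sub>R f) = r *\<^sub>R S0 f" for f r
      by (rule ell2_eqI) (simp add: S0 cinner_scaleR_left)
  qed (rule S0)
  show ?thesis
  proof
    show "complex_linear (Blinfun S0)"
      unfolding complex_linear_def
      by (intro allI ell2_eqI) (simp add: bounded_linear_Blinfun_apply[OF bl] S0 cinner_scale_left)
    show "norm (Blinfun S0) \<le> norm T"
      by (rule norm_blinfun_bound) (auto simp: bounded_linear_Blinfun_apply[OF bl] S0(2) mult.commute)
    fix f g
    have "cinner (blinfun_apply T f) g - cinner f (S0 g) = 0"
    proof (rule bounded_linear_eq_0_ell2[where f = f])
      show "bounded_linear (\<lambda>f. cinner (blinfun_apply T f) g - cinner f (S0 g))"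
        by (intro bounded_linear_sub bounded_linear_cinner_left
            bounded_linear_compose[OF bounded_linear_cinner_left] blinfun.bounded_linear_right)
      show "cinner (blinfun_apply T (ell2_scale c (delta x))) g - cinner (ell2_scale c (delta x)) (S0 g) = 0"
        for c x
        using T S0(1)[of g x] cinner_commute[of "blinfun_apply T (delta x)" g]
        by (simp add: complex_linear_scale cinner_scale_left)
    qed
    then show "cinner (blinfun_apply T f) g = cinner f (blinfun_apply (Blinfun S0) g)"
      by (simp add: bounded_linear_Blinfun_apply[OF bl])
  qed
qed

lemma operator_adj_unique:
  assumes "\<And>f g. cinner (blinfun_apply T f) g = cinner f (blinfun_apply S g)"
  shows "operator_adj T = S"
  unfolding operator_adj_def
proof (rule the_equality)
  fix S' assume S': "\<forall>f g. cinner (blinfun_apply T f) g = cinner f (blinfun_apply S' g)"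
  show "S' = S"
  proof (intro blinfun_eqI ell2_eqI)
    fix g x
    have "cinner (delta x) (blinfun_apply S' g) = cinner (delta x) (blinfun_apply S g)"
      using assms S' by metis
    then show "ell2_nth (blinfun_apply S' g) x = ell2_nth (blinfun_apply S g) x"
      by simp
  qed
qed (use assms in blast)

lemma
  assumes "complex_linear T"
  shows cinner_adj_right: "cinner (blinfun_apply T f) g = cinner f (blinfun_apply (operator_adj T) g)"
    and complex_linear_adj [intro]: "complex_linear (operator_adj T)"
    and norm_adj_le: "norm (operator_adj T) \<le> norm T"
  using operator_adj_exists[OF assms] operator_adj_unique by metis+

lemma cinner_adj_left:
  assumes "complex_linear T"
  shows "cinner (blinfun_apply (operator_adj T) f) g = cinner f (blinfun_apply T g)"
  using cinner_adj_right[OF assms, of g f] by (metis cinner_commute)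

lemma operator_adj_adj [simp]: "complex_linear T \<Longrightarrow> operator_adj (operator_adj T) = T"
  by (rule operator_adj_unique) (rule cinner_adj_left)

lemma mat_entry_adj: "complex_linear T \<Longrightarrow> mat_entry (operator_adj T) x y = cnj (mat_entry T y x)"
  using cinner_adj_left[of T "delta y" "delta x"] by (simp add: mat_entry_nth)

lemma operator_adj_add:
  "complex_linear T \<Longrightarrow> complex_linear S \<Longrightarrow> operator_adj (T + S) = operator_adj T + operator_adj S"
  by (rule operator_adj_unique)
    (simp add: blinfun.add_left cinner_add_left cinner_add_right cinner_adj_right)

lemma operator_adj_scale:
  "complex_linear T \<Longrightarrow> operator_adj (scale_operator c T) = scale_operator (cnj c) (operator_adj T)"
  by (rule operator_adj_unique)
    (simp add: scale_operator_apply cinner_scale_left cinner_scale_right cinner_adj_right)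

lemma operator_adj_comp:
  "complex_linear T \<Longrightarrow> complex_linear S \<Longrightarrow> operator_adj (T o\<^sub>L S) = operator_adj S o\<^sub>L operator_adj T"
  by (rule operator_adj_unique) (simp add: cinner_adj_right)

lemma norm_adj [simp]: "complex_linear T \<Longrightarrow> norm (operator_adj T) = norm T"
  by (metis norm_adj_le complex_linear_adj operator_adj_adj order_antisym)

lemma norm_adj_comp_self:
  assumes "complex_linear T"
  shows "norm (operator_adj T o\<^sub>L T) = (norm T)\<^sup>2"
proof (rule antisym)
  show "norm (operator_adj T o\<^sub>L T) \<le> (norm T)\<^sup>2"
    using norm_blinfun_compose[of "operator_adj T" T] assms by (simp add: power2_eq_square)
  have "norm T \<le> sqrt (norm (operator_adj T o\<^sub>L T))"
  proof (rule norm_blinfun_bound)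
    fix f
    have "of_real ((norm (blinfun_apply T f))\<^sup>2) = cinner f (blinfun_apply (operator_adj T o\<^sub>L T) f)"
      unfolding cinner_self[symmetric] using assms by (simp add: cinner_adj_right)
    then have "(norm (blinfun_apply T f))\<^sup>2 = cmod (cinner f (blinfun_apply (operator_adj T o\<^sub>L T) f))"
      by (rule of_real_eq_imp_eq_cmod) simp
    also have "\<dots> \<le> norm f * (norm (operator_adj T o\<^sub>L T) * norm f)"
      by (rule order_trans[OF Cauchy_Schwarz_cinner]) (intro mult_left_mono norm_blinfun norm_ge_zero)
    also have "\<dots> = (sqrt (norm (operator_adj T o\<^sub>L T)) * norm f)\<^sup>2"
      by (simp add: power_mult_distrib power2_eq_square[of "norm f"])
    finally show "norm (blinfun_apply T f) \<le> sqrt (norm (operator_adj T o\<^sub>L T)) * norm f"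
      by (rule power2_le_imp_le) simp
  qed simp
  then have "(norm T)\<^sup>2 \<le> (sqrt (norm (operator_adj T o\<^sub>L T)))\<^sup>2"
    by (rule power_mono) simp
  then show "(norm T)\<^sup>2 \<le> norm (operator_adj T o\<^sub>L T)"
    by simp
qed

lemma mat_entry_comp_infsum:
  assumes "complex_linear T"
  shows "mat_entry (T o\<^sub>L S) x y = (\<Sum>\<^sub>\<infinity>z. mat_entry S z y * mat_entry T x z)"
proof -
  have "mat_entry (T o\<^sub>L S) x y = cinner (blinfun_apply S (delta y)) (blinfun_apply (operator_adj T) (delta x))"
    unfolding mat_entry_def using assms by (simp only: blinfun_apply_blinfun_compose cinner_adj_right)
  then show ?thesis
    unfolding cinner.rep_eq mat_entry_nth[symmetric] using assms by (simp add: mat_entry_adj)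
qed

lemma mat_entry_comp:
  assumes "complex_linear T" "finite Z" "\<And>z. z \<notin> Z \<Longrightarrow> mat_entry T x z = 0 \<or> mat_entry S z y = 0"
  shows "mat_entry (T o\<^sub>L S) x y = (\<Sum>z\<in>Z. mat_entry T x z * mat_entry S z y)"
proof -
  have "mat_entry (T o\<^sub>L S) x y = (\<Sum>\<^sub>\<infinity>z\<in>Z. mat_entry T x z * mat_entry S z y)"
    unfolding mat_entry_comp_infsum[OF assms(1)] by (rule infsum_cong_neutral) (use assms(3) in auto)
  then show ?thesis
    using assms(2) by simp
qed

lemma mat_entry_comp_neq_0D:
  assumes "complex_linear T" "mat_entry (T o\<^sub>L S) x y \<noteq> 0"
  obtains z where "mat_entry T x z \<noteq> 0" "mat_entry S z y \<noteq> 0"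
  using assms mat_entry_comp[of T "{}" x S y] by auto

section \<open>Operators from matrices\<close>

text \<open>Finite rows make the formal action of \<open>m\<close> a finite sum at each point, so a
  norm bound, tested on finite sets of rows, is all that an operator needs in order to
  exist.\<close>

lemma operator_of_matrix:
  fixes m :: "'x \<Rightarrow> 'x \<Rightarrow> complex"
  assumes fin: "\<And>x. finite {y. m x y \<noteq> 0}" and C: "C \<ge> 0"
    and bound: "\<And>f E. finite E \<Longrightarrow>
      (\<Sum>x\<in>E. (cmod (\<Sum>y | m x y \<noteq> 0. m x y * ell2_nth f y))\<^sup>2) \<le> (C * norm f)\<^sup>2"
  obtains T where "complex_linear T" "\<And>x y. mat_entry T x y = m x y" "norm T \<le> C"
    "\<And>f x. ell2_nth (blinfun_apply T f) x = (\<Sum>y | m x y \<noteq> 0. m x y * ell2_nth f y)"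
proof -
  have "\<exists>h. (\<forall>x. ell2_nth h x = (\<Sum>y | m x y \<noteq> 0. m x y * ell2_nth f y)) \<and> norm h \<le> C * norm f" for f
    by (rule ell2_of_bound[of "C * norm f" "\<lambda>x. \<Sum>y | m x y \<noteq> 0. m x y * ell2_nth f y"])
      (use C bound in auto)
  then obtain T0 where T0: "\<And>f x. ell2_nth (T0 f) x = (\<Sum>y | m x y \<noteq> 0. m x y * ell2_nth f y)"
    "\<And>f. norm (T0 f) \<le> C * norm f"
    by metis
  have bl: "bounded_linear T0"
  proof (rule bounded_linear_intro[where K = C])
    show "T0 (f + g) = T0 f + T0 g" for f g
      by (rule ell2_eqI) (simp add: T0 distrib_left sum.distrib)
    show "T0 (r *\<^sub>R f) = r *\<^sub>R T0 f" for f r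
      by (rule ell2_eqI) (simp add: T0 sum_distrib_left mult.left_commute)
  qed (use T0(2) in \<open>simp add: mult.commute\<close>)
  show ?thesis
  proof
    show "complex_linear (Blinfun T0)"
      unfolding complex_linear_def
      by (intro allI ell2_eqI)
        (simp add: bounded_linear_Blinfun_apply[OF bl] T0 sum_distrib_left mult.left_commute)
    show "norm (Blinfun T0) \<le> C"
      by (rule norm_blinfun_bound) (auto simp: bounded_linear_Blinfun_apply[OF bl] T0(2) C)
    fix x y
    have "(\<Sum>z | m x z \<noteq> 0. m x z * ell2_nth (delta y) z) = (\<Sum>z | m x z \<noteq> 0. if z = y then m x z else 0)"
      by (rule sum.cong) (auto simp: ell2_nth_delta)
    also have "\<dots> = m x y"
      using fin[of x] by simp
    finally show "mat_entry (Blinfun T0) x y = m x y"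
      by (simp add: mat_entry_nth bounded_linear_Blinfun_apply[OF bl] T0)
  qed (simp add: bounded_linear_Blinfun_apply[OF bl] T0)
qed

text \<open>Cauchy-Schwarz in each row costs a factor \<open>N\<close>; exchanging the order of
  summation costs another one, since by symmetry of \<open>r\<close> every column also meets at most
  \<open>N\<close> rows. The square root of \<open>N * N\<close> remains.\<close>

lemma Schur_test_exists:
  fixes m :: "'x \<Rightarrow> 'x \<Rightarrow> complex"
  assumes r: "\<And>x y. m x y \<noteq> 0 \<Longrightarrow> r x y" "\<And>x y. r x y \<Longrightarrow> r y x"
    and N: "\<And>x. finite {y. r x y} \<and> card {y. r x y} \<le> N"
    and c: "\<And>x y. cmod (m x y) \<le> c"
  obtains T where "complex_linear T" "\<And>x y. mat_entry T x y = m x y" "norm T \<le> real N * c"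
    "\<And>f x. ell2_nth (blinfun_apply T f) x = (\<Sum>y | m x y \<noteq> 0. m x y * ell2_nth f y)"
proof -
  have c0: "c \<ge> 0"
    using c[of undefined undefined] norm_ge_zero order_trans by blast
  have sub: "{y. m x y \<noteq> 0} \<subseteq> {y. r x y}" for x
    using r(1) by blast
  have fin: "finite {y. m x y \<noteq> 0}" for x
    using N sub finite_subset by blast
  have bound: "(\<Sum>x\<in>E. (cmod (\<Sum>y | m x y \<noteq> 0. m x y * ell2_nth f y))\<^sup>2) \<le> (real N * c * norm f)\<^sup>2"
    if E: "finite E" for f E
  proof -
    define g where "g y = (cmod (ell2_nth f y))\<^sup>2" for y
    have g0: "g y \<ge> 0" for y by (simp add: g_def)
    \<comment> \<open>The columns met by the rows in \<open>E\<close>: a finite set, so that the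
      double sum can be exchanged.\<close>
    define Y where "Y = (\<Union>x\<in>E. {y. r x y})"
    have Y: "finite Y" using E N by (auto simp: Y_def)
    have row: "(cmod (\<Sum>y | m x y \<noteq> 0. m x y * ell2_nth f y))\<^sup>2 \<le> real N * c\<^sup>2 * (\<Sum>y | r x y. g y)" for x
    proof -
      have "cmod (\<Sum>y | m x y \<noteq> 0. m x y * ell2_nth f y) \<le> (\<Sum>y | m x y \<noteq> 0. c * cmod (ell2_nth f y))"
        by (rule order_trans[OF norm_sum]) (intro sum_mono, simp add: norm_mult c mult_right_mono)
      also have "\<dots> \<le> (\<Sum>y | r x y. c * cmod (ell2_nth f y))"
        using N sub c0 by (intro sum_mono2) auto
      finally have "(cmod (\<Sum>y | m x y \<noteq> 0. m x y * ell2_nth f y))\<^sup>2 \<le> (\<Sum>y | r x y. c * cmod (ell2_nth f y))\<^sup>2"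
        by (intro power_mono) auto
      also have "\<dots> \<le> (\<Sum>y | r x y. c\<^sup>2) * (\<Sum>y | r x y. (cmod (ell2_nth f y))\<^sup>2)"
        by (rule Cauchy_Schwarz_ineq_sum)
      also have "\<dots> = real (card {y. r x y}) * c\<^sup>2 * (\<Sum>y | r x y. g y)"
        by (simp add: g_def)
      also have "\<dots> \<le> real N * c\<^sup>2 * (\<Sum>y | r x y. g y)"
        using N[of x] by (intro mult_right_mono sum_nonneg g0) auto
      finally show ?thesis .
    qed
    have "(\<Sum>x\<in>E. \<Sum>y | r x y. g y) = (\<Sum>x\<in>E. \<Sum>y | y \<in> Y \<and> r x y. g y)"
      by (intro sum.cong refl) (auto simp: Y_def)
    also have "\<dots> = (\<Sum>y\<in>Y. \<Sum>x | x \<in> E \<and> r x y. g y)"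
      by (rule sum.swap_restrict[OF E Y])
    also have "\<dots> \<le> (\<Sum>y\<in>Y. real N * g y)"
    proof (rule sum_mono)
      fix y
      have "card {x. x \<in> E \<and> r x y} \<le> card {x. r y x}"
        using N r(2) by (intro card_mono) auto
      then have "real (card {x. x \<in> E \<and> r x y}) \<le> real N"
        using N[of y] by linarith
      then show "(\<Sum>x | x \<in> E \<and> r x y. g y) \<le> real N * g y"
        by (simp add: g0 mult_right_mono)
    qed
    also have "\<dots> \<le> real N * (norm f)\<^sup>2"
      unfolding sum_distrib_left[symmetric] g_def using Y
      by (intro mult_left_mono sum_le_norm_ell2_sq) auto
    finally have *: "(\<Sum>x\<in>E. \<Sum>y | r x y. g y) \<le> real N * (norm f)\<^sup>2" .
    have "(\<Sum>x\<in>E. (cmod (\<Sum>y | m x y \<noteq> 0. m x y * ell2_nth f y))\<^sup>2)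
        \<le> (\<Sum>x\<in>E. real N * c\<^sup>2 * (\<Sum>y | r x y. g y))"
      by (intro sum_mono row)
    also have "\<dots> \<le> real N * c\<^sup>2 * (real N * (norm f)\<^sup>2)"
      unfolding sum_distrib_left[symmetric] by (intro mult_left_mono *) auto
    finally show ?thesis
      by (simp add: power_mult_distrib power2_eq_square mult_ac)
  qed
  show ?thesis
    by (rule operator_of_matrix[OF fin _ bound]) (use c0 that in auto)
qed

lemma Schur_test:
  assumes T: "complex_linear T"
    and r: "\<And>x y. mat_entry T x y \<noteq> 0 \<Longrightarrow> r x y" "\<And>x y. r x y \<Longrightarrow> r y x"
    and N: "\<And>x. finite {y. r x y} \<and> card {y. r x y} \<le> N"
    and c: "\<And>x y. cmod (mat_entry T x y) \<le> c"
  shows "norm T \<le> real N * c"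
proof -
  obtain S where "complex_linear S" "\<And>x y. mat_entry S x y = mat_entry T x y" "norm S \<le> real N * c"
    by (rule Schur_test_exists[of "mat_entry T" r N c]) (use r N c in auto)
  then show ?thesis
    using operator_eqI[of S T] T by auto
qed

text \<open>The choice is meaningful for bounded \<open>\<kappa>\<close> only, as an unbounded
  function has no bounded multiplication operator; this is why the facts about it carry a bound
  \<open>c\<close>.\<close>

definition mult_op :: "('x \<Rightarrow> real) \<Rightarrow> 'x operator" where
  "mult_op \<kappa> = (SOME T. complex_linear T \<and>
     (\<forall>f x. ell2_nth (blinfun_apply T f) x = of_real (\<kappa> x) * ell2_nth f x))"

lemma
  assumes \<kappa>: "\<And>x. \<bar>\<kappa> x\<bar> \<le> c"
  shows mult_op_complex_linear: "complex_linear (mult_op \<kappa>)"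
    and mult_op_nth: "ell2_nth (blinfun_apply (mult_op \<kappa>) f) x = of_real (\<kappa> x) * ell2_nth f x"
    and mat_entry_mult_op: "mat_entry (mult_op \<kappa>) x y = (if x = y then of_real (\<kappa> x) else 0)"
    and norm_mult_op: "norm (mult_op \<kappa>) \<le> c"
proof -
  define m where "m x y = (if x = y then of_real (\<kappa> x) else 0 :: complex)" for x y
  have c0: "c \<ge> 0" using \<kappa>[of undefined] by linarith
  obtain T where T: "complex_linear T"
    "\<And>f x. ell2_nth (blinfun_apply T f) x = (\<Sum>y | m x y \<noteq> 0. m x y * ell2_nth f y)"
    by (rule Schur_test_exists[of m "(=)" 1 c]) (use c0 in \<open>auto simp: m_def \<kappa> split: if_splits\<close>)
  have "(\<Sum>y | m x y \<noteq> 0. m x y * ell2_nth f y) = of_real (\<kappa> x) * ell2_nth f x" for f x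
  proof -
    have "{y. m x y \<noteq> 0} = (if \<kappa> x = 0 then {} else {x})"
      by (auto simp: m_def)
    then show ?thesis by (simp add: m_def)
  qed
  then have "\<exists>T. complex_linear T \<and> (\<forall>f x. ell2_nth (blinfun_apply T f) x = of_real (\<kappa> x) * ell2_nth f x)"
    using T by auto
  from someI_ex[OF this, folded mult_op_def]
  show cl: "complex_linear (mult_op \<kappa>)"
    and nth: "\<And>f x. ell2_nth (blinfun_apply (mult_op \<kappa>) f) x = of_real (\<kappa> x) * ell2_nth f x"
    by auto
  show me: "mat_entry (mult_op \<kappa>) x y = (if x = y then of_real (\<kappa> x) else 0)" for x y
    by (simp add: mat_entry_nth nth ell2_nth_delta)
  show "norm (mult_op \<kappa>) \<le> c"
  proof -
    have "norm (mult_op \<kappa>) \<le> real 1 * c"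
      by (rule Schur_test[OF cl, of "(=)"]) (use c0 in \<open>auto simp: me \<kappa> split: if_splits\<close>)
    then show ?thesis by simp
  qed
qed

lemma cinner_mult_op:
  assumes "\<And>x. \<bar>\<kappa> x\<bar> \<le> c"
  shows "cinner (blinfun_apply (mult_op \<kappa>) f) g = cinner f (blinfun_apply (mult_op \<kappa>) g)"
  unfolding cinner.rep_eq mult_op_nth[OF assms] by (rule infsum_cong) simp

lemma mat_entry_mult_op_left:
  assumes "\<And>x. \<bar>\<kappa> x\<bar> \<le> c"
  shows "mat_entry (mult_op \<kappa> o\<^sub>L T) x y = of_real (\<kappa> x) * mat_entry T x y"
  by (simp add: mat_entry_nth mult_op_nth[OF assms])

lemma mat_entry_mult_op_right:
  assumes "\<And>x. \<bar>\<kappa> x\<bar> \<le> c" "complex_linear T"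
  shows "mat_entry (T o\<^sub>L mult_op \<kappa>) x y = mat_entry T x y * of_real (\<kappa> y)"
  using mat_entry_comp[of T "{y}" x "mult_op \<kappa>" y] assms(2)
  by (simp add: mat_entry_mult_op[OF assms(1)])

text \<open>Multiplication operators by real functions are self-adjoint, so the left side is the
  pairing of \<open>s f\<close> with \<open>f\<close>, where \<open>s\<close> is the sum of the
  squared weights.\<close>

lemma sum_norm_mult_op_sq:
  assumes I: "finite I" and \<kappa>: "\<And>i x. i \<in> I \<Longrightarrow> \<bar>\<kappa> i x\<bar> \<le> 1" and c: "\<And>x. (\<Sum>i\<in>I. (\<kappa> i x)\<^sup>2) \<le> c"
  shows "(\<Sum>i\<in>I. (norm (blinfun_apply (mult_op (\<kappa> i)) f))\<^sup>2) \<le> c * (norm f)\<^sup>2"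
proof -
  define s where "s x = (\<Sum>i\<in>I. (\<kappa> i x)\<^sup>2)" for x
  have s: "\<bar>s x\<bar> \<le> c" for x
    using c[of x] by (simp add: s_def sum_nonneg abs_of_nonneg)
  have "blinfun_apply (mult_op s) f = (\<Sum>i\<in>I. blinfun_apply (mult_op (\<kappa> i)) (blinfun_apply (mult_op (\<kappa> i)) f))"
  proof (rule ell2_eqI)
    fix x
    have "ell2_nth (blinfun_apply (mult_op (\<kappa> i)) (blinfun_apply (mult_op (\<kappa> i)) f)) x
        = of_real ((\<kappa> i x)\<^sup>2) * ell2_nth f x" if "i \<in> I" for i
      using mult_op_nth[of "\<kappa> i" 1, OF \<kappa>[OF that]] by (simp add: power2_eq_square)
    then show "ell2_nth (blinfun_apply (mult_op s) f) x
        = ell2_nth (\<Sum>i\<in>I. blinfun_apply (mult_op (\<kappa> i)) (blinfun_apply (mult_op (\<kappa> i)) f)) x"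
      by (simp add: mult_op_nth[OF s] ell2_nth_sum s_def sum_distrib_right)
  qed
  then have "cinner (blinfun_apply (mult_op s) f) f
      = (\<Sum>i\<in>I. cinner (blinfun_apply (mult_op (\<kappa> i)) (blinfun_apply (mult_op (\<kappa> i)) f)) f)"
    by (simp add: cinner_sum_left)
  also have "\<dots> = (\<Sum>i\<in>I. of_real ((norm (blinfun_apply (mult_op (\<kappa> i)) f))\<^sup>2))"
    using cinner_mult_op[of "\<kappa> _" 1, OF \<kappa>] by (intro sum.cong) (simp_all add: cinner_self)
  finally have "of_real (\<Sum>i\<in>I. (norm (blinfun_apply (mult_op (\<kappa> i)) f))\<^sup>2) = cinner (blinfun_apply (mult_op s) f) f"
    by simp
  then have "(\<Sum>i\<in>I. (norm (blinfun_apply (mult_op (\<kappa> i)) f))\<^sup>2) = cmod (cinner (blinfun_apply (mult_op s) f) f)"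
    by (rule of_real_eq_imp_eq_cmod) (simp add: sum_nonneg)
  also have "\<dots> \<le> norm (mult_op s) * norm f * norm f"
    by (rule order_trans[OF Cauchy_Schwarz_cinner]) (intro mult_right_mono norm_blinfun norm_ge_zero)
  also have "\<dots> \<le> c * norm f * norm f"
    by (intro mult_right_mono norm_mult_op s norm_ge_zero)
  finally show ?thesis
    by (simp add: power2_eq_square mult.assoc)
qed

text \<open>The triangle inequality would cost a factor \<open>card I\<close>. Instead the outer
  weights are moved to the other side of the inner product, and Cauchy-Schwarz over \<open>i\<close>
  leaves only the bound \<open>c\<close> on the sum of squares. For index sets
  \<open>\<sigma>\<close> of arbitrary size this independence is indispensable.\<close>

lemma norm_sum_mult_op_conj:
  fixes B :: "'i \<Rightarrow> 'x operator"
  assumes I: "finite I" and \<kappa>: "\<And>i x. i \<in> I \<Longrightarrow> \<bar>\<kappa> i x\<bar> \<le> 1" and c: "\<And>x. (\<Sum>i\<in>I. (\<kappa> i x)\<^sup>2) \<le> c"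
    and B: "\<And>i. i \<in> I \<Longrightarrow> norm (B i) \<le> M" and M: "M \<ge> 0"
  shows "norm (\<Sum>i\<in>I. mult_op (\<kappa> i) o\<^sub>L B i o\<^sub>L mult_op (\<kappa> i)) \<le> M * c"
proof (rule norm_blinfun_bound)
  have c0: "c \<ge> 0"
    using c[of undefined] sum_nonneg[of I "\<lambda>i. (\<kappa> i undefined)\<^sup>2"] by simp
  then show "0 \<le> M * c" using M by simp
  fix f
  define g where "g = blinfun_apply (\<Sum>i\<in>I. mult_op (\<kappa> i) o\<^sub>L B i o\<^sub>L mult_op (\<kappa> i)) f"
  define a where "a i = norm (blinfun_apply (mult_op (\<kappa> i)) f)" for i
  define b where "b i = norm (blinfun_apply (mult_op (\<kappa> i)) g)" for i
  have "of_real ((norm g)\<^sup>2) = cinner (\<Sum>i\<in>I. blinfun_apply (mult_op (\<kappa> i) o\<^sub>L B i o\<^sub>L mult_op (\<kappa> i)) f) g"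
    unfolding cinner_self[symmetric] by (simp add: g_def blinfun.sum_left)
  also have "\<dots> = (\<Sum>i\<in>I. cinner (blinfun_apply (B i) (blinfun_apply (mult_op (\<kappa> i)) f)) (blinfun_apply (mult_op (\<kappa> i)) g))"
    unfolding cinner_sum_left using cinner_mult_op[of "\<kappa> _" 1, OF \<kappa>] by (intro sum.cong) simp_all
  finally have "(norm g)\<^sup>2 = cmod (\<Sum>i\<in>I. cinner (blinfun_apply (B i) (blinfun_apply (mult_op (\<kappa> i)) f)) (blinfun_apply (mult_op (\<kappa> i)) g))"
    by (rule of_real_eq_imp_eq_cmod) simp
  also have "\<dots> \<le> (\<Sum>i\<in>I. M * (a i * b i))"
  proof (rule sum_norm_le)
    fix i assume i: "i \<in> I"
    have "cmod (cinner (blinfun_apply (B i) (blinfun_apply (mult_op (\<kappa> i)) f)) (blinfun_apply (mult_op (\<kappa> i)) g))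
      \<le> norm (B i) * a i * b i"
      unfolding a_def b_def
      by (rule order_trans[OF Cauchy_Schwarz_cinner]) (intro mult_right_mono norm_blinfun norm_ge_zero)
    also have "\<dots> \<le> M * a i * b i"
      using B[OF i] by (intro mult_right_mono) (auto simp: a_def b_def)
    finally show "cmod (cinner (blinfun_apply (B i) (blinfun_apply (mult_op (\<kappa> i)) f)) (blinfun_apply (mult_op (\<kappa> i)) g))
      \<le> M * (a i * b i)"
      by (simp add: mult.assoc)
  qed
  also have "\<dots> = M * (\<Sum>i\<in>I. a i * b i)"
    by (simp add: sum_distrib_left)
  also have "(\<Sum>i\<in>I. a i * b i) \<le> c * norm f * norm g"
  proof (rule power2_le_imp_le)
    have "(\<Sum>i\<in>I. a i * b i)\<^sup>2 \<le> (\<Sum>i\<in>I. (a i)\<^sup>2) * (\<Sum>i\<in>I. (b i)\<^sup>2)"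
      by (rule Cauchy_Schwarz_ineq_sum)
    also have "\<dots> \<le> (c * (norm f)\<^sup>2) * (c * (norm g)\<^sup>2)"
      unfolding a_def b_def using I \<kappa> c c0
      by (intro mult_mono sum_norm_mult_op_sq) (auto intro: sum_nonneg)
    finally show "(\<Sum>i\<in>I. a i * b i)\<^sup>2 \<le> (c * norm f * norm g)\<^sup>2"
      by (simp add: power_mult_distrib power2_eq_square mult_ac)
  qed (use c0 in simp)
  finally have "norm g * norm g \<le> (M * c * norm f) * norm g"
    using M by (simp add: power2_eq_square mult_left_mono mult.assoc)
  then have "norm g \<le> M * c * norm f"
    by (rule le_of_mult_self_le) (use M c0 in auto)
  then show "norm (blinfun_apply (\<Sum>i\<in>I. mult_op (\<kappa> i) o\<^sub>L B i o\<^sub>L mult_op (\<kappa> i)) f) \<le> M * c * norm f"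
    by (simp add: g_def)
qed


section \<open>Algebras of operators\<close>

text \<open>One set of operations with a variable carrier, so that the uniform Roe algebra and the
  finite dimensional model algebras are instances of the same record.\<close>

definition operator_alg :: "'x operator set \<Rightarrow> 'x operator star_alg" where
  "operator_alg C =
     \<lparr>car = C, nul = 0, pls = (+), scl = scale_operator, tms = (o\<^sub>L), adj = operator_adj, nrm = norm\<rparr>"

lemma operator_alg_simps [simp]:
  "car (operator_alg C) = C" "nul (operator_alg C) = 0" "pls (operator_alg C) = (+)"
  "scl (operator_alg C) = scale_operator" "tms (operator_alg C) = (o\<^sub>L)"
  "adj (operator_alg C) = operator_adj" "nrm (operator_alg C) = norm"
  by (simp_all add: operator_alg_def)

lemma scale_operator_of_real: "scale_operator (of_real r) T = r *\<^sub>R T"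
  by (intro blinfun_eqI) (simp add: scale_operator_apply blinfun.scaleR_left scaleR_ell2_def)

lemma scale_operator_neg1 [simp]: "scale_operator (-1) T = - T"
  using scale_operator_of_real[of "-1" T] by simp

lemma mns_operator_alg [simp]: "x \<ominus>\<^bsub>operator_alg C\<^esub> y = x - y"
  by (simp add: mns_def)

lemma norm_scale_operator [simp]: "norm (scale_operator c T) = cmod c * norm T"
proof -
  have le: "norm (scale_operator c T) \<le> cmod c * norm T" for c and T :: "'a operator"
  proof (rule norm_blinfun_bound)
    show "norm (blinfun_apply (scale_operator c T) f) \<le> cmod c * norm T * norm f" for f
      using mult_left_mono[OF norm_blinfun[of T f], of "cmod c"]
      by (simp add: scale_operator_apply mult.assoc)
  qed simp
  show ?thesis
  proof (cases "c = 0")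
    case True
    then show ?thesis using le[of 0 T] by simp
  next
    case False
    have "scale_operator (1 / c) (scale_operator c T) = T"
      by (intro blinfun_eqI ell2_eqI) (use False in \<open>simp add: scale_operator_apply\<close>)
    then have "norm T \<le> cmod (1 / c) * norm (scale_operator c T)"
      using le[of "1 / c" "scale_operator c T"] by simp
    then have "cmod c * norm T \<le> norm (scale_operator c T)"
      using False by (simp add: norm_divide field_simps)
    then show ?thesis using le[of c T] by simp
  qed
qed

lemma scale_operator_simps:
  "scale_operator 1 T = T"
  "scale_operator c (scale_operator d T) = scale_operator (c * d) T"
  "scale_operator (c + d) T = scale_operator c T + scale_operator d T"
  "scale_operator c (T + S) = scale_operator c T + scale_operator c S"
  "scale_operator c T o\<^sub>L S = scale_operator c (T o\<^sub>L S)"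
  by (intro blinfun_eqI ell2_eqI,
      simp add: scale_operator_apply blinfun.add_left ell2_scale_add_right algebra_simps)+

lemma comp_scale_operator:
  "complex_linear T \<Longrightarrow> T o\<^sub>L scale_operator c S = scale_operator c (T o\<^sub>L S)"
  by (intro blinfun_eqI) (simp add: scale_operator_apply complex_linear_scale)

lemma operator_comp_assoc: "(T o\<^sub>L S) o\<^sub>L U = T o\<^sub>L (S o\<^sub>L U)"
  by (intro blinfun_eqI) simp

lemma alg_sum_operator_alg: "alg_sum (operator_alg C) f n = (\<Sum>k<n. f k)"
  by (induction n) simp_all

lemma positive_matE:
  assumes "positive_mat A n x"
  obtains b where "\<And>i j. i < n \<Longrightarrow> j < n \<Longrightarrow> b i j \<in> car A"
    "\<And>i j. i < n \<Longrightarrow> j < n \<Longrightarrow> x i j = alg_sum A (\<lambda>k. adj A (b k i) \<otimes>\<^bsub>A\<^esub> b k j) n"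
  using assms unfolding positive_mat_def by blast

lemma positive_mat_operator_alg:
  "positive_mat (operator_alg C) n x \<longleftrightarrow>
     (\<exists>b. (\<forall>i<n. \<forall>j<n. b i j \<in> C) \<and>
          (\<forall>i<n. \<forall>j<n. x i j = (\<Sum>k<n. operator_adj (b k i) o\<^sub>L b k j)))"
  by (simp add: positive_mat_def alg_sum_operator_alg)

text \<open>A norm closed \<open>*\<close>-subalgebra of the bounded operators, not necessarily
  containing \<open>id_blinfun\<close>: a model algebra acts on finitely many points and is zero
  elsewhere. Where the identity matters, it is an explicit assumption.\<close>

locale operator_subalgebra =
  fixes C :: "'x operator set"
  assumes complex_linear: "T \<in> C \<Longrightarrow> complex_linear T"
    and closed: "closed C"
    and zero: "0 \<in> C"
    and add: "T \<in> C \<Longrightarrow> S \<in> C \<Longrightarrow> T + S \<in> C"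
    and scale: "T \<in> C \<Longrightarrow> scale_operator c T \<in> C"
    and comp: "T \<in> C \<Longrightarrow> S \<in> C \<Longrightarrow> T o\<^sub>L S \<in> C"
    and adj: "T \<in> C \<Longrightarrow> operator_adj T \<in> C"
begin

lemma scaleR: "T \<in> C \<Longrightarrow> r *\<^sub>R T \<in> C"
  using scale[of T "of_real r"] by (simp add: scale_operator_of_real)

lemma diff: "T \<in> C \<Longrightarrow> S \<in> C \<Longrightarrow> T - S \<in> C"
  using add[of T "- S"] scale[of S "-1"] by simp

lemma sum: "(\<And>i. i \<in> I \<Longrightarrow> T i \<in> C) \<Longrightarrow> (\<Sum>i\<in>I. T i) \<in> C"
  by (induction I rule: infinite_finite_induct) (auto simp: zero add)

lemma cstar_algebra: "cstar_algebra (operator_alg C)"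
proof
  fix s :: "nat \<Rightarrow> 'x operator"
  assume s: "\<And>n. s n \<in> car (operator_alg C)"
    and c: "\<And>e. e > 0 \<Longrightarrow> \<exists>N. \<forall>m\<ge>N. \<forall>n\<ge>N. nrm (operator_alg C) (s m \<ominus>\<^bsub>operator_alg C\<^esub> s n) < e"
  have "Cauchy s"
    by (rule CauchyI) (use c in simp)
  then obtain l where l: "s \<longlonglongrightarrow> l"
    using Cauchy_convergent convergent_def by blast
  then have "l \<in> C"
    using closed_sequentially[OF closed _ l] s by simp
  moreover have "(\<lambda>n. norm (s n - l)) \<longlonglongrightarrow> 0"
    using l by (simp add: LIM_zero_iff tendsto_norm_zero_iff)
  ultimately show "\<exists>x\<in>car (operator_alg C). (\<lambda>n. nrm (operator_alg C) (s n \<ominus>\<^bsub>operator_alg C\<^esub> x)) \<longlonglongrightarrow> 0"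
    by (auto intro: bexI[of _ l])
qed (auto simp: zero add scale comp adj complex_linear operator_adj_add operator_adj_scale
      operator_adj_comp norm_adj_comp_self norm_triangle_ineq norm_blinfun_compose
      add_ac scale_operator_simps comp_scale_operator operator_comp_assoc
      bounded_bilinear.add_left[OF bounded_bilinear_blinfun_compose]
      bounded_bilinear.add_right[OF bounded_bilinear_blinfun_compose])

end

subsection \<open>Transport of structure\<close>

text \<open>\<open>nudim_set\<close> wants summands with elements in
  \<open>nat \<Rightarrow> complex\<close>. Here \<open>h\<close> encodes an operator by coordinates
  and \<open>k\<close> decodes; \<open>k\<close> has to invert \<open>h\<close> on the carrier
  only.\<close>

definition transport :: "('a \<Rightarrow> 'b) \<Rightarrow> ('b \<Rightarrow> 'a) \<Rightarrow> 'a star_alg \<Rightarrow> 'b star_alg" where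
  "transport h k A =
     \<lparr>car = h ` car A, nul = h (nul A), pls = (\<lambda>x y. h (pls A (k x) (k y))),
      scl = (\<lambda>c x. h (scl A c (k x))), tms = (\<lambda>x y. h (tms A (k x) (k y))),
      adj = (\<lambda>x. h (adj A (k x))), nrm = (\<lambda>x. nrm A (k x))\<rparr>"

lemma transport_simps [simp]:
  "car (transport h k A) = h ` car A" "nul (transport h k A) = h (nul A)"
  "pls (transport h k A) x y = h (pls A (k x) (k y))" "scl (transport h k A) c x = h (scl A c (k x))"
  "tms (transport h k A) x y = h (tms A (k x) (k y))" "adj (transport h k A) x = h (adj A (k x))"
  "nrm (transport h k A) x = nrm A (k x)"
  by (simp_all add: transport_def)

context cstar_algebra
begin

lemma mns_closed: "x \<in> car A \<Longrightarrow> y \<in> car A \<Longrightarrow> x \<ominus> y \<in> car A"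
  by (simp add: mns_def pls_closed scl_closed)

lemma alg_sum_closed: "(\<And>i. i < n \<Longrightarrow> f i \<in> car A) \<Longrightarrow> alg_sum A f n \<in> car A"
  by (induction n) (auto simp: nul_closed pls_closed)

lemma alg_sum_cong: "(\<And>i. i < n \<Longrightarrow> f i = g i) \<Longrightarrow> alg_sum A f n = alg_sum A g n"
  by (induction n) auto

lemmas closed_simps = nul_closed pls_closed scl_closed tms_closed adj_closed mns_closed

end

context
  fixes A :: "'a star_alg" (structure)
  assumes A: "cstar_algebra A"
begin

interpretation cstar_algebra A
  by (rule A)

lemma cstar_algebra_transport:
  assumes hk: "\<And>x. x \<in> car A \<Longrightarrow> k (h x) = x"
  shows "cstar_algebra (transport h k A)"
proof -
  have mns: "h x \<ominus>\<^bsub>transport h k A\<^esub> h y = h (x \<ominus> y)" if "x \<in> car A" "y \<in> car A" for x y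
    using that by (simp add: mns_def[of "transport h k A"] hk closed_simps) (simp add: mns_def)
  show ?thesis
  proof
    fix s :: "nat \<Rightarrow> 'b"
    assume s: "\<And>n. s n \<in> car (transport h k A)"
      and c: "\<And>e. e > 0 \<Longrightarrow> \<exists>N. \<forall>m\<ge>N. \<forall>n\<ge>N. nrm (transport h k A) (s m \<ominus>\<^bsub>transport h k A\<^esub> s n) < e"
    from s obtain u where u: "\<And>n. s n = h (u n)" "\<And>n. u n \<in> car A"
      by (simp add: image_iff) metis
    obtain l where "l \<in> car A" "(\<lambda>n. nrm A (u n \<ominus> l)) \<longlonglongrightarrow> 0"
      using complete[of u] c u by (auto simp: mns hk mns_closed)
    then show "\<exists>x\<in>car (transport h k A). (\<lambda>n. nrm (transport h k A) (s n \<ominus>\<^bsub>transport h k A\<^esub> x)) \<longlonglongrightarrow> 0"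
      by (intro bexI[of _ "h l"]) (auto simp: u mns hk mns_closed)
  next
    fix x assume "x \<in> car (transport h k A)"
    then obtain x' where x': "x = h x'" "x' \<in> car A"
      by auto
    then show "x \<ominus>\<^bsub>transport h k A\<^esub> x = \<zero>\<^bsub>transport h k A\<^esub>"
      by (simp add: mns mns_self)
    show "nrm (transport h k A) x = 0 \<longleftrightarrow> x = \<zero>\<^bsub>transport h k A\<^esub>"
    proof -
      have "h x' = h \<zero> \<longleftrightarrow> x' = \<zero>"
        using hk[OF nul_closed] hk[OF x'(2)] by metis
      then show ?thesis
        by (simp add: x' hk nrm_eq_0_iff)
    qed
    fix y assume "y \<in> car (transport h k A)"
    then obtain y' where y': "y = h y'" "y' \<in> car A"
      by auto
    show "x \<oplus>\<^bsub>transport h k A\<^esub> y = y \<oplus>\<^bsub>transport h k A\<^esub> x"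
      using x' y' pls_commute by (simp add: hk)
  qed (auto simp: hk closed_simps pls_assoc pls_nul scl_one scl_scl scl_pls_left scl_pls_right
      tms_assoc tms_pls_left tms_pls_right tms_scl_left tms_scl_right adj_adj adj_pls adj_scl adj_tms
      nrm_nonneg nrm_triangle nrm_scl nrm_tms cstar_identity)
qed

lemma alg_sum_transport:
  assumes hk: "\<And>x. x \<in> car A \<Longrightarrow> k (h x) = x" and "\<And>i. i < n \<Longrightarrow> f i \<in> car A"
  shows "alg_sum (transport h k A) (\<lambda>i. h (f i)) n = h (alg_sum A f n)"
  using assms(2) by (induction n) (simp_all add: hk alg_sum_closed)

text \<open>This direction serves the map into the coordinate algebras, while
  \<open>positive_mat_transportD\<close> serves the map out of them. In both the factor
  \<open>b\<close> is transported entry by entry.\<close>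

lemma positive_mat_transportI:
  assumes hk: "\<And>x. x \<in> car A \<Longrightarrow> k (h x) = x" and "positive_mat A n x"
  shows "positive_mat (transport h k A) n (\<lambda>i j. h (x i j))"
proof -
  obtain b where b: "\<And>i j. i < n \<Longrightarrow> j < n \<Longrightarrow> b i j \<in> car A"
    "\<And>i j. i < n \<Longrightarrow> j < n \<Longrightarrow> x i j = alg_sum A (\<lambda>l. adj A (b l i) \<otimes> b l j) n"
    using assms(2) unfolding positive_mat_def by blast
  show ?thesis
    unfolding positive_mat_def
  proof (intro exI[of _ "\<lambda>i j. h (b i j)"] conjI allI impI)
    fix i j assume ij: "i < n" "j < n"
    have "alg_sum (transport h k A) (\<lambda>l. h (adj A (b l i) \<otimes> b l j)) n = h (x i j)"
      using ij by (subst alg_sum_transport[where h = h and k = k]) (auto simp: hk b closed_simps)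
    moreover have "alg_sum (transport h k A) (\<lambda>l. adj (transport h k A) (h (b l i)) \<otimes>\<^bsub>transport h k A\<^esub> h (b l j)) n
        = alg_sum (transport h k A) (\<lambda>l. h (adj A (b l i) \<otimes> b l j)) n"
      using ij by (intro cstar_algebra.alg_sum_cong[OF cstar_algebra_transport[where h = h and k = k, OF hk]])
        (auto simp: hk b closed_simps)
    ultimately show "h (x i j) = alg_sum (transport h k A)
        (\<lambda>l. adj (transport h k A) (h (b l i)) \<otimes>\<^bsub>transport h k A\<^esub> h (b l j)) n"
      by simp
  qed (simp add: b)
qed

lemma positive_mat_transportD:
  assumes hk: "\<And>x. x \<in> car A \<Longrightarrow> k (h x) = x" and "positive_mat (transport h k A) n y"
  shows "positive_mat A n (\<lambda>i j. k (y i j))"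
proof -
  obtain b where b: "\<And>i j. i < n \<Longrightarrow> j < n \<Longrightarrow> b i j \<in> h ` car A"
    "\<And>i j. i < n \<Longrightarrow> j < n \<Longrightarrow>
       y i j = alg_sum (transport h k A) (\<lambda>l. h (k (h (adj A (k (b l i)))) \<otimes> k (b l j))) n"
    by (rule positive_matE[OF assms(2)]) auto
  have kb: "\<And>i j. i < n \<Longrightarrow> j < n \<Longrightarrow> k (b i j) \<in> car A"
    using b(1) hk by fastforce
  show ?thesis
    unfolding positive_mat_def
  proof (intro exI[of _ "\<lambda>i j. k (b i j)"] conjI allI impI)
    fix i j assume ij: "i < n" "j < n"
    have "y i j = alg_sum (transport h k A) (\<lambda>l. h (adj A (k (b l i)) \<otimes> k (b l j))) n"
      unfolding b(2)[OF ij] using ij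
      by (intro cstar_algebra.alg_sum_cong[OF cstar_algebra_transport[where h = h and k = k, OF hk]])
        (auto simp: hk kb closed_simps)
    also have "\<dots> = h (alg_sum A (\<lambda>l. adj A (k (b l i)) \<otimes> k (b l j)) n)"
      using ij by (intro alg_sum_transport hk) (auto simp: kb closed_simps)
    finally show "k (y i j) = alg_sum A (\<lambda>l. adj A (k (b l i)) \<otimes> k (b l j)) n"
      using ij by (simp add: hk alg_sum_closed kb closed_simps)
  qed (simp add: kb)
qed

lemma finite_dimensional_transport:
  assumes hk: "\<And>x. x \<in> car A \<Longrightarrow> k (h x) = x" and "finite_dimensional A"
  shows "finite_dimensional (transport h k A)"
proof -
  obtain n b where b: "\<And>i. i < n \<Longrightarrow> b i \<in> car A"
    "\<And>x. x \<in> car A \<Longrightarrow> \<exists>c. x = alg_sum A (\<lambda>i. c i \<odot> b i) n"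
    using assms(2) unfolding finite_dimensional_def by blast
  show ?thesis
    unfolding finite_dimensional_def
  proof (intro exI[of _ n] exI[of _ "\<lambda>i. h (b i)"] conjI ballI allI impI)
    fix x assume "x \<in> car (transport h k A)"
    then obtain x' where x': "x = h x'" "x' \<in> car A"
      by auto
    then obtain c where c: "x' = alg_sum A (\<lambda>i. c i \<odot> b i) n"
      using b(2) by blast
    have "x = alg_sum (transport h k A) (\<lambda>i. h (c i \<odot> b i)) n"
      using b(1) x' c by (subst alg_sum_transport[where h = h and k = k]) (auto simp: hk closed_simps)
    also have "\<dots> = alg_sum (transport h k A) (\<lambda>i. c i \<odot>\<^bsub>transport h k A\<^esub> h (b i)) n"
      by (intro cstar_algebra.alg_sum_cong[OF cstar_algebra_transport[where h = h and k = k, OF hk]]) (auto simp: hk b)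
    finally show "\<exists>c. x = alg_sum (transport h k A) (\<lambda>i. c i \<odot>\<^bsub>transport h k A\<^esub> h (b i)) n"
      by blast
  qed (simp add: b)
qed

end

subsection \<open>Direct sums\<close>

lemma direct_sum_simps [simp]:
  "car (direct_sum I F) = (\<Pi>\<^sub>E i\<in>I. car (F i))"
  "nul (direct_sum I F) = (\<lambda>i\<in>I. nul (F i))"
  "pls (direct_sum I F) x y = (\<lambda>i\<in>I. pls (F i) (x i) (y i))"
  "scl (direct_sum I F) c x = (\<lambda>i\<in>I. scl (F i) c (x i))"
  "tms (direct_sum I F) x y = (\<lambda>i\<in>I. tms (F i) (x i) (y i))"
  "adj (direct_sum I F) x = (\<lambda>i\<in>I. adj (F i) (x i))"
  "nrm (direct_sum I F) x = (MAX i\<in>I. nrm (F i) (x i))"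
  by (simp_all add: direct_sum_def)

lemma alg_sum_direct_sum:
  "alg_sum (direct_sum I F) f n = (\<lambda>i\<in>I. alg_sum (F i) (\<lambda>k. f k i) n)"
  by (induction n) (auto simp: restrict_def fun_eq_iff)

lemma positive_mat_direct_sumD:
  assumes "positive_mat (direct_sum I F) n x" "t \<in> I"
  shows "positive_mat (F t) n (\<lambda>i j. x i j t)"
proof -
  obtain b where b: "\<And>i j. i < n \<Longrightarrow> j < n \<Longrightarrow> b i j \<in> (\<Pi>\<^sub>E i\<in>I. car (F i))"
    "\<And>i j. i < n \<Longrightarrow> j < n \<Longrightarrow> x i j = alg_sum (direct_sum I F)
       (\<lambda>k. adj (direct_sum I F) (b k i) \<otimes>\<^bsub>direct_sum I F\<^esub> b k j) n"
    by (rule positive_matE[OF assms(1)]) (auto simp del: direct_sum_simps(3-7))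
  show ?thesis
    unfolding positive_mat_def
    by (rule exI[of _ "\<lambda>i j. b i j t"]) (use assms(2) b(1) in \<open>auto simp: b(2) alg_sum_direct_sum\<close>)
qed

text \<open>The factors are chosen independently in each summand. Extensionality enters because
  elements of \<open>direct_sum\<close> are restricted functions, whose values off \<open>I\<close>
  must agree as well.\<close>

lemma positive_mat_direct_sumI:
  assumes "\<And>t. t \<in> I \<Longrightarrow> positive_mat (F t) n (\<lambda>i j. x i j t)"
    and "\<And>i j. i < n \<Longrightarrow> j < n \<Longrightarrow> x i j \<in> extensional I"
  shows "positive_mat (direct_sum I F) n x"
proof -
  obtain b where b: "\<And>t i j. t \<in> I \<Longrightarrow> i < n \<Longrightarrow> j < n \<Longrightarrow> b t i j \<in> car (F t)"
    "\<And>t i j. t \<in> I \<Longrightarrow> i < n \<Longrightarrow> j < n \<Longrightarrow>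
       x i j t = alg_sum (F t) (\<lambda>k. adj (F t) (b t k i) \<otimes>\<^bsub>F t\<^esub> b t k j) n"
    using assms(1) unfolding positive_mat_def by metis
  show ?thesis
    unfolding positive_mat_def
  proof (intro exI[of _ "\<lambda>i j. \<lambda>t\<in>I. b t i j"] conjI allI impI)
    fix i j assume ij: "i < n" "j < n"
    show "x i j = alg_sum (direct_sum I F) (\<lambda>k. adj (direct_sum I F) (\<lambda>t\<in>I. b t k i) \<otimes>\<^bsub>direct_sum I F\<^esub> (\<lambda>t\<in>I. b t k j)) n"
      by (rule extensionalityI[of _ I]) (use assms(2) ij in \<open>simp_all add: alg_sum_direct_sum b(2)\<close>)
  qed (use b(1) in auto)
qed

subsection \<open>Block diagonal matrices\<close>

text \<open>For finite \<open>Y\<close> this is a direct sum of full matrix algebras, one for each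
  label that \<open>p\<close> takes on \<open>Y\<close>, placed inside the operators on all of the
  space.\<close>

definition block_ops :: "'x set \<Rightarrow> ('x \<Rightarrow> 'l) \<Rightarrow> 'x operator set" where
  "block_ops Y p = {T. complex_linear T \<and> (\<forall>x y. mat_entry T x y \<noteq> 0 \<longrightarrow> x \<in> Y \<and> y \<in> Y \<and> p x = p y)}"

lemma operator_subalgebra_block_ops: "operator_subalgebra (block_ops Y p)"
proof
  have "block_ops Y p = {T. complex_linear T} \<inter>
      (\<Inter>x. \<Inter>y\<in>{y. \<not> (x \<in> Y \<and> y \<in> Y \<and> p x = p y)}. {T. mat_entry T x y = 0})"
    by (auto simp: block_ops_def)
  also have "closed \<dots>"
    by (intro closed_Int closed_complex_linear closed_INT ballI closed_Collect_eq
        bounded_linear.continuous_on[OF bounded_linear_mat_entry] continuous_intros)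
  finally show "closed (block_ops Y p)" .
  show "T o\<^sub>L S \<in> block_ops Y p" if "T \<in> block_ops Y p" "S \<in> block_ops Y p" for T S
    using that by (force simp: block_ops_def elim: mat_entry_comp_neq_0D)
qed (auto simp: block_ops_def mat_entry_adj, (metis add.right_neutral)+)

text \<open>The Schur test asks for a symmetric relation: \<open>{x, y} = {a, b}\<close> is the
  symmetric closure of the single position \<open>(a, b)\<close> and has at most two points in each
  row.\<close>

lemma matrix_unit_exists:
  obtains E :: "'x operator" where "complex_linear E"
    "\<And>x y. mat_entry E x y = (if x = a \<and> y = b then 1 else 0)"
proof (rule Schur_test_exists[of "\<lambda>x y. if x = a \<and> y = b then 1 else 0"
      "\<lambda>x y. {x, y} = {a, b}" 2 1])
  fix x
  have "{y. {x, y} = {a, b}} \<subseteq> {a, b}"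
    by auto
  moreover have "card {a, b} \<le> 2"
    by (simp add: card_insert_if)
  ultimately show "finite {y. {x, y} = {a, b}} \<and> card {y. {x, y} = {a, b}} \<le> 2"
    by (meson card_mono finite.intros finite_subset le_trans)
qed (use that in \<open>auto split: if_splits\<close>)

lemma block_ops_coordinates:
  fixes Y :: "'x set"
  assumes "finite Y"
  obtains h :: "'x operator \<Rightarrow> nat \<Rightarrow> complex" and k where
    "\<And>T. T \<in> block_ops Y p \<Longrightarrow> k (h T) = T"
    "cstar_algebra (transport h k (operator_alg (block_ops Y p)))"
    "finite_dimensional (transport h k (operator_alg (block_ops Y p)))"
proof -
  interpret operator_subalgebra "block_ops Y p"
    by (rule operator_subalgebra_block_ops)
  obtain e where e: "bij_betw e {0..<card (Y \<times> Y)} (Y \<times> Y)"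
    using assms ex_bij_betw_nat_finite[of "Y \<times> Y"] by auto
  define N where "N = card (Y \<times> Y)"
  have e: "bij_betw e {..<N} (Y \<times> Y)"
    using e by (simp add: N_def atLeast0LessThan)
  define h where "h T n = mat_entry T (fst (e n)) (snd (e n))" for T :: "'x operator" and n :: nat
  have ex: "\<exists>n<N. e n = (x, y)" if "x \<in> Y" "y \<in> Y" for x y
    using bij_betw_imp_surj_on[OF e] that by (force simp: image_iff)
  have inj: "inj_on h (block_ops Y p)"
  proof (rule inj_onI)
    fix T S assume T: "T \<in> block_ops Y p" and S: "S \<in> block_ops Y p" and "h T = h S"
    then have *: "mat_entry T (fst (e n)) (snd (e n)) = mat_entry S (fst (e n)) (snd (e n))" for n
      by (metis h_def)
    show "T = S"
    proof (rule operator_eqI)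
      fix x y
      show "mat_entry T x y = mat_entry S x y"
      proof (cases "x \<in> Y \<and> y \<in> Y")
        case True
        then obtain n where "e n = (x, y)"
          using ex by blast
        then show ?thesis using *[of n] by simp
      next
        case False
        then have "mat_entry T x y = 0" "mat_entry S x y = 0"
          using T S by (auto simp: block_ops_def)
        then show ?thesis by simp
      qed
    qed (use T S complex_linear in auto)
  qed
  define k where "k = inv_into (block_ops Y p) h"
  have hk: "k (h T) = T" if "T \<in> block_ops Y p" for T
    unfolding k_def using inj that by (rule inv_into_f_f)
  have "\<exists>E. complex_linear E \<and> (\<forall>x y. mat_entry E x y = (if (x, y) = e n then 1 else 0))" for n
    by (rule matrix_unit_exists[of "fst (e n)" "snd (e n)"]) (auto simp: prod_eq_iff)
  then obtain E where E: "\<And>n. complex_linear (E n)"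
    "\<And>n x y. mat_entry (E n) x y = (if (x, y) = e n then 1 else 0)"
    by metis
  \<comment> \<open>Positions across different blocks contribute 0 instead of being left out. The
    family spans without being a basis, which is all that \<open>finite_dimensional\<close>
    demands.\<close>
  define b where "b n = (if p (fst (e n)) = p (snd (e n)) then E n else 0)" for n
  have fd: "finite_dimensional (operator_alg (block_ops Y p))"
    unfolding finite_dimensional_def alg_sum_operator_alg operator_alg_simps
  proof (intro exI[of _ N] exI[of _ b] conjI ballI allI impI)
    fix n assume "n < N"
    then have "e n \<in> Y \<times> Y"
      using e bij_betwE by blast
    then show "b n \<in> block_ops Y p"
      using E by (auto simp: b_def zero) (auto simp: block_ops_def E split: if_splits)
  next
    fix T assume T: "T \<in> block_ops Y p"
    have "T = (\<Sum>n<N. scale_operator (h T n) (b n))"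
    proof (rule operator_eqI)
      show "complex_linear T" using T complex_linear by blast
      show "complex_linear (\<Sum>n<N. scale_operator (h T n) (b n))"
        by (intro complex_linear_sum complex_linear_scale_operator) (simp add: b_def E)
      fix x y
      have "mat_entry (scale_operator (h T n) (b n)) x y = (if (x, y) = e n then mat_entry T x y else 0)" for n
      proof (cases "(x, y) = e n")
        case True
        then have "fst (e n) = x" "snd (e n) = y"
          by (metis fst_conv snd_conv)+
        then show ?thesis
          using True T by (auto simp: b_def E h_def block_ops_def)
      qed (simp add: b_def E)
      then have *: "mat_entry (\<Sum>n<N. scale_operator (h T n) (b n)) x y
          = (\<Sum>n<N. if (x, y) = e n then mat_entry T x y else 0)"
        by (simp add: mat_entry_sum)
      show "mat_entry T x y = mat_entry (\<Sum>n<N. scale_operator (h T n) (b n)) x y"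
      proof (cases "x \<in> Y \<and> y \<in> Y")
        case True
        then obtain n where n: "n < N" "e n = (x, y)"
          using ex by blast
        have "(x, y) = e m \<longleftrightarrow> n = m" if "m < N" for m
          using e n that by (auto simp: bij_betw_def inj_on_def)
        then have "(\<Sum>m<N. if (x, y) = e m then mat_entry T x y else 0) = (\<Sum>m<N. if n = m then mat_entry T x y else 0)"
          by (intro sum.cong) auto
        then show ?thesis using * n(1) by simp
      next
        case False
        then have "mat_entry T x y = 0"
          using T by (auto simp: block_ops_def)
        then show ?thesis unfolding * by (auto intro: sum.neutral)
      qed
    qed
    then show "\<exists>c. T = (\<Sum>n<N. scale_operator (c n) (b n))"
      by blast
  qed
  show ?thesis
    by (rule that[of k h]) (use hk in \<open>auto intro!: cstar_algebra_transport finite_dimensional_transport cstar_algebra fd\<close>)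
qed

subsection \<open>The uniform Roe algebra\<close>

abbreviation roe_ops :: "'x::metric_space operator set" where
  "roe_ops \<equiv> closure {T. complex_linear T \<and> finite_propagation T}"

lemma uniform_Roe_eq: "uniform_Roe = operator_alg roe_ops"
  by (simp add: uniform_Roe_def operator_alg_def)

lemma finite_propagation_comp:
  assumes "complex_linear T" "finite_propagation T" "finite_propagation S"
  shows "finite_propagation (T o\<^sub>L S)"
proof -
  obtain R R' where R: "\<And>x y. mat_entry T x y \<noteq> 0 \<Longrightarrow> dist x y \<le> R"
    "\<And>x y. mat_entry S x y \<noteq> 0 \<Longrightarrow> dist x y \<le> R'"
    using assms by (auto simp: finite_propagation_def)
  have "dist x y \<le> R + R'" if nz: "mat_entry (T o\<^sub>L S) x y \<noteq> 0" for x y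
  proof -
    obtain z where "mat_entry T x z \<noteq> 0" "mat_entry S z y \<noteq> 0"
      by (rule mat_entry_comp_neq_0D[OF assms(1) nz])
    then show ?thesis
      using R(1)[of x z] R(2)[of z y] dist_triangle[of x y z] by linarith
  qed
  then show ?thesis
    by (auto simp: finite_propagation_def)
qed

lemma finite_propagation_add:
  assumes "finite_propagation T" "finite_propagation S"
  shows "finite_propagation (T + S)"
proof -
  obtain R R' where R: "\<And>x y. mat_entry T x y \<noteq> 0 \<Longrightarrow> dist x y \<le> R"
    "\<And>x y. mat_entry S x y \<noteq> 0 \<Longrightarrow> dist x y \<le> R'"
    using assms by (auto simp: finite_propagation_def)
  have "dist x y \<le> max R R'" if "mat_entry (T + S) x y \<noteq> 0" for x y
  proof -
    have "mat_entry T x y \<noteq> 0 \<or> mat_entry S x y \<noteq> 0"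
      using that by auto
    then show ?thesis using R by fastforce
  qed
  then show ?thesis
    by (auto simp: finite_propagation_def)
qed

lemma finite_propagation_scale:
  assumes "finite_propagation T"
  shows "finite_propagation (scale_operator c T)"
  using assms unfolding finite_propagation_def mat_entry_scale mult_eq_0_iff by blast

lemma closure_invariant:
  assumes "\<And>x. x \<in> G \<Longrightarrow> f x \<in> closure H" "x \<in> closure G" "continuous_on UNIV f"
  shows "f x \<in> closure H"
  using image_closure_subset[of G f "closure H"] assms continuous_on_subset by blast

lemma bounded_linear_scale_operator: "bounded_linear (scale_operator c :: 'x operator \<Rightarrow> _)"
proof (rule bounded_linear_intro[where K = "cmod c"])
  show "scale_operator c (T + S) = scale_operator c T + scale_operator c S" for T S :: "'x operator"
    by (intro blinfun_eqI) (simp add: scale_operator_apply blinfun.add_left ell2_scale_add_right)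
  show "scale_operator c (r *\<^sub>R T) = r *\<^sub>R scale_operator c T" for r and T :: "'x operator"
    by (intro blinfun_eqI) (simp add: scale_operator_apply blinfun.scaleR_left ell2_scale_scaleR)
qed (simp add: mult.commute)

lemma operator_subalgebra_roe: "operator_subalgebra (roe_ops :: 'x::metric_space operator set)"
proof
  let ?G = "{T :: 'x operator. complex_linear T \<and> finite_propagation T}"
  have "roe_ops \<subseteq> {T :: 'x operator. complex_linear T}"
    by (rule closure_minimal[OF _ closed_complex_linear]) auto
  then show cl: "complex_linear T" if "T \<in> roe_ops" for T :: "'x operator"
    using that by blast
  show "closed (roe_ops :: 'x operator set)"
    by simp
  show "(0 :: 'x operator) \<in> roe_ops"
    by (rule subsetD[OF closure_subset]) (auto simp: finite_propagation_def)
  show "T + S \<in> roe_ops" if "T \<in> roe_ops" "S \<in> roe_ops" for T S :: "'x operator"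
  proof (rule closure_invariant[OF _ that(1), where f = "\<lambda>T. T + S"])
    fix T assume T: "T \<in> ?G"
    show "T + S \<in> roe_ops"
      by (rule closure_invariant[OF _ that(2), where f = "\<lambda>S. T + S"])
        (use T in \<open>auto intro!: subsetD[OF closure_subset] finite_propagation_add continuous_intros\<close>)
  qed (intro continuous_intros)
  show "T o\<^sub>L S \<in> roe_ops" if "T \<in> roe_ops" "S \<in> roe_ops" for T S :: "'x operator"
  proof (rule closure_invariant[OF _ that(1), where f = "\<lambda>T. T o\<^sub>L S"])
    fix T assume T: "T \<in> ?G"
    show "T o\<^sub>L S \<in> roe_ops"
      by (rule closure_invariant[OF _ that(2), where f = "\<lambda>S. T o\<^sub>L S"])
        (use T in \<open>auto intro!: subsetD[OF closure_subset] finite_propagation_comp continuous_intros\<close>)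
  qed (intro continuous_intros)
  show "scale_operator c T \<in> roe_ops" if "T \<in> roe_ops" for c and T :: "'x operator"
    by (rule closure_invariant[OF _ that])
      (auto intro!: subsetD[OF closure_subset] bounded_linear.continuous_on[OF bounded_linear_scale_operator]
        continuous_on_id finite_propagation_scale)
  \<comment> \<open>\<open>closure_invariant\<close> would need continuity on the whole space, but
    \<open>operator_adj\<close> is controlled on complex-linear operators only; hence the direct
    approximation.\<close>
  show "operator_adj T \<in> roe_ops" if T: "T \<in> roe_ops" for T :: "'x operator"
    unfolding closure_approachable
  proof (intro allI impI)
    fix e :: real assume "e > 0"
    then obtain S where S: "S \<in> ?G" "dist S T < e"
      using T unfolding closure_approachable by blast
    have "operator_adj S = operator_adj (S - T) + operator_adj T"
      using operator_adj_add[of "S - T" T] S(1) cl[OF T] by auto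
    then have "dist (operator_adj S) (operator_adj T) < e"
      using S cl[OF T] by (simp add: dist_norm complex_linear_diff)
    moreover have "operator_adj S \<in> ?G"
      using S(1) by (auto simp: finite_propagation_def mat_entry_adj) (metis dist_commute)
    ultimately show "\<exists>S\<in>?G. dist S (operator_adj T) < e"
      by blast
  qed
qed

lemma id_in_roe: "id_blinfun \<in> roe_ops"
  by (rule subsetD[OF closure_subset]) (auto simp: finite_propagation_def mat_entry_id split: if_splits)


section \<open>Square roots and sums of positive matrices\<close>

text \<open>\<open>I - Y\<close> is a square root of \<open>I - S\<close> when \<open>Y = (S + Y\<^sup>2) / 2\<close>. The iteration converges in
  norm because its increments are dominated by those of the scalar iteration for \<open>S = 1\<close>.\<close>

lemma square_root_iteration:
  fixes S :: "'h::banach \<Rightarrow>\<^sub>L 'h"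
  assumes S: "norm S \<le> 1" and C: "closed C" "0 \<in> C"
    and step: "\<And>Y. Y \<in> C \<Longrightarrow> (1/2) *\<^sub>R (S + (Y o\<^sub>L Y)) \<in> C"
  obtains Y where "Y \<in> C" "Y = (1/2) *\<^sub>R (S + (Y o\<^sub>L Y))"
proof -
  note bb = bounded_bilinear_blinfun_compose
  define Y where "Y = rec_nat 0 (\<lambda>_ Y. (1/2) *\<^sub>R (S + (Y o\<^sub>L Y)))"
  \<comment> \<open>With only \<open>norm S \<le> 1\<close> there is no uniform contraction factor
    to rely on; boundedness and monotonicity of \<open>y\<close> replace it.\<close>
  define y where "y = rec_nat 0 (\<lambda>_ y. (1 + y\<^sup>2) / 2 :: real)"
  have Y: "Y 0 = 0" "\<And>n. Y (Suc n) = (1/2) *\<^sub>R (S + (Y n o\<^sub>L Y n))"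
    by (simp_all add: Y_def)
  have y: "y 0 = 0" "\<And>n. y (Suc n) = (1 + (y n)\<^sup>2) / 2"
    by (simp_all add: y_def)
  have YC: "Y n \<in> C" for n
    by (induction n) (auto simp: Y C step)
  have y01: "0 \<le> y n \<and> y n \<le> 1" for n
  proof (induction n)
    case (Suc n)
    then have "(y n)\<^sup>2 \<le> 1" by (simp add: power_le_one)
    then show ?case by (simp add: y)
  qed (simp add: y)
  have mono: "y n \<le> y (Suc n)" for n
    using sum_squares_bound[of "y n" 1] by (simp add: y)
  have nY: "norm (Y n) \<le> y n" for n
  proof (induction n)
    case (Suc n)
    have "norm (Y n o\<^sub>L Y n) \<le> y n * y n"
      by (rule order_trans[OF norm_blinfun_compose]) (use Suc y01[of n] in \<open>auto intro: mult_mono\<close>)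
    then have "norm (S + (Y n o\<^sub>L Y n)) \<le> 1 + y n * y n"
      using S norm_triangle_ineq[of S "Y n o\<^sub>L Y n"] by linarith
    then show ?case
      by (simp add: Y y power2_eq_square)
  qed (simp add: Y y)
  have diff: "norm (Y (Suc n) - Y n) \<le> y (Suc n) - y n" for n
  proof (induction n)
    case 0
    then show ?case using S by (simp add: Y y)
  next
    case (Suc n)
    let ?A = "Y (Suc n)" and ?B = "Y n"
    have "Y (Suc (Suc n)) - Y (Suc n) = (1/2) *\<^sub>R ((?A o\<^sub>L ?A) - (?B o\<^sub>L ?B))"
      by (simp add: Y(2)[of "Suc n"]) (subst Y(2)[of n], simp add: algebra_simps)
    \<comment> \<open>A difference of squares split without commuting \<open>?A\<close> and
      \<open>?B\<close>; the same splitting of the scalar squares gives exactly the increment of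
      \<open>y\<close>.\<close>
    also have "(?A o\<^sub>L ?A) - (?B o\<^sub>L ?B) = (?A o\<^sub>L (?A - ?B)) + ((?A - ?B) o\<^sub>L ?B)"
      by (simp add: bounded_bilinear.diff_left[OF bb] bounded_bilinear.diff_right[OF bb])
    also have "norm ((1/2) *\<^sub>R ((?A o\<^sub>L (?A - ?B)) + ((?A - ?B) o\<^sub>L ?B)))
        \<le> (norm (?A o\<^sub>L (?A - ?B)) + norm ((?A - ?B) o\<^sub>L ?B)) / 2"
      using norm_triangle_ineq[of "?A o\<^sub>L (?A - ?B)" "(?A - ?B) o\<^sub>L ?B"] by simp
    also have "\<dots> \<le> (y (Suc n) * (y (Suc n) - y n) + (y (Suc n) - y n) * y n) / 2"
    proof (intro divide_right_mono add_mono)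
      show "norm (?A o\<^sub>L (?A - ?B)) \<le> y (Suc n) * (y (Suc n) - y n)"
        by (rule order_trans[OF norm_blinfun_compose])
          (intro mult_mono nY Suc.IH, use y01 mono in auto)
      show "norm ((?A - ?B) o\<^sub>L ?B) \<le> (y (Suc n) - y n) * y n"
        by (rule order_trans[OF norm_blinfun_compose])
          (intro mult_mono nY Suc.IH, use y01 mono in auto)
    qed simp
    also have "\<dots> = y (Suc (Suc n)) - y (Suc n)"
    proof -
      have "(a * (a - b) + (a - b) * b) / 2 = (1 + a\<^sup>2) / 2 - a" if "2 * a = 1 + b\<^sup>2" for a b :: real
        using that by (simp add: power2_eq_square field_simps)
      from this[of "y (Suc n)" "y n"] show ?thesis
        by (simp add: y(2)[of "Suc n"]) (simp add: y(2)[of n])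
    qed
    finally show ?case .
  qed
  have diff2: "norm (Y (n + k) - Y n) \<le> y (n + k) - y n" for n k
  proof (induction k)
    case (Suc k)
    have "Y (n + Suc k) - Y n = (Y (Suc (n + k)) - Y (n + k)) + (Y (n + k) - Y n)"
      by simp
    then show ?case
      using diff[of "n + k"] Suc norm_triangle_ineq[of "Y (Suc (n + k)) - Y (n + k)" "Y (n + k) - Y n"]
      by simp
  qed simp
  have "incseq y"
    using mono by (rule incseq_SucI)
  then have "convergent y"
    using y01 by (intro Bseq_monoseq_convergent BseqI'[of _ 1]) (auto simp: incseq_imp_monoseq)
  then have cy: "Cauchy y"
    by (rule convergent_Cauchy)
  have "Cauchy Y"
  proof (rule CauchyI)
    fix e :: real assume "e > 0"
    then obtain M where M: "\<And>m n. m \<ge> M \<Longrightarrow> n \<ge> M \<Longrightarrow> norm (y m - y n) < e"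
      using CauchyD[OF cy] by blast
    have "norm (Y m - Y n) < e" if "m \<ge> M" "n \<ge> M" "n \<le> m" for m n
      using diff2[of n "m - n"] M[of m n] that by auto
    then show "\<exists>M. \<forall>m\<ge>M. \<forall>n\<ge>M. norm (Y m - Y n) < e"
      by (metis nat_le_linear norm_minus_commute)
  qed
  then obtain L where L: "Y \<longlonglongrightarrow> L"
    using Cauchy_convergent convergent_def by blast
  have "(\<lambda>n. Y (Suc n)) \<longlonglongrightarrow> (1/2) *\<^sub>R (S + (L o\<^sub>L L))"
    unfolding Y(2) by (intro tendsto_intros bounded_bilinear.tendsto[OF bb] L)
  then have "L = (1/2) *\<^sub>R (S + (L o\<^sub>L L))"
    using LIMSEQ_unique LIMSEQ_Suc[OF L] by blast
  moreover have "L \<in> C"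
    using closed_sequentially[OF C(1) _ L] YC by simp
  ultimately show ?thesis
    using that by blast
qed

text \<open>Matrices over an operator algebra act on a direct sum of copies of \<open>\<ell>\<^sup>2(X)\<close>, realised as
  \<open>\<ell>\<^sup>2(\<nat> \<times> X)\<close>; only the first \<open>n\<close> copies matter.\<close>

definition inj_op :: "'i \<Rightarrow> 'x ell2 \<Rightarrow>\<^sub>L ('i \<times> 'x) ell2" where
  "inj_op i = (SOME J. \<forall>f k x. ell2_nth (blinfun_apply J f) (k, x) = (if k = i then ell2_nth f x else 0))"

definition prj_op :: "'i \<Rightarrow> ('i \<times> 'x) ell2 \<Rightarrow>\<^sub>L 'x ell2" where
  "prj_op i = (SOME Q. \<forall>f x. ell2_nth (blinfun_apply Q f) x = ell2_nth f (i, x))"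

lemma bounded_linear_ell2_exists:
  fixes T :: "'x ell2 \<Rightarrow> 'y \<Rightarrow> complex"
  assumes bound: "\<And>f E. finite E \<Longrightarrow> (\<Sum>z\<in>E. (cmod (T f z))\<^sup>2) \<le> (norm f)\<^sup>2"
    and add: "\<And>f g z. T (f + g) z = T f z + T g z"
    and scale: "\<And>r f z. T (r *\<^sub>R f) z = of_real r * T f z"
  shows "\<exists>J. \<forall>f z. ell2_nth (blinfun_apply J f) z = T f z"
proof -
  have "\<exists>h. (\<forall>z. ell2_nth h z = T f z) \<and> norm h \<le> norm f" for f
    by (rule ell2_of_bound[of "norm f" "T f"]) (use bound in auto)
  then obtain T0 where T0: "\<And>f z. ell2_nth (T0 f) z = T f z" "\<And>f. norm (T0 f) \<le> norm f"
    by metis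
  have "bounded_linear T0"
    by (rule bounded_linear_intro[where K = 1]) (auto intro!: ell2_eqI simp: T0 add scale)
  then show ?thesis
    by (intro exI[of _ "Blinfun T0"]) (simp add: bounded_linear_Blinfun_apply T0)
qed

lemma inj_op_nth:
  fixes i :: 'i and f :: "'x ell2"
  shows "ell2_nth (blinfun_apply (inj_op i) f) (k, x) = (if k = i then ell2_nth f x else 0)"
proof -
  have "\<exists>J. \<forall>(f :: 'x ell2) z. ell2_nth (blinfun_apply J f) z = (if fst z = i then ell2_nth f (snd z) else 0)"
  proof (rule bounded_linear_ell2_exists)
    fix f :: "'x ell2" and E :: "('i \<times> 'x) set" assume E: "finite E"
    have "(\<Sum>z\<in>E. (cmod (if fst z = i then ell2_nth f (snd z) else 0))\<^sup>2)
        = (\<Sum>z\<in>{z\<in>E. fst z = i}. (cmod (ell2_nth f (snd z)))\<^sup>2)"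
      using E by (intro sum.mono_neutral_cong_right) auto
    also have "\<dots> = (\<Sum>x\<in>snd ` {z\<in>E. fst z = i}. (cmod (ell2_nth f x))\<^sup>2)"
      by (subst sum.reindex) (auto simp: inj_on_def)
    also have "\<dots> \<le> (norm f)\<^sup>2"
      using E by (intro sum_le_norm_ell2_sq) auto
    finally show "(\<Sum>z\<in>E. (cmod (if fst z = i then ell2_nth f (snd z) else 0))\<^sup>2) \<le> (norm f)\<^sup>2" .
  qed auto
  then obtain J :: "'x ell2 \<Rightarrow>\<^sub>L ('i \<times> 'x) ell2"
    where "\<And>f z. ell2_nth (blinfun_apply J f) z = (if fst z = i then ell2_nth f (snd z) else 0)"
    by blast
  then have "\<exists>J. \<forall>(f :: 'x ell2) k x. ell2_nth (blinfun_apply J f) (k, x) = (if k = i then ell2_nth f x else 0)"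
    by (intro exI[of _ J]) simp
  from someI_ex[OF this, folded inj_op_def] show ?thesis
    by blast
qed

lemma prj_op_nth:
  fixes i :: 'i and f :: "('i \<times> 'x) ell2"
  shows "ell2_nth (blinfun_apply (prj_op i) f) x = ell2_nth f (i, x)"
proof -
  have "\<exists>Q. \<forall>(f :: ('i \<times> 'x) ell2) x. ell2_nth (blinfun_apply Q f) x = ell2_nth f (i, x)"
  proof (rule bounded_linear_ell2_exists)
    fix f :: "('i \<times> 'x) ell2" and E :: "'x set" assume E: "finite E"
    have "(\<Sum>x\<in>E. (cmod (ell2_nth f (i, x)))\<^sup>2) = (\<Sum>z\<in>Pair i ` E. (cmod (ell2_nth f z))\<^sup>2)"
      by (subst sum.reindex) (auto simp: inj_on_def)
    also have "\<dots> \<le> (norm f)\<^sup>2"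
      using E by (intro sum_le_norm_ell2_sq) auto
    finally show "(\<Sum>x\<in>E. (cmod (ell2_nth f (i, x)))\<^sup>2) \<le> (norm f)\<^sup>2" .
  qed auto
  from someI_ex[OF this, folded prj_op_def] show ?thesis
    by blast
qed

lemma inj_op_scale: "blinfun_apply (inj_op i) (ell2_scale c f) = ell2_scale c (blinfun_apply (inj_op i) f)"
  by (rule ell2_eqI) (auto simp: inj_op_nth)

lemma prj_op_scale: "blinfun_apply (prj_op i) (ell2_scale c f) = ell2_scale c (blinfun_apply (prj_op i) f)"
  by (rule ell2_eqI) (auto simp: prj_op_nth)

lemma prj_inj_op: "blinfun_apply (prj_op i) (blinfun_apply (inj_op j) f) = (if i = j then f else 0)"
  by (rule ell2_eqI) (simp add: inj_op_nth prj_op_nth)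

lemma cinner_inj_op: "cinner (blinfun_apply (inj_op i) f) g = cinner f (blinfun_apply (prj_op i) g)"
proof -
  have "cinner (blinfun_apply (inj_op i) f) g
      = (\<Sum>\<^sub>\<infinity>z\<in>range (Pair i). ell2_nth (blinfun_apply (inj_op i) f) z * cnj (ell2_nth g z))"
    unfolding cinner.rep_eq by (rule infsum_cong_neutral) (auto simp: inj_op_nth image_iff)
  also have "\<dots> = cinner f (blinfun_apply (prj_op i) g)"
    unfolding cinner.rep_eq by (subst infsum_reindex) (auto simp: inj_on_def inj_op_nth prj_op_nth o_def)
  finally show ?thesis .
qed

lemma cinner_prj_op: "cinner (blinfun_apply (prj_op i) g) f = cinner g (blinfun_apply (inj_op i) f)"
  using cinner_inj_op[of i f g] by (metis cinner_commute)

section \<open>Operator matrices as single operators\<close>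

definition op_entry :: "('i \<times> 'x) operator \<Rightarrow> 'i \<Rightarrow> 'i \<Rightarrow> 'x operator" where
  "op_entry M i j = prj_op i o\<^sub>L M o\<^sub>L inj_op j"

text \<open>The projection onto the first \<open>n\<close> copies. It acts as the unit of the
  \<open>n\<close> by \<open>n\<close> matrices inside the operators on infinitely many
  copies.\<close>

definition op_unit :: "nat \<Rightarrow> (nat \<times> 'x) operator" where
  "op_unit n = (\<Sum>i<n. inj_op i o\<^sub>L prj_op i)"

definition op_matrix :: "nat \<Rightarrow> (nat \<Rightarrow> nat \<Rightarrow> 'x operator) \<Rightarrow> (nat \<times> 'x) operator" where
  "op_matrix n a = (\<Sum>i<n. \<Sum>j<n. inj_op i o\<^sub>L a i j o\<^sub>L prj_op j)"

lemma op_entry_apply: "blinfun_apply (op_entry M i j) f =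
    blinfun_apply (prj_op i) (blinfun_apply M (blinfun_apply (inj_op j) f))"
  by (simp add: op_entry_def)

lemma op_unit_apply: "blinfun_apply (op_unit n) f = (\<Sum>i<n. blinfun_apply (inj_op i) (blinfun_apply (prj_op i) f))"
  by (simp add: op_unit_def blinfun.sum_left)

lemma op_matrix_apply: "blinfun_apply (op_matrix n a) f =
    (\<Sum>i<n. \<Sum>j<n. blinfun_apply (inj_op i) (blinfun_apply (a i j) (blinfun_apply (prj_op j) f)))"
  by (simp add: op_matrix_def blinfun.sum_left)

lemma op_unit_nth: "ell2_nth (blinfun_apply (op_unit n) f) (k, x) = (if k < n then ell2_nth f (k, x) else 0)"
  by (simp add: op_unit_apply ell2_nth_sum inj_op_nth prj_op_nth)

lemma op_unit_unit: "blinfun_apply (op_unit n) (blinfun_apply (op_unit n) f) = blinfun_apply (op_unit n) f"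
  by (rule ell2_eqI) (auto simp: op_unit_nth)

lemma complex_linear_op_unit: "complex_linear (op_unit n)"
  unfolding complex_linear_def by (intro allI ell2_eqI) (auto simp: op_unit_nth)

lemma cinner_op_unit: "cinner (blinfun_apply (op_unit n) f) g = cinner f (blinfun_apply (op_unit n) g)"
  by (simp add: op_unit_apply cinner_sum_left cinner_sum_right cinner_inj_op cinner_prj_op)

lemma op_unit_inj_op: "i < n \<Longrightarrow> blinfun_apply (op_unit n) (blinfun_apply (inj_op i) f) = blinfun_apply (inj_op i) f"
  by (rule ell2_eqI) (auto simp: op_unit_nth inj_op_nth)

lemma prj_op_op_unit: "i < n \<Longrightarrow> blinfun_apply (prj_op i) (blinfun_apply (op_unit n) f) = blinfun_apply (prj_op i) f"
  by (rule ell2_eqI) (auto simp: op_unit_nth prj_op_nth)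

lemma ell2_scale_sum: "ell2_scale c (\<Sum>i\<in>I. f i) = (\<Sum>i\<in>I. ell2_scale c (f i))"
  by (rule ell2_eqI) (simp add: ell2_nth_sum sum_distrib_left)

lemma complex_linearI:
  "(\<And>c f. blinfun_apply T (ell2_scale c f) = ell2_scale c (blinfun_apply T f)) \<Longrightarrow> complex_linear T"
  by (simp add: complex_linear_def)

lemma complex_linear_op_matrix:
  "(\<And>i j. i < n \<Longrightarrow> j < n \<Longrightarrow> complex_linear (a i j)) \<Longrightarrow> complex_linear (op_matrix n a)"
  by (rule complex_linearI, unfold op_matrix_apply ell2_scale_sum, intro sum.cong refl)
    (simp add: complex_linear_scale prj_op_scale inj_op_scale)

lemma op_entry_op_matrix:
  assumes "i < n" "j < n"
  shows "op_entry (op_matrix n a) i j = a i j"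
proof (rule blinfun_eqI)
  fix f
  have "blinfun_apply (op_entry (op_matrix n a) i j) f
      = (\<Sum>k<n. \<Sum>l<n. if i = k \<and> l = j then blinfun_apply (a k l) f else 0)"
    unfolding op_entry_apply op_matrix_apply blinfun.sum_right prj_inj_op
    by (intro sum.cong refl) (auto simp: blinfun.zero_right)
  also have "\<dots> = (\<Sum>k<n. if i = k then blinfun_apply (a k j) f else 0)"
    using assms(2) by (intro sum.cong refl) (auto simp: if_distrib cong: if_cong)
  finally show "blinfun_apply (op_entry (op_matrix n a) i j) f = blinfun_apply (a i j) f"
    using assms by simp
qed

text \<open>Matrix multiplication: the hypothesis inserts \<open>op_unit n\<close> between the
  factors, and this projection is the sum over the \<open>n\<close> intermediate indices.\<close>

lemma op_entry_comp:
  assumes "M o\<^sub>L op_unit n = M"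
  shows "op_entry (M o\<^sub>L N) i j = (\<Sum>k<n. op_entry M i k o\<^sub>L op_entry N k j)"
proof (rule blinfun_eqI)
  fix f
  have *: "blinfun_apply M g = (\<Sum>k<n. blinfun_apply M (blinfun_apply (inj_op k) (blinfun_apply (prj_op k) g)))" for g
    using arg_cong[OF assms, of "\<lambda>M. blinfun_apply M g"] by (simp add: op_unit_apply blinfun.sum_right)
  show "blinfun_apply (op_entry (M o\<^sub>L N) i j) f = blinfun_apply (\<Sum>k<n. op_entry M i k o\<^sub>L op_entry N k j) f"
    using arg_cong[OF *[of "blinfun_apply N (blinfun_apply (inj_op j) f)"], of "blinfun_apply (prj_op i)"]
    by (simp add: op_entry_apply blinfun.sum_left blinfun.sum_right)
qed

lemma op_entry_add: "op_entry (M + N) i j = op_entry M i j + op_entry N i j"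
  by (rule blinfun_eqI) (simp add: op_entry_apply blinfun.add_left blinfun.add_right)

lemma op_entry_scaleR: "op_entry (r *\<^sub>R M) i j = r *\<^sub>R op_entry M i j"
  by (rule blinfun_eqI) (simp add: op_entry_apply blinfun.scaleR_left blinfun.scaleR_right)

lemma op_entry_op_unit: "i < n \<Longrightarrow> j < n \<Longrightarrow> op_entry (op_unit n) i j = (if i = j then id_blinfun else 0)"
  by (rule blinfun_eqI) (simp add: op_entry_apply op_unit_inj_op prj_inj_op)

lemma op_entry_zero: "op_entry 0 i j = 0"
  by (rule blinfun_eqI) (simp add: op_entry_apply)

lemma operator_adj_op_entry:
  "complex_linear M \<Longrightarrow> operator_adj (op_entry M i j) = op_entry (operator_adj M) j i"
  by (rule operator_adj_unique) (simp add: op_entry_apply cinner_prj_op cinner_adj_right cinner_inj_op)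

context operator_subalgebra
begin

text \<open>The set in which the square root iteration runs: it is closed and stable under real
  combinations and squares, though not under arbitrary products. Self-adjointness is phrased through
  \<open>cinner\<close>, which makes it visibly a closed condition.\<close>

definition sa_matrices :: "nat \<Rightarrow> (nat \<times> 'x) operator set" where
  "sa_matrices n = {M. complex_linear M \<and>
     (\<forall>f g. cinner (blinfun_apply M f) g = cinner f (blinfun_apply M g)) \<and>
     (\<forall>i<n. \<forall>j<n. op_entry M i j \<in> C) \<and> op_unit n o\<^sub>L M = M \<and> M o\<^sub>L op_unit n = M}"

lemma closed_sa_matrices: "closed (sa_matrices n)"
proof -
  have bl: "bounded_linear (\<lambda>M. op_entry M i j)" for i j :: nat
    unfolding op_entry_def
    by (intro bounded_linear_compose[OF bounded_bilinear.bounded_linear_left[OF bounded_bilinear_blinfun_compose]]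
        bounded_bilinear.bounded_linear_right[OF bounded_bilinear_blinfun_compose])
  have sa: "closed {M. cinner (blinfun_apply M f) g = cinner f (blinfun_apply M g)}" for f g :: "(nat \<times> 'x) ell2"
    by (intro closed_Collect_eq continuous_intros
        bounded_linear.continuous_on[OF bounded_linear_cinner_left]
        bounded_linear.continuous_on[OF bounded_linear_cinner_right])
  have ent: "closed {M. op_entry M i j \<in> C}" for i j :: nat
    using continuous_closed_vimage[OF closed linear_continuous_at[OF bl[of i j]]]
    by (simp add: vimage_def)
  have "sa_matrices n = {M. complex_linear M} \<inter>
     (\<Inter>f. \<Inter>g. {M. cinner (blinfun_apply M f) g = cinner f (blinfun_apply M g)}) \<inter>
     (\<Inter>i\<in>{..<n}. \<Inter>j\<in>{..<n}. {M. op_entry M i j \<in> C}) \<inter>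
     {M. op_unit n o\<^sub>L M = M} \<inter> {M. M o\<^sub>L op_unit n = M}"
    by (auto simp: sa_matrices_def)
  also have "closed \<dots>"
    by (intro closed_Int closed_complex_linear closed_INT ballI sa ent closed_Collect_eq continuous_intros)
  finally show ?thesis .
qed

text \<open>With \<open>P = b\<^sup>*b + c\<^sup>*c\<close> and \<open>K\<close> large, \<open>S = I - P/K\<close> is a contraction, because
  \<open>\<parallel>P f\<parallel>\<^sup>2 \<le> K \<langle>P f, f\<rangle>\<close>; the self-adjoint square root of \<open>P\<close> then witnesses positivity.\<close>

lemma positive_mat_add:
  assumes id: "id_blinfun \<in> C"
    and x: "positive_mat (operator_alg C) n x" and y: "positive_mat (operator_alg C) n y"
  shows "positive_mat (operator_alg C) n (\<lambda>i j. x i j + y i j)"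
proof -
  obtain b where b: "\<And>i j. i < n \<Longrightarrow> j < n \<Longrightarrow> b i j \<in> C"
    "\<And>i j. i < n \<Longrightarrow> j < n \<Longrightarrow> x i j = (\<Sum>k<n. operator_adj (b k i) o\<^sub>L b k j)"
    using x unfolding positive_mat_operator_alg by blast
  obtain c where c: "\<And>i j. i < n \<Longrightarrow> j < n \<Longrightarrow> c i j \<in> C"
    "\<And>i j. i < n \<Longrightarrow> j < n \<Longrightarrow> y i j = (\<Sum>k<n. operator_adj (c k i) o\<^sub>L c k j)"
    using y unfolding positive_mat_operator_alg by blast
  let ?e = "op_unit n :: (nat \<times> 'x) operator"
  define SQ where "SQ M = operator_adj M o\<^sub>L M" for M :: "(nat \<times> 'x) operator"
  have square: "SQ (op_matrix n b) \<in> sa_matrices n"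
    "\<And>i j. i < n \<Longrightarrow> j < n \<Longrightarrow> op_entry (SQ (op_matrix n b)) i j = (\<Sum>k<n. operator_adj (b k i) o\<^sub>L b k j)"
    "complex_linear (op_matrix n b)"
    if bC: "\<And>i j. i < n \<Longrightarrow> j < n \<Longrightarrow> b i j \<in> C" for b
  proof -
    let ?B = "op_matrix n b"
    show cl: "complex_linear ?B"
      by (intro complex_linear_op_matrix complex_linear bC)
    have eB: "?e o\<^sub>L ?B = ?B"
      by (rule blinfun_eqI) (simp add: op_matrix_apply blinfun.sum_right op_unit_inj_op)
    have Be: "?B o\<^sub>L ?e = ?B"
      by (rule blinfun_eqI) (simp add: op_matrix_apply prj_op_op_unit)
    have adje: "operator_adj ?e = ?e"
      by (rule operator_adj_unique) (rule cinner_op_unit)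
    have ae: "operator_adj ?B o\<^sub>L ?e = operator_adj ?B"
      using operator_adj_comp[OF complex_linear_op_unit cl, of n] by (simp add: eB adje)
    have ea: "?e o\<^sub>L operator_adj ?B = operator_adj ?B"
      using operator_adj_comp[OF cl complex_linear_op_unit, of n] by (simp add: Be adje)
    show ent: "op_entry (SQ ?B) i j = (\<Sum>k<n. operator_adj (b k i) o\<^sub>L b k j)" if "i < n" "j < n" for i j
      unfolding SQ_def op_entry_comp[OF ae]
      by (intro sum.cong refl) (use that cl in \<open>simp add: op_entry_op_matrix flip: operator_adj_op_entry\<close>)
    show "SQ ?B \<in> sa_matrices n"
      unfolding sa_matrices_def
    proof (intro CollectI conjI allI impI)
      show "complex_linear (SQ ?B)"
        using cl by (auto simp: SQ_def)
      show "cinner (blinfun_apply (SQ ?B) f) g = cinner f (blinfun_apply (SQ ?B) g)" for f g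
        using cl by (simp add: SQ_def cinner_adj_left cinner_adj_right complex_linear_adj)
      show "op_entry (SQ ?B) i j \<in> C" if "i < n" "j < n" for i j
        unfolding ent[OF that] using that by (intro sum comp adj bC) auto
      show "?e o\<^sub>L SQ ?B = SQ ?B"
        unfolding SQ_def by (simp flip: operator_comp_assoc add: ea)
      show "SQ ?B o\<^sub>L ?e = SQ ?B"
        unfolding SQ_def by (simp add: operator_comp_assoc Be)
    qed
  qed
  define B where "B = op_matrix n b"
  define D where "D = op_matrix n c"
  have BD: "complex_linear B" "complex_linear D"
    using square(3) b(1) c(1) by (auto simp: B_def D_def)
  define P where "P = SQ B + SQ D"
  have sa_add: "M + N \<in> sa_matrices n" if "M \<in> sa_matrices n" "N \<in> sa_matrices n" for M N
    using that unfolding sa_matrices_def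
    by (auto simp: blinfun.add_left cinner_add_left cinner_add_right op_entry_add add
        bounded_bilinear.add_left[OF bounded_bilinear_blinfun_compose]
        bounded_bilinear.add_right[OF bounded_bilinear_blinfun_compose])
  have sa_scaleR: "r *\<^sub>R M \<in> sa_matrices n" if "M \<in> sa_matrices n" for M and r :: real
    using that unfolding sa_matrices_def
    by (auto simp: blinfun.scaleR_left cinner_scaleR_left cinner_scaleR_right op_entry_scaleR scaleR
        bounded_bilinear.scaleR_left[OF bounded_bilinear_blinfun_compose]
        bounded_bilinear.scaleR_right[OF bounded_bilinear_blinfun_compose])
  have sa_sq: "M o\<^sub>L M \<in> sa_matrices n" if M: "M \<in> sa_matrices n" for M
    unfolding sa_matrices_def
  proof (intro CollectI conjI allI impI)
    show "complex_linear (M o\<^sub>L M)"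
      using M by (auto simp: sa_matrices_def)
    show "cinner (blinfun_apply (M o\<^sub>L M) f) g = cinner f (blinfun_apply (M o\<^sub>L M) g)" for f g
      using M by (simp add: sa_matrices_def)
    show "op_entry (M o\<^sub>L M) i j \<in> C" if "i < n" "j < n" for i j
      using M that by (subst op_entry_comp[of _ n]) (auto simp: sa_matrices_def intro!: sum comp)
    show "?e o\<^sub>L (M o\<^sub>L M) = M o\<^sub>L M"
      using M by (simp add: sa_matrices_def flip: operator_comp_assoc)
    show "(M o\<^sub>L M) o\<^sub>L ?e = M o\<^sub>L M"
      using M by (simp add: sa_matrices_def operator_comp_assoc)
  qed
  have sa_e: "?e \<in> sa_matrices n"
    by (auto simp: sa_matrices_def complex_linear_op_unit cinner_op_unit op_entry_op_unit id zero
        op_unit_unit intro!: blinfun_eqI)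
  have sa_0: "0 \<in> sa_matrices n"
    by (auto simp: sa_matrices_def op_entry_zero zero intro!: blinfun_eqI)
  have PM: "P \<in> sa_matrices n"
    unfolding P_def B_def D_def by (intro sa_add square(1) b c)
  have Pe: "op_entry P i j = x i j + y i j" if "i < n" "j < n" for i j
    unfolding P_def B_def D_def op_entry_add using that b c by (simp add: square(2))
  \<comment> \<open>\<open>K\<close> dominates the coefficients \<open>2 * (norm B)\<^sup>2\<close>
    and \<open>2 * (norm D)\<^sup>2\<close> that arise from
    \<open>(a + b)\<^sup>2 \<le> 2 * a\<^sup>2 + 2 * b\<^sup>2\<close>; the summand 1 keeps it
    positive when both operators vanish.\<close>
  define K where "K = 2 * (norm B)\<^sup>2 + 2 * (norm D)\<^sup>2 + 1"
  have K: "K > 0"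
    unfolding K_def by (intro add_nonneg_pos add_nonneg_nonneg) auto
  define S where "S = ?e - (1 / K) *\<^sub>R P"
  have SM: "S \<in> sa_matrices n"
    unfolding S_def using sa_add[OF sa_e sa_scaleR[OF PM, of "- (1 / K)"]] by simp
  have "norm S \<le> 1"
  proof (rule norm_blinfun_bound)
    fix f
    \<comment> \<open>In \<open>S\<close> the projection \<open>?e\<close> stands where the overview
      of the argument has the identity, so the estimate runs through the truncation \<open>g\<close>
      of \<open>f\<close>.\<close>
    define g where "g = blinfun_apply ?e f"
    have nb: "(norm (blinfun_apply (SQ M) f))\<^sup>2 \<le> (norm M)\<^sup>2 * (norm (blinfun_apply M f))\<^sup>2"
      if "complex_linear M" for M :: "(nat \<times> 'x) operator"
    proof -
      have "norm (blinfun_apply (SQ M) f) \<le> norm M * norm (blinfun_apply M f)"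
        using norm_blinfun[of "operator_adj M" "blinfun_apply M f"] that by (simp add: SQ_def)
      then show ?thesis
        unfolding power_mult_distrib[symmetric] by (rule power_mono) simp
    qed
    have ip: "inner f (blinfun_apply (SQ M) f) = (norm (blinfun_apply M f))\<^sup>2"
      if "complex_linear M" for M :: "(nat \<times> 'x) operator"
      unfolding inner_ell2_def SQ_def using that
      by (simp add: cinner_self flip: cinner_adj_right)
    define p where "p = (norm (blinfun_apply B f))\<^sup>2 + (norm (blinfun_apply D f))\<^sup>2"
    have p0: "p \<ge> 0" by (simp add: p_def)
    have fP: "inner f (blinfun_apply P f) = p"
      by (simp add: P_def p_def blinfun.add_left inner_add_right ip BD)
    have "(norm (blinfun_apply P f))\<^sup>2 \<le> 2 * (norm (blinfun_apply (SQ B) f))\<^sup>2 + 2 * (norm (blinfun_apply (SQ D) f))\<^sup>2"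
    proof -
      have "norm (blinfun_apply P f) \<le> norm (blinfun_apply (SQ B) f) + norm (blinfun_apply (SQ D) f)"
        by (simp add: P_def blinfun.add_left norm_triangle_ineq)
      then have "(norm (blinfun_apply P f))\<^sup>2 \<le> (norm (blinfun_apply (SQ B) f) + norm (blinfun_apply (SQ D) f))\<^sup>2"
        by (rule power_mono) simp
      then show ?thesis
        using sum_squares_bound[of "norm (blinfun_apply (SQ B) f)" "norm (blinfun_apply (SQ D) f)"]
        by (simp add: power2_sum)
    qed
    also have "\<dots> \<le> 2 * ((norm B)\<^sup>2 * (norm (blinfun_apply B f))\<^sup>2) + 2 * ((norm D)\<^sup>2 * (norm (blinfun_apply D f))\<^sup>2)"
      by (intro add_mono mult_left_mono nb BD) auto
    also have "\<dots> \<le> K * (norm (blinfun_apply B f))\<^sup>2 + K * (norm (blinfun_apply D f))\<^sup>2"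
      unfolding mult.assoc[symmetric] K_def by (intro add_mono mult_right_mono) auto
    finally have nP: "(norm (blinfun_apply P f))\<^sup>2 \<le> K * p"
      by (simp add: p_def distrib_left)
    have gP: "inner g (blinfun_apply P f) = p"
    proof -
      have "blinfun_apply ?e (blinfun_apply P f) = blinfun_apply P f"
        using PM by (metis (mono_tags, lifting) blinfun_apply_blinfun_compose mem_Collect_eq sa_matrices_def)
      then show ?thesis
        unfolding fP[symmetric] by (simp add: inner_ell2_def g_def cinner_op_unit)
    qed
    have "(norm g)\<^sup>2 \<le> norm f * norm g"
    proof -
      have "(norm g)\<^sup>2 = inner f g"
        unfolding power2_norm_eq_inner inner_ell2_def g_def by (simp add: cinner_op_unit op_unit_unit)
      then show ?thesis using norm_cauchy_schwarz by metis
    qed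
    then have "norm g * norm g \<le> norm f * norm g"
      by (simp only: power2_eq_square)
    then have ng: "norm g \<le> norm f"
      by (rule le_of_mult_self_le) auto
    have "(norm (blinfun_apply S f))\<^sup>2 = (norm g)\<^sup>2 - 2 * p / K + (norm (blinfun_apply P f))\<^sup>2 / K\<^sup>2"
    proof -
      have "blinfun_apply S f = g - (1 / K) *\<^sub>R blinfun_apply P f"
        by (simp add: S_def g_def blinfun.diff_left blinfun.scaleR_left)
      moreover have "inner (blinfun_apply P f) g = p"
        using gP by (simp add: inner_commute)
      ultimately show ?thesis
        unfolding power2_norm_eq_inner
        by (simp add: inner_diff_left inner_diff_right gP power2_eq_square diff_divide_distrib)
    qed
    also have "\<dots> \<le> (norm g)\<^sup>2 - 2 * p / K + K * p / K\<^sup>2"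
      using nP by (intro add_left_mono divide_right_mono) auto
    also have "\<dots> = (norm g)\<^sup>2 - p / K"
      using K by (simp add: power2_eq_square field_simps)
    also have "\<dots> \<le> (norm f)\<^sup>2"
    proof -
      have "(norm g)\<^sup>2 \<le> (norm f)\<^sup>2" "0 \<le> p / K"
        using ng p0 K by (auto intro: power_mono)
      then show ?thesis by linarith
    qed
    finally show "norm (blinfun_apply S f) \<le> 1 * norm f"
      by (simp add: power2_le_iff_abs_le)
  qed simp
  then obtain Y where Y: "Y \<in> sa_matrices n" "Y = (1/2) *\<^sub>R (S + (Y o\<^sub>L Y))"
    by (rule square_root_iteration[OF _ closed_sa_matrices sa_0]) (intro sa_scaleR sa_add SM sa_sq)
  \<comment> \<open>From \<open>2 Y = S + Y\<^sup>2\<close> the square of \<open>?e - Y\<close> is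
    \<open>?e - S = P / K\<close>, so \<open>Z\<close> is the self-adjoint root of
    \<open>P\<close>.\<close>
  define Z where "Z = sqrt K *\<^sub>R (?e - Y)"
  have ZM: "Z \<in> sa_matrices n"
    unfolding Z_def using sa_scaleR[OF sa_add[OF sa_e sa_scaleR[OF Y(1), of "-1"]]] by simp
  have "Z o\<^sub>L Z = P"
  proof -
    have eY: "?e o\<^sub>L Y = Y" "Y o\<^sub>L ?e = Y" "?e o\<^sub>L ?e = ?e"
      using Y(1) sa_e by (auto simp: sa_matrices_def)
    have "Z o\<^sub>L Z = K *\<^sub>R ((?e - Y) o\<^sub>L (?e - Y))"
      using K by (simp add: Z_def bounded_bilinear.scaleR_left[OF bounded_bilinear_blinfun_compose]
        bounded_bilinear.scaleR_right[OF bounded_bilinear_blinfun_compose])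
    also have "(?e - Y) o\<^sub>L (?e - Y) = ?e - 2 *\<^sub>R Y + (Y o\<^sub>L Y)"
      by (simp add: bounded_bilinear.diff_left[OF bounded_bilinear_blinfun_compose]
        bounded_bilinear.diff_right[OF bounded_bilinear_blinfun_compose] eY scaleR_2)
    also have "2 *\<^sub>R Y = S + (Y o\<^sub>L Y)"
      using arg_cong[OF Y(2), of "\<lambda>Z. 2 *\<^sub>R Z"] by simp
    finally show ?thesis
      using K by (simp add: S_def)
  qed
  have adjZ: "operator_adj Z = Z" and clZ: "complex_linear Z" and Ze: "Z o\<^sub>L ?e = Z"
    using ZM by (auto simp: sa_matrices_def intro: operator_adj_unique)
  show ?thesis
    unfolding positive_mat_operator_alg
  proof (intro exI[of _ "op_entry Z"] conjI allI impI)
    show "op_entry Z i j \<in> C" if "i < n" "j < n" for i j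
      using ZM that by (auto simp: sa_matrices_def)
    show "x i j + y i j = (\<Sum>k<n. operator_adj (op_entry Z k i) o\<^sub>L op_entry Z k j)" if "i < n" "j < n" for i j
      using op_entry_comp[OF Ze, of Z i j] Pe[OF that] \<open>Z o\<^sub>L Z = P\<close>
      by (simp add: operator_adj_op_entry clZ adjZ)
  qed
qed

lemma positive_mat_zero: "positive_mat (operator_alg C) n (\<lambda>i j. 0)"
  unfolding positive_mat_operator_alg by (intro exI[of _ "\<lambda>i j. 0"]) (auto simp: zero)

lemma positive_mat_sum:
  assumes "id_blinfun \<in> C" "finite I" "\<And>t. t \<in> I \<Longrightarrow> positive_mat (operator_alg C) n (x t)"
  shows "positive_mat (operator_alg C) n (\<lambda>i j. \<Sum>t\<in>I. x t i j)"
  using assms(2,3)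
proof (induction I)
  case empty
  then show ?case by (simp add: positive_mat_zero)
next
  case (insert t I)
  then show ?case
    using positive_mat_add[OF assms(1), of n "x t" "\<lambda>i j. \<Sum>t\<in>I. x t i j"] by simp
qed

end

text \<open>Gram-Schmidt: one vector is split off, the others are projected to its orthogonal complement.\<close>

lemma Gram_matrix_factorization:
  fixes v :: "'i \<Rightarrow> 'k \<Rightarrow> 'x ell2"
  assumes "finite I" "finite K"
  shows "\<exists>w :: 'i \<Rightarrow> 'i \<Rightarrow> complex. \<forall>i\<in>I. \<forall>j\<in>I.
    (\<Sum>k\<in>K. cinner (v i k) (v j k)) = (\<Sum>l\<in>I. w i l * cnj (w j l))"
  using assms(1)
proof (induction I arbitrary: v)
  case (insert a I)
  define G where "G v i j = (\<Sum>k\<in>K. cinner (v i k) (v j k))" for v :: "'i \<Rightarrow> 'k \<Rightarrow> 'x ell2" and i j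
  have G_commute: "G v i j = cnj (G v j i)" for i j
    unfolding G_def cnj_sum by (intro sum.cong refl cinner_commute)
  define s where "s = (\<Sum>k\<in>K. (norm (v a k))\<^sup>2)"
  have s0: "s \<ge> 0" by (simp add: s_def sum_nonneg)
  have Gaa: "G v a a = of_real s"
    by (simp add: G_def s_def cinner_self)
  \<comment> \<open>The coefficients of the vectors along the normalised \<open>v a\<close>. If
    \<open>s = 0\<close>, division yields 0 while all \<open>v a k\<close> with
    \<open>k \<in> K\<close> vanish, so the formulas below remain valid.\<close>
  define c where "c i = G v i a / of_real (sqrt s)" for i
  define v' where "v' i k = v i k - ell2_scale (c i / of_real (sqrt s)) (v a k)" for i k
  have Gia: "G v i a = c i * of_real (sqrt s)" for i
  proof (cases "s = 0")
    case True
    then have "v a k = 0" if "k \<in> K" for k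
      using that assms(2) by (simp add: s_def sum_nonneg_eq_0_iff)
    then have "G v i a = 0"
      by (simp add: G_def)
    then show ?thesis using True by simp
  qed (simp add: c_def)
  have Gai: "G v a i = cnj (c i) * of_real (sqrt s)" for i
    using G_commute[of a i] by (simp add: Gia)
  have G': "G v' i j = G v i j - c i * cnj (c j)" for i j
  proof -
    have "G v' i j = G v i j - cnj (c j / of_real (sqrt s)) * G v i a
        - (c i / of_real (sqrt s)) * G v a j
        + (c i / of_real (sqrt s)) * cnj (c j / of_real (sqrt s)) * G v a a"
      by (simp add: G_def v'_def cinner_minus_left cinner_minus_right cinner_scale_left
          cinner_scale_right sum.distrib sum_subtractf sum_distrib_left sum_divide_distrib algebra_simps)
    also have "\<dots> = G v i j - c i * cnj (c j)"
    proof (cases "s = 0")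
      case True
      then show ?thesis by (simp add: c_def)
    next
      case False
      have "of_real s = of_real (sqrt s) * (of_real (sqrt s) :: complex)"
        using s0 by (simp flip: of_real_mult)
      then show ?thesis
        unfolding Gaa unfolding Gia Gai using False by (simp add: field_simps)
    qed
    finally show ?thesis .
  qed
  have ca: "G v i j = c i * cnj (c j)" if "i = a \<or> j = a" for i j
  proof -
    have "c a = of_real (sqrt s)"
      using s0 by (simp add: c_def Gaa real_div_sqrt flip: of_real_divide)
    then show ?thesis
      using that by (auto simp: Gia Gai)
  qed
  obtain w :: "'i \<Rightarrow> 'i \<Rightarrow> complex" where w: "\<And>i j. i \<in> I \<Longrightarrow> j \<in> I \<Longrightarrow> G v' i j = (\<Sum>l\<in>I. w i l * cnj (w j l))"
    using insert.IH[of v'] unfolding G_def by blast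
  \<comment> \<open>Column \<open>a\<close> records the components along the vector split off; row
    \<open>a\<close> has no other entries, since that vector has no component in the orthogonal
    complement.\<close>
  define w' where "w' i l = (if l = a then c i else if i = a then 0 else w i l)" for i l
  show ?case
  proof (intro exI[of _ w'] ballI)
    fix i j assume ij: "i \<in> insert a I" "j \<in> insert a I"
    have "(\<Sum>l\<in>insert a I. w' i l * cnj (w' j l)) = c i * cnj (c j) + (\<Sum>l\<in>I. w' i l * cnj (w' j l))"
      using insert by (simp add: w'_def)
    also have "\<dots> = G v i j"
    proof (cases "i = a \<or> j = a")
      case True
      then have "(\<Sum>l\<in>I. w' i l * cnj (w' j l)) = 0"
        using insert by (intro sum.neutral) (auto simp: w'_def)
      then show ?thesis using ca[OF True] by simp
    next
      case False
      then have "(\<Sum>l\<in>I. w' i l * cnj (w' j l)) = (\<Sum>l\<in>I. w i l * cnj (w j l))"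
        using insert by (intro sum.cong) (auto simp: w'_def)
      then show ?thesis
        using False ij w[of i j] by (simp add: G' diff_eq_eq add.commute)
    qed
    finally show "(\<Sum>k\<in>K. cinner (v i k) (v j k)) = (\<Sum>l\<in>insert a I. w' i l * cnj (w' j l))"
      by (simp add: G_def)
  qed
qed simp


section \<open>Block diagonal models\<close>

lemmas complex_linear_ops = complex_linear_add complex_linear_diff complex_linear_scale_operator
  complex_linear_comp complex_linear_adj

lemma finite_matrix_operator:
  assumes "finite Y" and m: "\<And>x y. m x y \<noteq> 0 \<Longrightarrow> x \<in> Y \<and> y \<in> Y"
  obtains T where "complex_linear T" "\<And>x y. mat_entry T x y = m x y"
proof -
  define c where "c = (\<Sum>z\<in>Y \<times> Y. cmod (m (fst z) (snd z)))"
  have c: "cmod (m x y) \<le> c" for x y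
  proof (cases "x \<in> Y \<and> y \<in> Y")
    case True
    then show ?thesis
      using member_le_sum[of "(x, y)" "Y \<times> Y" "\<lambda>z. cmod (m (fst z) (snd z))"] assms(1) by (simp add: c_def)
  next
    case False
    then have "m x y = 0" using m by blast
    then show ?thesis by (simp add: c_def sum_nonneg)
  qed
  show ?thesis
    by (rule Schur_test_exists[of m "\<lambda>x y. x \<in> Y \<and> y \<in> Y" "card Y" c])
      (use m c that assms(1) in \<open>auto intro: card_mono\<close>)
qed

lemma norm_sum_delta_sq:
  assumes "finite U" "inj_on \<beta> U"
  shows "(norm (\<Sum>y\<in>U. ell2_scale (f y) (delta (\<beta> y))))\<^sup>2 = (\<Sum>y\<in>U. (cmod (f y))\<^sup>2)"
proof -
  have "of_real ((norm (\<Sum>y\<in>U. ell2_scale (f y) (delta (\<beta> y))))\<^sup>2)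
      = (\<Sum>y\<in>U. \<Sum>z\<in>U. f z * cnj (f y) * (if \<beta> y = \<beta> z then 1 else 0))"
    unfolding cinner_self[symmetric]
    by (simp add: cinner_sum_left cinner_sum_right cinner_scale_left cinner_scale_right ell2_nth_sum
        ell2_nth_delta sum_distrib_left mult_ac)
  also have "\<dots> = (\<Sum>y\<in>U. \<Sum>z\<in>U. if y = z then f z * cnj (f y) else 0)"
    using assms(2) by (intro sum.cong refl) (auto simp: inj_on_def)
  also have "\<dots> = of_real (\<Sum>y\<in>U. (cmod (f y))\<^sup>2)"
    using assms(1) unfolding of_real_sum complex_norm_square by simp
  finally show ?thesis
    using of_real_eq_iff by blast
qed

text \<open>\<open>S\<close> is partitioned into blocks by the labelling \<open>p\<close>. The map \<open>\<beta>\<close> sends each block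
  bijectively onto one of finitely many model blocks, whose union is \<open>\<beta> ` S\<close>.\<close>

locale block_model =
  fixes S :: "'x::metric_space set" and p :: "'x \<Rightarrow> 'l" and \<beta> :: "'x \<Rightarrow> 'x" and D :: real and N :: nat
  assumes block_finite: "x \<in> S \<Longrightarrow> finite {y\<in>S. p y = p x}"
    and block_card: "x \<in> S \<Longrightarrow> card {y\<in>S. p y = p x} \<le> N"
    and block_dist: "x \<in> S \<Longrightarrow> y \<in> S \<Longrightarrow> p x = p y \<Longrightarrow> dist x y \<le> D"
    and \<beta>_closed: "x \<in> S \<Longrightarrow> \<beta> x \<in> S"
    and finite_range: "finite (\<beta> ` S)"
    and \<beta>_label: "x \<in> S \<Longrightarrow> y \<in> S \<Longrightarrow> p x = p y \<Longrightarrow> p (\<beta> x) = p (\<beta> y)"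
    and \<beta>_inj: "x \<in> S \<Longrightarrow> y \<in> S \<Longrightarrow> p x = p y \<Longrightarrow> \<beta> x = \<beta> y \<Longrightarrow> x = y"
    and \<beta>_surj: "x \<in> S \<Longrightarrow> z \<in> S \<Longrightarrow> p z = p (\<beta> x) \<Longrightarrow> \<exists>y\<in>S. p y = p x \<and> \<beta> y = z"
begin

abbreviation blk :: "'x \<Rightarrow> 'x set" where "blk x \<equiv> {y\<in>S. p y = p x}"

abbreviation model :: "'x operator set" where "model \<equiv> block_ops (\<beta> ` S) p"

lemma \<beta>_block: "x \<in> S \<Longrightarrow> bij_betw \<beta> (blk x) (blk (\<beta> x))"
  unfolding bij_betw_def
proof
  assume x: "x \<in> S"
  show "inj_on \<beta> (blk x)"
    by (rule inj_onI) (auto intro: \<beta>_inj)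
  show "\<beta> ` blk x = blk (\<beta> x)"
  proof
    show "\<beta> ` blk x \<subseteq> blk (\<beta> x)"
      using x \<beta>_closed \<beta>_label by blast
    show "blk (\<beta> x) \<subseteq> \<beta> ` blk x"
      using \<beta>_surj[OF x] by blast
  qed
qed

lemma model_block: "x \<in> \<beta> ` S \<Longrightarrow> y \<in> S \<Longrightarrow> p y = p x \<Longrightarrow> y \<in> \<beta> ` S"
  using \<beta>_surj by blast

subsection \<open>Spreading out a model matrix\<close>

definition spread :: "'x operator \<Rightarrow> 'x operator" where
  "spread T = (SOME W. complex_linear W \<and> norm W \<le> norm T \<and>
     (\<forall>x y. mat_entry W x y = (if x \<in> S \<and> y \<in> S \<and> p x = p y then mat_entry T (\<beta> x) (\<beta> y) else 0)))"

text \<open>On each block \<open>\<beta>\<close> carries \<open>f\<close> isometrically to a vector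
  on the model block, where \<open>T\<close> acts with its own norm. The blocks are disjoint, so the
  squares add up and infinitely many copies cost nothing in norm.\<close>

lemma
  assumes T: "complex_linear T"
  shows complex_linear_spread: "complex_linear (spread T)"
    and norm_spread: "norm (spread T) \<le> norm T"
    and mat_entry_spread: "mat_entry (spread T) x y =
      (if x \<in> S \<and> y \<in> S \<and> p x = p y then mat_entry T (\<beta> x) (\<beta> y) else 0)"
proof -
  define m where "m x y = (if x \<in> S \<and> y \<in> S \<and> p x = p y then mat_entry T (\<beta> x) (\<beta> y) else 0)" for x y
  have mS: "m x y \<noteq> 0 \<Longrightarrow> x \<in> S \<and> y \<in> blk x" for x y
    by (auto simp: m_def split: if_splits)
  have fin: "finite {y. m x y \<noteq> 0}" for x
  proof (cases "x \<in> S")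
    case True
    show ?thesis
      by (rule finite_subset[OF _ block_finite[OF True]]) (use mS in blast)
  next
    case False
    then have "{y. m x y \<noteq> 0} = {}" using mS by blast
    then show ?thesis by simp
  qed
  have bound: "(\<Sum>x\<in>E. (cmod (\<Sum>y | m x y \<noteq> 0. m x y * ell2_nth f y))\<^sup>2) \<le> (norm T * norm f)\<^sup>2"
    if E: "finite E" for E f
  proof -
    define row where "row x = (\<Sum>y | m x y \<noteq> 0. m x y * ell2_nth f y)" for x
    define g where "g U = (\<Sum>y\<in>U. ell2_scale (ell2_nth f y) (delta (\<beta> y)))" for U
    \<comment> \<open>Only the blocks that meet \<open>E\<close>, hence finitely many; enlarging
      \<open>E\<close> to their union keeps whole blocks together.\<close>
    define V where "V = blk ` (E \<inter> S)"
    have V: "finite V" "\<And>U. U \<in> V \<Longrightarrow> finite U"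
      using E block_finite by (auto simp: V_def)
    have disj: "\<And>U U'. U \<in> V \<Longrightarrow> U' \<in> V \<Longrightarrow> U \<noteq> U' \<Longrightarrow> U \<inter> U' = {}"
      by (auto simp: V_def)
    have rowU: "row x = ell2_nth (blinfun_apply T (g (blk x))) (\<beta> x)" if x: "x \<in> S" for x
    proof -
      have "row x = (\<Sum>y\<in>blk x. m x y * ell2_nth f y)"
        unfolding row_def using mS block_finite[OF x] by (intro sum.mono_neutral_left) auto
      also have "\<dots> = (\<Sum>y\<in>blk x. ell2_nth f y * mat_entry T (\<beta> x) (\<beta> y))"
        using x by (intro sum.cong) (auto simp: m_def)
      finally show ?thesis
        by (simp add: g_def blinfun.sum_right ell2_nth_sum complex_linear_scale[OF T] mat_entry_nth)
    qed
    have row0: "row x = 0" if "x \<notin> S" for x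
      unfolding row_def using mS[of x] that by (intro sum.neutral) auto
    have inj: "inj_on \<beta> U" if "U \<in> V" for U
      using that \<beta>_block by (auto simp: V_def bij_betw_def)
    have "(\<Sum>x\<in>E. (cmod (row x))\<^sup>2) = (\<Sum>x\<in>E \<inter> S. (cmod (row x))\<^sup>2)"
      using E row0 by (intro sum.mono_neutral_right) auto
    also have "\<dots> \<le> (\<Sum>x\<in>\<Union>V. (cmod (row x))\<^sup>2)"
      using V by (intro sum_mono2) (auto simp: V_def)
    also have "\<dots> = (\<Sum>U\<in>V. \<Sum>x\<in>U. (cmod (row x))\<^sup>2)"
      using V disj by (subst sum.Union_disjoint) auto
    also have "\<dots> \<le> (\<Sum>U\<in>V. (norm T)\<^sup>2 * (\<Sum>y\<in>U. (cmod (ell2_nth f y))\<^sup>2))"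
    proof (rule sum_mono)
      fix U assume U: "U \<in> V"
      have "(\<Sum>x\<in>U. (cmod (row x))\<^sup>2) = (\<Sum>x\<in>U. (cmod (ell2_nth (blinfun_apply T (g U)) (\<beta> x)))\<^sup>2)"
      proof (rule sum.cong)
        fix x assume "x \<in> U"
        then have "x \<in> S" "blk x = U"
          using U by (auto simp: V_def)
        then show "(cmod (row x))\<^sup>2 = (cmod (ell2_nth (blinfun_apply T (g U)) (\<beta> x)))\<^sup>2"
          using rowU by metis
      qed simp
      also have "\<dots> = (\<Sum>z\<in>\<beta> ` U. (cmod (ell2_nth (blinfun_apply T (g U)) z))\<^sup>2)"
        by (simp add: sum.reindex[OF inj[OF U]])
      also have "\<dots> \<le> (norm (blinfun_apply T (g U)))\<^sup>2"
        using V U by (intro sum_le_norm_ell2_sq) auto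
      also have "\<dots> \<le> (norm T * norm (g U))\<^sup>2"
        by (intro power_mono norm_blinfun) simp
      also have "\<dots> = (norm T)\<^sup>2 * (\<Sum>y\<in>U. (cmod (ell2_nth f y))\<^sup>2)"
        unfolding power_mult_distrib g_def using norm_sum_delta_sq[OF V(2)[OF U] inj[OF U]] by metis
      finally show "(\<Sum>x\<in>U. (cmod (row x))\<^sup>2) \<le> (norm T)\<^sup>2 * (\<Sum>y\<in>U. (cmod (ell2_nth f y))\<^sup>2)" .
    qed
    also have "\<dots> = (norm T)\<^sup>2 * (\<Sum>y\<in>\<Union>V. (cmod (ell2_nth f y))\<^sup>2)"
      unfolding sum_distrib_left[symmetric] using V disj by (subst sum.Union_disjoint) auto
    also have "\<dots> \<le> (norm T)\<^sup>2 * (norm f)\<^sup>2"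
      using V by (intro mult_left_mono sum_le_norm_ell2_sq) auto
    finally show ?thesis
      by (simp add: row_def power_mult_distrib)
  qed
  obtain W where "complex_linear W" "\<And>x y. mat_entry W x y = m x y" "norm W \<le> norm T"
    by (rule operator_of_matrix[OF fin norm_ge_zero bound]) (auto simp: that)
  then have "\<exists>W. complex_linear W \<and> norm W \<le> norm T \<and>
      (\<forall>x y. mat_entry W x y = (if x \<in> S \<and> y \<in> S \<and> p x = p y then mat_entry T (\<beta> x) (\<beta> y) else 0))"
    by (auto simp: m_def)
  from someI_ex[OF this, folded spread_def]
  show "complex_linear (spread T)" "norm (spread T) \<le> norm T"
    "mat_entry (spread T) x y = (if x \<in> S \<and> y \<in> S \<and> p x = p y then mat_entry T (\<beta> x) (\<beta> y) else 0)"
    by auto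
qed

lemma model_complex_linear: "T \<in> model \<Longrightarrow> complex_linear T"
  by (simp add: block_ops_def)

lemma spread_add: "complex_linear T \<Longrightarrow> complex_linear T' \<Longrightarrow> spread (T + T') = spread T + spread T'"
  by (rule operator_eqI) (auto simp: mat_entry_spread complex_linear_spread complex_linear_ops)

lemma spread_zero: "spread 0 = 0"
  by (rule operator_eqI) (auto simp: mat_entry_spread complex_linear_spread complex_linear_ops)

lemma spread_scale: "complex_linear T \<Longrightarrow> spread (scale_operator c T) = scale_operator c (spread T)"
  by (rule operator_eqI) (auto simp: mat_entry_spread complex_linear_spread complex_linear_ops)

lemma spread_adj: "complex_linear T \<Longrightarrow> spread (operator_adj T) = operator_adj (spread T)"
  by (rule operator_eqI)
    (auto simp: mat_entry_spread complex_linear_spread complex_linear_adj mat_entry_adj)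

lemma spread_sum: "(\<And>i. i \<in> I \<Longrightarrow> complex_linear (T i)) \<Longrightarrow> spread (\<Sum>i\<in>I. T i) = (\<Sum>i\<in>I. spread (T i))"
  by (induction I rule: infinite_finite_induct) (auto simp: spread_zero spread_add complex_linear_sum)

text \<open>A matrix in the model does not leave the block of \<open>\<beta> x\<close>, so the
  intermediate points range over that block, and \<open>\<beta>\<close> reindexes it bijectively by
  the block of \<open>x\<close>. Thus spreading is a homomorphism on the model.\<close>

lemma spread_comp:
  assumes T: "T \<in> model" and T': "T' \<in> model"
  shows "spread (T o\<^sub>L T') = spread T o\<^sub>L spread T'"
proof (rule operator_eqI)
  note cl = model_complex_linear[OF T] model_complex_linear[OF T']
  show "complex_linear (spread (T o\<^sub>L T'))" "complex_linear (spread T o\<^sub>L spread T')"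
    using cl by (auto intro: complex_linear_spread)
  fix x y
  show "mat_entry (spread (T o\<^sub>L T')) x y = mat_entry (spread T o\<^sub>L spread T') x y"
  proof (cases "x \<in> S")
    case False
    then have "mat_entry (spread T o\<^sub>L spread T') x y = 0"
      using cl mat_entry_comp[of "spread T" "{}" x "spread T'" y]
      by (simp add: complex_linear_spread mat_entry_spread)
    then show ?thesis
      using False cl by (auto simp: mat_entry_spread complex_linear_ops)
  next
    case x: True
    have 1: "mat_entry (spread T o\<^sub>L spread T') x y = (\<Sum>z\<in>blk x. mat_entry (spread T) x z * mat_entry (spread T') z y)"
      using cl block_finite[OF x] by (intro mat_entry_comp) (auto simp: complex_linear_spread mat_entry_spread)
    show ?thesis
    proof (cases "y \<in> S \<and> p x = p y")
      case True
      have "mat_entry (T o\<^sub>L T') (\<beta> x) (\<beta> y) = (\<Sum>z\<in>blk (\<beta> x). mat_entry T (\<beta> x) z * mat_entry T' z (\<beta> y))"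
      proof (rule mat_entry_comp[OF cl(1) block_finite[OF \<beta>_closed[OF x]]])
        fix z assume z: "z \<notin> blk (\<beta> x)"
        have "z \<in> \<beta> ` S \<and> p (\<beta> x) = p z" if "mat_entry T (\<beta> x) z \<noteq> 0"
          using T that by (simp add: block_ops_def)
        then show "mat_entry T (\<beta> x) z = 0 \<or> mat_entry T' z (\<beta> y) = 0"
          using z \<beta>_closed by (cases "mat_entry T (\<beta> x) z = 0") auto
      qed
      also have "\<dots> = (\<Sum>z\<in>blk x. mat_entry T (\<beta> x) (\<beta> z) * mat_entry T' (\<beta> z) (\<beta> y))"
        by (rule sum.reindex_bij_betw[OF \<beta>_block[OF x], symmetric])
      also have "\<dots> = (\<Sum>z\<in>blk x. mat_entry (spread T) x z * mat_entry (spread T') z y)"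
        using True x by (intro sum.cong) (auto simp: mat_entry_spread cl)
      finally show ?thesis
        unfolding 1 using True x cl by (simp add: mat_entry_spread complex_linear_comp)
    next
      case False
      then have "(\<Sum>z\<in>blk x. mat_entry (spread T) x z * mat_entry (spread T') z y) = 0"
        by (intro sum.neutral) (auto simp: mat_entry_spread cl)
      then show ?thesis
        unfolding 1 using False cl by (auto simp: mat_entry_spread complex_linear_comp)
    qed
  qed
qed

text \<open>All nonzero entries stay within a block, and blocks have diameter at most
  \<open>D\<close>: this bounds the propagation, however many copies there are.\<close>

lemma spread_in_roe: "complex_linear T \<Longrightarrow> spread T \<in> roe_ops"
proof (rule subsetD[OF closure_subset], intro CollectI conjI)
  assume T: "complex_linear T"
  then show "complex_linear (spread T)" by (rule complex_linear_spread)
  show "finite_propagation (spread T)"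
    unfolding finite_propagation_def
    by (rule exI[of _ D]) (use T in \<open>auto simp: mat_entry_spread block_dist split: if_splits\<close>)
qed

lemma positive_mat_spread:
  assumes "positive_mat (operator_alg model) n x"
  shows "positive_mat (operator_alg roe_ops) n (\<lambda>i j. spread (x i j))"
proof -
  interpret M: operator_subalgebra model
    by (rule operator_subalgebra_block_ops)
  obtain b where b: "\<And>i j. i < n \<Longrightarrow> j < n \<Longrightarrow> b i j \<in> model"
    "\<And>i j. i < n \<Longrightarrow> j < n \<Longrightarrow> x i j = (\<Sum>k<n. operator_adj (b k i) o\<^sub>L b k j)"
    using assms unfolding positive_mat_operator_alg by blast
  show ?thesis
    unfolding positive_mat_operator_alg
  proof (intro exI[of _ "\<lambda>i j. spread (b i j)"] conjI allI impI)
    fix i j assume ij: "i < n" "j < n"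
    show "spread (b i j) \<in> roe_ops"
      using ij b(1) by (intro spread_in_roe M.complex_linear) auto
    have "spread (x i j) = (\<Sum>k<n. spread (operator_adj (b k i) o\<^sub>L b k j))"
      unfolding b(2)[OF ij] using ij b(1) by (intro spread_sum M.complex_linear M.comp M.adj) auto
    also have "\<dots> = (\<Sum>k<n. operator_adj (spread (b k i)) o\<^sub>L spread (b k j))"
      using ij b(1) by (intro sum.cong refl)
        (simp add: spread_comp spread_adj M.adj M.complex_linear)
    finally show "spread (x i j) = (\<Sum>k<n. operator_adj (spread (b k i)) o\<^sub>L spread (b k j))" .
  qed
qed

subsection \<open>Compression to the model blocks\<close>

text \<open>Each summand cuts the weight \<open>\<kappa>\<close> down to one model block and
  conjugates \<open>a\<close> with it. In this form \<open>norm_sum_mult_op_conj\<close> applies: at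
  each point only the label of that point contributes a square, and it is at most 1.\<close>

definition compress :: "('x \<Rightarrow> real) \<Rightarrow> 'x operator \<Rightarrow> 'x operator" where
  "compress \<kappa> a = (\<Sum>c\<in>p ` \<beta> ` S.
     mult_op (\<lambda>x. if x \<in> \<beta> ` S \<and> p x = c then \<kappa> x else 0) o\<^sub>L a o\<^sub>L
     mult_op (\<lambda>x. if x \<in> \<beta> ` S \<and> p x = c then \<kappa> x else 0))"

context
  fixes \<kappa> :: "'x \<Rightarrow> real"
  assumes \<kappa>: "\<And>x. \<bar>\<kappa> x\<bar> \<le> 1"
begin

lemma cut_bound: "\<bar>if x \<in> \<beta> ` S \<and> p x = c then \<kappa> x else 0\<bar> \<le> 1"
  using \<kappa> by simp

lemma complex_linear_compress: "complex_linear a \<Longrightarrow> complex_linear (compress \<kappa> a)"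
  unfolding compress_def
  by (intro complex_linear_sum complex_linear_comp mult_op_complex_linear[of _ 1] cut_bound) auto

lemma mat_entry_compress:
  assumes "complex_linear a"
  shows "mat_entry (compress \<kappa> a) x y =
    (if x \<in> \<beta> ` S \<and> y \<in> \<beta> ` S \<and> p x = p y then of_real (\<kappa> x) * mat_entry a x y * of_real (\<kappa> y) else 0)"
proof -
  let ?c = "\<lambda>c x. if x \<in> \<beta> ` S \<and> p x = c then \<kappa> x else 0"
  have fin: "finite (p ` \<beta> ` S)"
    using finite_range by simp
  have "mat_entry (compress \<kappa> a) x y = (\<Sum>c\<in>p ` \<beta> ` S. of_real (?c c x) * mat_entry a x y * of_real (?c c y))"
    unfolding compress_def mat_entry_sum operator_comp_assoc
    using assms mult_op_complex_linear[of "?c _" 1, OF cut_bound]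
    by (simp only: mat_entry_mult_op_left[of "?c _" 1, OF cut_bound]
        mat_entry_mult_op_right[of "?c _" 1, OF cut_bound] mult.assoc)
  also have "\<dots> = (\<Sum>c\<in>p ` \<beta> ` S. if c = p x then (if x \<in> \<beta> ` S \<and> y \<in> \<beta> ` S \<and> p x = p y
      then of_real (\<kappa> x) * mat_entry a x y * of_real (\<kappa> y) else 0) else 0)"
    by (intro sum.cong refl) auto
  also have "\<dots> = (if x \<in> \<beta> ` S \<and> y \<in> \<beta> ` S \<and> p x = p y then of_real (\<kappa> x) * mat_entry a x y * of_real (\<kappa> y) else 0)"
    using fin by (auto simp: sum.delta')
  finally show ?thesis .
qed

lemma compress_in_model: "complex_linear a \<Longrightarrow> compress \<kappa> a \<in> model"
  by (auto simp: block_ops_def complex_linear_compress mat_entry_compress split: if_splits)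

lemma norm_compress: "norm (compress \<kappa> a) \<le> norm a"
proof -
  let ?c = "\<lambda>c x. if x \<in> \<beta> ` S \<and> p x = c then \<kappa> x else 0"
  have fin: "finite (p ` \<beta> ` S)"
    using finite_range by simp
  have "(\<Sum>c\<in>p ` \<beta> ` S. (?c c x)\<^sup>2) \<le> 1" for x
  proof -
    have "(\<Sum>c\<in>p ` \<beta> ` S. (?c c x)\<^sup>2) = (\<Sum>c\<in>p ` \<beta> ` S. if c = p x then (if x \<in> \<beta> ` S then (\<kappa> x)\<^sup>2 else 0) else 0)"
      by (intro sum.cong refl) auto
    also have "\<dots> \<le> 1"
      using fin \<kappa>[of x] by (simp add: abs_square_le_1)
    finally show ?thesis .
  qed
  then have "norm (compress \<kappa> a) \<le> norm a * 1"
    unfolding compress_def by (intro norm_sum_mult_op_conj fin cut_bound) auto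
  then show ?thesis by simp
qed

lemma compress_add: "complex_linear a \<Longrightarrow> complex_linear b \<Longrightarrow> compress \<kappa> (a + b) = compress \<kappa> a + compress \<kappa> b"
  by (rule operator_eqI) (auto simp: mat_entry_compress complex_linear_compress complex_linear_ops algebra_simps)

lemma compress_scale: "complex_linear a \<Longrightarrow> compress \<kappa> (scale_operator c a) = scale_operator c (compress \<kappa> a)"
  by (rule operator_eqI) (auto simp: mat_entry_compress complex_linear_compress complex_linear_ops algebra_simps)

text \<open>On each model block the compressed matrix is a Gram matrix; replacing the vectors by
  finite dimensional ones yields the factor required for positivity in the model.\<close>

lemma positive_mat_compress:
  assumes "positive_mat (operator_alg roe_ops) n x"
  shows "positive_mat (operator_alg model) n (\<lambda>i j. compress \<kappa> (x i j))"
proof -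
  interpret R: operator_subalgebra "roe_ops :: 'x operator set"
    by (rule operator_subalgebra_roe)
  obtain b where b: "\<And>i j. i < n \<Longrightarrow> j < n \<Longrightarrow> b i j \<in> roe_ops"
    "\<And>i j. i < n \<Longrightarrow> j < n \<Longrightarrow> x i j = (\<Sum>k<n. operator_adj (b k i) o\<^sub>L b k j)"
    using assms unfolding positive_mat_operator_alg by blast
  let ?Y = "\<beta> ` S"
  \<comment> \<open>Pairs of a matrix index and a point of the block with label \<open>c\<close>.
    The Gram factor is square over this same set, so it can be read again as an \<open>n\<close> by
    \<open>n\<close> matrix of operators on the block: the size \<open>n\<close> does not
    grow.\<close>
  define I where "I c = {..<n} \<times> {q\<in>?Y. p q = c}" for c
  have finI: "finite (I c)" for c
    using finite_range by (auto simp: I_def)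
  define v where "v iq k = ell2_scale (of_real (\<kappa> (snd iq))) (blinfun_apply (b k (fst iq)) (delta (snd iq)))" for iq k
  have "\<exists>w. \<forall>s\<in>I c. \<forall>s'\<in>I c. (\<Sum>k<n. cinner (v s k) (v s' k)) = (\<Sum>l\<in>I c. w s l * cnj (w s' l))" for c
    by (rule Gram_matrix_factorization[OF finI]) simp
  then obtain w where w: "\<And>c s s'. s \<in> I c \<Longrightarrow> s' \<in> I c \<Longrightarrow>
      (\<Sum>k<n. cinner (v s k) (v s' k)) = (\<Sum>l\<in>I c. w c s l * cnj (w c s' l))"
    by metis
  define m where "m k j z y = (if z \<in> ?Y \<and> y \<in> ?Y \<and> p z = p y then w (p y) (j, y) (k, z) else 0)"
    for k j :: nat and z y
  have "\<exists>T. complex_linear T \<and> (\<forall>z y. mat_entry T z y = m k j z y)" for k j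
    by (rule finite_matrix_operator[OF finite_range, of "m k j"]) (auto simp: m_def split: if_splits)
  then obtain B where B: "\<And>k j. complex_linear (B k j)" "\<And>k j z y. mat_entry (B k j) z y = m k j z y"
    by metis
  have BM: "B k j \<in> model" for k j
    using B by (auto simp: block_ops_def m_def split: if_splits)
  \<comment> \<open>The column data \<open>(j, z')\<close> come first because \<open>cinner\<close>
    is conjugate linear in its second argument.\<close>
  have G: "(\<Sum>k<n. cinner (v (j, z') k) (v (i, z) k)) = of_real (\<kappa> z) * mat_entry (x i j) z z' * of_real (\<kappa> z')"
    if ij: "i < n" "j < n" for i j z z'
  proof -
    have "cinner (v (j, z') k) (v (i, z) k) = of_real (\<kappa> z) * mat_entry (operator_adj (b k i) o\<^sub>L b k j) z z' * of_real (\<kappa> z')"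
      if k: "k < n" for k
    proof -
      have "complex_linear (b k i)"
        using b(1) k ij R.complex_linear by blast
      then show ?thesis
        by (simp add: v_def cinner_scale_left cinner_scale_right mat_entry_def cinner_adj_left
            del: cinner_delta_right)
    qed
    then show ?thesis
      unfolding b(2)[OF ij] mat_entry_sum by (simp add: sum_distrib_left sum_distrib_right)
  qed
  show ?thesis
    unfolding positive_mat_operator_alg
  proof (intro exI[of _ B] conjI allI impI BM)
    fix i j assume ij: "i < n" "j < n"
    show "compress \<kappa> (x i j) = (\<Sum>k<n. operator_adj (B k i) o\<^sub>L B k j)"
    proof (rule operator_eqI)
      have clx: "complex_linear (x i j)"
        unfolding b(2)[OF ij] using b(1) ij
        by (intro R.complex_linear R.sum R.comp R.adj) auto
      then show "complex_linear (compress \<kappa> (x i j))"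
        by (rule complex_linear_compress)
      show "complex_linear (\<Sum>k<n. operator_adj (B k i) o\<^sub>L B k j)"
        using B(1) by (intro complex_linear_sum) auto
      fix z z'
      have ent: "mat_entry (operator_adj (B k i) o\<^sub>L B k j) z z' = (\<Sum>u\<in>?Y. cnj (m k i u z) * m k j u z')" for k
        using finite_range B by (subst mat_entry_comp[of _ ?Y]) (auto simp: mat_entry_adj m_def)
      show "mat_entry (compress \<kappa> (x i j)) z z' = mat_entry (\<Sum>k<n. operator_adj (B k i) o\<^sub>L B k j) z z'"
      proof (cases "z \<in> ?Y \<and> z' \<in> ?Y \<and> p z = p z'")
        case True
        have "(\<Sum>u\<in>?Y. cnj (m k i u z) * m k j u z')
            = (\<Sum>u | u \<in> ?Y \<and> p u = p z. w (p z) (j, z') (k, u) * cnj (w (p z) (i, z) (k, u)))" for k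
          using finite_range True by (intro sum.mono_neutral_cong_right) (auto simp: m_def)
        then have "mat_entry (\<Sum>k<n. operator_adj (B k i) o\<^sub>L B k j) z z'
            = (\<Sum>l\<in>I (p z). w (p z) (j, z') l * cnj (w (p z) (i, z) l))"
          unfolding mat_entry_sum ent I_def by (simp add: sum.cartesian_product)
        also have "\<dots> = (\<Sum>k<n. cinner (v (j, z') k) (v (i, z) k))"
          using True ij by (intro w[symmetric]) (auto simp: I_def)
        finally show ?thesis
          using True clx by (simp add: G[OF ij] mat_entry_compress)
      next
        case False
        then have "(\<Sum>u\<in>?Y. cnj (m k i u z) * m k j u z') = 0" for k
          by (intro sum.neutral) (auto simp: m_def)
        then show ?thesis
          using False clx by (auto simp: mat_entry_sum ent mat_entry_compress)
      qed
    qed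
  qed
qed

end

end


section \<open>Norm estimates\<close>

context block_model
begin

text \<open>Meant for the small remainder, which has no controlled propagation and so cannot be
  treated entrywise. With the weights factored out, \<open>norm_sum_mult_op_conj\<close> bounds the
  sum of these terms over all indices jointly.\<close>

lemma spread_compress_weight:
  assumes \<kappa>: "\<And>x. \<bar>\<kappa> x\<bar> \<le> 1" and b: "complex_linear b"
  shows "spread (compress \<kappa> b) = mult_op (\<lambda>x. if x \<in> S then \<kappa> (\<beta> x) else 0) o\<^sub>L
    spread (compress (\<lambda>_. 1) b) o\<^sub>L mult_op (\<lambda>x. if x \<in> S then \<kappa> (\<beta> x) else 0)"
proof -
  let ?k = "\<lambda>x. if x \<in> S then \<kappa> (\<beta> x) else 0"
  have k: "\<bar>?k x\<bar> \<le> 1" for x using \<kappa> by simp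
  have one: "\<bar>1::real\<bar> \<le> 1" by simp
  have cl: "complex_linear (compress \<kappa> b)" "complex_linear (compress (\<lambda>_. 1) b)"
    using complex_linear_compress[OF \<kappa> b] complex_linear_compress[OF one b] by auto
  note cl' = cl[THEN complex_linear_spread]
  show ?thesis
  proof (rule operator_eqI)
    show "complex_linear (spread (compress \<kappa> b))" by (rule cl')
    show "complex_linear (mult_op ?k o\<^sub>L spread (compress (\<lambda>_. 1) b) o\<^sub>L mult_op ?k)"
      by (intro complex_linear_comp mult_op_complex_linear[of _ 1] k cl')
    fix x y
    have "mat_entry (mult_op ?k o\<^sub>L spread (compress (\<lambda>_. 1) b) o\<^sub>L mult_op ?k) x y
       = of_real (?k x) * mat_entry (spread (compress (\<lambda>_. 1) b)) x y * of_real (?k y)"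
      unfolding operator_comp_assoc mat_entry_mult_op_left[of ?k 1, OF k]
        mat_entry_mult_op_right[of ?k 1, OF k cl'(2)] by simp
    then show "mat_entry (spread (compress \<kappa> b)) x y
      = mat_entry (mult_op ?k o\<^sub>L spread (compress (\<lambda>_. 1) b) o\<^sub>L mult_op ?k) x y"
      by (auto simp: mat_entry_spread cl mat_entry_compress \<kappa> b \<beta>_label)
  qed
qed

text \<open>By \<open>sep\<close> the operator does not connect different blocks inside
  \<open>S\<close>, so keeping only the diagonal blocks loses nothing. What remains is an entrywise
  error \<open>e\<close> on blocks of at most \<open>N\<close> points, which the Schur test turns
  into \<open>N * e\<close>.\<close>

lemma norm_spread_compress_diff:
  assumes \<kappa>: "\<And>x. \<bar>\<kappa> x\<bar> \<le> 1" "\<And>x. x \<notin> S \<Longrightarrow> \<kappa> x = 0" and a: "complex_linear a"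
    and sep: "\<And>x y. mat_entry a x y \<noteq> 0 \<Longrightarrow> x \<in> S \<Longrightarrow> y \<in> S \<Longrightarrow> p x = p y"
    and close: "\<And>x y. x \<in> S \<Longrightarrow> y \<in> S \<Longrightarrow> p x = p y \<Longrightarrow>
      cmod (of_real (\<kappa> (\<beta> x)) * mat_entry a (\<beta> x) (\<beta> y) * of_real (\<kappa> (\<beta> y))
        - of_real (\<kappa> x) * mat_entry a x y * of_real (\<kappa> y)) \<le> e" and e: "e \<ge> 0"
  shows "norm (spread (compress \<kappa> a) - (mult_op \<kappa> o\<^sub>L a o\<^sub>L mult_op \<kappa>)) \<le> real N * e"
proof -
  have cl: "complex_linear (compress \<kappa> a)"
    by (rule complex_linear_compress[OF \<kappa>(1) a])
  have clm: "complex_linear (mult_op \<kappa> o\<^sub>L a o\<^sub>L mult_op \<kappa>)"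
    by (intro complex_linear_comp mult_op_complex_linear[of _ 1] \<kappa>(1) a)
  let ?d = "spread (compress \<kappa> a) - (mult_op \<kappa> o\<^sub>L a o\<^sub>L mult_op \<kappa>)"
  have d: "mat_entry ?d x y = (if x \<in> S \<and> y \<in> S \<and> p x = p y
      then of_real (\<kappa> (\<beta> x)) * mat_entry a (\<beta> x) (\<beta> y) * of_real (\<kappa> (\<beta> y))
        - of_real (\<kappa> x) * mat_entry a x y * of_real (\<kappa> y) else 0)" for x y
  proof -
    have 1: "mat_entry (mult_op \<kappa> o\<^sub>L a o\<^sub>L mult_op \<kappa>) x y = of_real (\<kappa> x) * mat_entry a x y * of_real (\<kappa> y)"
      unfolding operator_comp_assoc mat_entry_mult_op_left[of \<kappa> 1, OF \<kappa>(1)]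
        mat_entry_mult_op_right[of \<kappa> 1, OF \<kappa>(1) a] by simp
    have 2: "of_real (\<kappa> x) * mat_entry a x y * of_real (\<kappa> y) = 0" if "\<not> (x \<in> S \<and> y \<in> S \<and> p x = p y)"
      using that sep[of x y] \<kappa>(2)[of x] \<kappa>(2)[of y] by (cases "mat_entry a x y = 0") auto
    show ?thesis
      using 2 by (auto simp: 1 mat_entry_spread cl mat_entry_compress \<kappa>(1) a \<beta>_label)
  qed
  show ?thesis
  proof (rule Schur_test)
    show "complex_linear ?d"
      using cl clm by (auto intro: complex_linear_spread)
    show "mat_entry ?d x y \<noteq> 0 \<Longrightarrow> x \<in> S \<and> y \<in> S \<and> p y = p x" for x y
      unfolding d by (auto split: if_splits)
    show "finite {y. x \<in> S \<and> y \<in> S \<and> p y = p x} \<and> card {y. x \<in> S \<and> y \<in> S \<and> p y = p x} \<le> N" for x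
      using block_finite[of x] block_card[of x] by (cases "x \<in> S") auto
    show "cmod (mat_entry ?d x y) \<le> e" for x y
      unfolding d using close e by auto
  qed auto
qed

text \<open>For propagation at most \<open>R\<close> the compression is conjugation by a single
  function \<open>l\<close>. Moving \<open>l\<^sup>2\<close> past \<open>b\<close> in the product
  gives a compression of \<open>a b\<close> plus a commutator term, and a slowly varying
  \<open>l\<close> makes the commutator small.\<close>

lemma norm_compress_comp:
  assumes \<kappa>: "\<And>x. \<bar>\<kappa> x\<bar> \<le> 1" "\<And>x. x \<notin> S \<Longrightarrow> \<kappa> x = 0"
    and a: "complex_linear a" "\<And>x y. mat_entry a x y \<noteq> 0 \<Longrightarrow> dist x y \<le> R"
    and b: "complex_linear b" "\<And>x y. mat_entry b x y \<noteq> 0 \<Longrightarrow> dist x y \<le> R"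
    and sep: "\<And>x y. x \<in> S \<Longrightarrow> y \<in> S \<Longrightarrow> dist x y \<le> R \<Longrightarrow> p x = p y"
    and K: "\<And>x::'x. finite (cball x R) \<and> card (cball x R) \<le> K"
    and e: "\<And>x y. dist x y \<le> R \<Longrightarrow> \<bar>\<kappa> x - \<kappa> y\<bar> \<le> e" "e \<ge> 0"
  shows "norm (compress \<kappa> a o\<^sub>L compress \<kappa> b) \<le> norm (a o\<^sub>L b) + norm a * (real K * (2 * e * norm b))"
proof -
  define l where "l x = (if x \<in> \<beta> ` S then \<kappa> x else 0)" for x
  have l: "\<bar>l x\<bar> \<le> 1" for x using \<kappa> by (simp add: l_def)
  have l2: "\<bar>(l x)\<^sup>2\<bar> \<le> 1" for x using l[of x] by (simp add: abs_square_le_1)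
  \<comment> \<open>Cutting \<open>\<kappa>\<close> off outside the model creates no jump: a point
    of \<open>S\<close> within \<open>R\<close> of a model block belongs to that block, and points
    outside \<open>S\<close> have weight 0.\<close>
  have var: "\<bar>l x - l y\<bar> \<le> e" if "dist x y \<le> R" for x y
  proof -
    have half: "\<bar>l x - l y\<bar> \<le> e" if xy: "dist x y \<le> R" "x \<in> \<beta> ` S" for x y
    proof (cases "y \<in> \<beta> ` S")
      case True
      then show ?thesis using xy e(1) by (simp add: l_def)
    next
      case False
      have "y \<notin> S"
        using xy False sep[of x y] model_block[of x y] \<beta>_closed by force
      then have "\<kappa> y = 0" by (rule \<kappa>(2))
      then show ?thesis using e(1)[OF xy(1)] xy(2) False by (simp add: l_def)
    qed
    show ?thesis
    proof (cases "x \<in> \<beta> ` S")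
      case True
      then show ?thesis using half that by blast
    next
      case x: False
      show ?thesis
      proof (cases "y \<in> \<beta> ` S")
        case True
        then show ?thesis using half[of y x] that by (simp add: dist_commute abs_minus_commute)
      next
        case False
        then show ?thesis using x e(2) by (simp add: l_def)
      qed
    qed
  qed
  have compress_eq: "compress \<kappa> a = mult_op l o\<^sub>L (a o\<^sub>L mult_op l)"
    if a: "complex_linear a" "\<And>x y. mat_entry a x y \<noteq> 0 \<Longrightarrow> dist x y \<le> R" for a
  proof (rule operator_eqI)
    show "complex_linear (compress \<kappa> a)" by (rule complex_linear_compress[OF \<kappa>(1) a(1)])
    show "complex_linear (mult_op l o\<^sub>L (a o\<^sub>L mult_op l))"
      by (intro complex_linear_comp mult_op_complex_linear[of _ 1] l a)
    fix x y
    have "mat_entry (mult_op l o\<^sub>L (a o\<^sub>L mult_op l)) x y = of_real (l x) * mat_entry a x y * of_real (l y)"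
      unfolding mat_entry_mult_op_left[of l 1, OF l] mat_entry_mult_op_right[of l 1, OF l a(1)] by simp
    moreover have "p x = p y" if "mat_entry a x y \<noteq> 0" "x \<in> \<beta> ` S" "y \<in> \<beta> ` S"
      using sep a(2) that \<beta>_closed by blast
    ultimately show "mat_entry (compress \<kappa> a) x y = mat_entry (mult_op l o\<^sub>L (a o\<^sub>L mult_op l)) x y"
      by (auto simp: mat_entry_compress[OF \<kappa>(1) a(1)] l_def)
  qed
  define L where "L = mult_op l"
  define L2 where "L2 = mult_op (\<lambda>x. (l x)\<^sup>2)"
  have nL: "norm L \<le> 1" "norm L2 \<le> 1"
    unfolding L_def L2_def by (auto intro!: norm_mult_op l l2)
  have clL: "complex_linear L" "complex_linear L2"
    unfolding L_def L2_def by (auto intro!: mult_op_complex_linear[of _ 1] l l2)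
  have LL: "L o\<^sub>L L = L2"
    by (rule operator_eqI[OF complex_linear_comp[OF clL(1,1)] clL(2)])
      (unfold L_def L2_def mat_entry_mult_op_left[of l 1, OF l] mat_entry_mult_op[of l 1, OF l]
        mat_entry_mult_op[of "\<lambda>x. (l x)\<^sup>2" 1, OF l2], simp add: power2_eq_square)
  \<comment> \<open>The commutator has entries weighted by
    \<open>(l x)\<^sup>2 - (l y)\<^sup>2\<close>, which is at most \<open>2 * e\<close> on the
    support of \<open>b\<close>; the Schur test over \<open>R\<close>-balls supplies the factor
    \<open>K\<close>.\<close>
  define C where "C = (L2 o\<^sub>L b) - (b o\<^sub>L L2)"
  have entC: "mat_entry C x y = of_real ((l x)\<^sup>2 - (l y)\<^sup>2) * mat_entry b x y" for x y
    unfolding C_def L2_def mat_entry_diff mat_entry_mult_op_left[of "\<lambda>x. (l x)\<^sup>2" 1, OF l2]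
      mat_entry_mult_op_right[of "\<lambda>x. (l x)\<^sup>2" 1, OF l2 b(1)] by (simp add: algebra_simps)
  have "norm C \<le> real K * (2 * e * norm b)"
  proof (rule Schur_test)
    show "complex_linear C"
      unfolding C_def by (intro complex_linear_diff complex_linear_comp clL b)
    show "mat_entry C x y \<noteq> 0 \<Longrightarrow> dist x y \<le> R" for x y
      unfolding entC using b(2) by auto
    show "finite {y. dist x y \<le> R} \<and> card {y. dist x y \<le> R} \<le> K" for x :: 'x
      using K[of x] by (simp add: cball_def)
    fix x y
    show "cmod (mat_entry C x y) \<le> 2 * e * norm b"
    proof (cases "dist x y \<le> R")
      case True
      have "\<bar>(l x)\<^sup>2 - (l y)\<^sup>2\<bar> = \<bar>l x + l y\<bar> * \<bar>l x - l y\<bar>"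
        by (simp add: power2_eq_square square_diff_square_factored abs_mult)
      also have "\<dots> \<le> 2 * e"
        using l[of x] l[of y] var[OF True] by (intro mult_mono) auto
      finally show ?thesis
        unfolding entC norm_mult norm_of_real using e(2) by (intro mult_mono norm_mat_entry_le) auto
    next
      case False
      then have "mat_entry b x y = 0" using b(2) by blast
      then show ?thesis using e(2) by (simp add: entC)
    qed
  qed (simp add: dist_commute)
  moreover have "compress \<kappa> a o\<^sub>L compress \<kappa> b = (L o\<^sub>L ((a o\<^sub>L b) o\<^sub>L (L2 o\<^sub>L L))) + (L o\<^sub>L (a o\<^sub>L (C o\<^sub>L L)))"
  proof -
    have "compress \<kappa> a o\<^sub>L compress \<kappa> b = L o\<^sub>L (a o\<^sub>L (((L o\<^sub>L L) o\<^sub>L b) o\<^sub>L L))"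
    proof -
      have "compress \<kappa> a = mult_op l o\<^sub>L (a o\<^sub>L mult_op l)"
        by (rule compress_eq) (use a in auto)
      moreover have "compress \<kappa> b = mult_op l o\<^sub>L (b o\<^sub>L mult_op l)"
        by (rule compress_eq) (use b in auto)
      ultimately show ?thesis by (simp add: L_def operator_comp_assoc)
    qed
    also have "(L o\<^sub>L L) o\<^sub>L b = (b o\<^sub>L L2) + C"
      by (simp add: LL C_def)
    finally show ?thesis
      by (simp add: operator_comp_assoc bounded_bilinear.add_left[OF bounded_bilinear_blinfun_compose]
          bounded_bilinear.add_right[OF bounded_bilinear_blinfun_compose])
  qed
  moreover have "norm (L o\<^sub>L ((a o\<^sub>L b) o\<^sub>L (L2 o\<^sub>L L))) \<le> norm (a o\<^sub>L b)"
  proof -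
    have 1: "norm (L2 o\<^sub>L L) \<le> 1 * 1"
      by (rule order_trans[OF norm_blinfun_compose]) (intro mult_mono nL, auto)
    have 2: "norm ((a o\<^sub>L b) o\<^sub>L (L2 o\<^sub>L L)) \<le> norm (a o\<^sub>L b) * (1 * 1)"
      by (rule order_trans[OF norm_blinfun_compose]) (intro mult_left_mono 1, auto)
    have "norm (L o\<^sub>L ((a o\<^sub>L b) o\<^sub>L (L2 o\<^sub>L L))) \<le> 1 * (norm (a o\<^sub>L b) * (1 * 1))"
      by (rule order_trans[OF norm_blinfun_compose]) (intro mult_mono nL 2, auto)
    then show ?thesis by simp
  qed
  moreover have "norm (L o\<^sub>L (a o\<^sub>L (C o\<^sub>L L))) \<le> norm a * norm C"
  proof -
    have 1: "norm (C o\<^sub>L L) \<le> norm C * 1"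
      by (rule order_trans[OF norm_blinfun_compose]) (intro mult_left_mono nL, auto)
    have 2: "norm (a o\<^sub>L (C o\<^sub>L L)) \<le> norm a * (norm C * 1)"
      by (rule order_trans[OF norm_blinfun_compose]) (intro mult_left_mono 1, auto)
    have "norm (L o\<^sub>L (a o\<^sub>L (C o\<^sub>L L))) \<le> 1 * (norm a * (norm C * 1))"
      by (rule order_trans[OF norm_blinfun_compose]) (intro mult_mono nL 2, auto)
    then show ?thesis by simp
  qed
  ultimately show ?thesis
    using norm_triangle_ineq[of "L o\<^sub>L ((a o\<^sub>L b) o\<^sub>L (L2 o\<^sub>L L))" "L o\<^sub>L (a o\<^sub>L (C o\<^sub>L L))"]
      mult_left_mono[of "norm C" "real K * (2 * e * norm b)" "norm a"] by simp
qed

end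

text \<open>On entries the difference multiplies by the sum of \<open>k t x * k t y\<close> minus 1.
  Since the squares sum to 1 at both points, this is minus one half of the sum of
  \<open>(k t x - k t y)\<^sup>2\<close>, so the error is quadratic in the variation.\<close>

lemma norm_partition_average:
  fixes a :: "'x::metric_space operator"
  assumes \<sigma>: "finite \<sigma>" and k: "\<And>t x. t \<in> \<sigma> \<Longrightarrow> \<bar>k t x\<bar> \<le> 1" "\<And>x. (\<Sum>t\<in>\<sigma>. (k t x)\<^sup>2) = 1"
    and a: "complex_linear a" "\<And>x y. mat_entry a x y \<noteq> 0 \<Longrightarrow> dist x y \<le> R"
    and K: "\<And>x::'x. finite (cball x R) \<and> card (cball x R) \<le> K"
    and var: "\<And>t x y. t \<in> \<sigma> \<Longrightarrow> dist x y \<le> R \<Longrightarrow> \<bar>k t x - k t y\<bar> \<le> e t"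
    and \<delta>: "(\<Sum>t\<in>\<sigma>. (e t)\<^sup>2) \<le> 2 * \<delta>"
  shows "norm ((\<Sum>t\<in>\<sigma>. mult_op (k t) o\<^sub>L a o\<^sub>L mult_op (k t)) - a) \<le> real K * (\<delta> * norm a)"
proof -
  let ?d = "(\<Sum>t\<in>\<sigma>. mult_op (k t) o\<^sub>L a o\<^sub>L mult_op (k t)) - a"
  have \<delta>0: "\<delta> \<ge> 0"
    using \<delta> sum_nonneg[of \<sigma> "\<lambda>t. (e t)\<^sup>2"] by simp
  have d: "mat_entry ?d x y = of_real ((\<Sum>t\<in>\<sigma>. k t x * k t y) - 1) * mat_entry a x y" for x y
  proof -
    have "mat_entry (mult_op (k t) o\<^sub>L a o\<^sub>L mult_op (k t)) x y = of_real (k t x * k t y) * mat_entry a x y"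
      if t: "t \<in> \<sigma>" for t
      unfolding operator_comp_assoc mat_entry_mult_op_left[of "k t" 1, OF k(1)[OF t]]
        mat_entry_mult_op_right[of "k t" 1, OF k(1)[OF t] a(1)] by simp
    then show ?thesis
      by (simp add: mat_entry_sum left_diff_distrib sum_distrib_right)
  qed
  show ?thesis
  proof (rule Schur_test)
    show "complex_linear ?d"
      by (intro complex_linear_diff complex_linear_sum complex_linear_comp mult_op_complex_linear[of _ 1] k a)
    show "mat_entry ?d x y \<noteq> 0 \<Longrightarrow> dist x y \<le> R" for x y
      unfolding d using a(2) by auto
    show "finite {y. dist x y \<le> R} \<and> card {y. dist x y \<le> R} \<le> K" for x :: 'x
      using K[of x] by (simp add: cball_def)
    fix x y
    show "cmod (mat_entry ?d x y) \<le> \<delta> * norm a"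
    proof (cases "dist x y \<le> R")
      case True
      have "(\<Sum>t\<in>\<sigma>. (k t x - k t y)\<^sup>2) = (\<Sum>t\<in>\<sigma>. (k t x)\<^sup>2) + (\<Sum>t\<in>\<sigma>. (k t y)\<^sup>2) - 2 * (\<Sum>t\<in>\<sigma>. k t x * k t y)"
        by (simp add: power2_diff sum.distrib sum_subtractf sum_distrib_left mult.assoc)
      then have "2 * (1 - (\<Sum>t\<in>\<sigma>. k t x * k t y)) = (\<Sum>t\<in>\<sigma>. (k t x - k t y)\<^sup>2)"
        using k(2) by simp
      moreover have "(\<Sum>t\<in>\<sigma>. (k t x - k t y)\<^sup>2) \<le> (\<Sum>t\<in>\<sigma>. (e t)\<^sup>2)"
      proof (rule sum_mono)
        fix t assume t: "t \<in> \<sigma>"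
        have "\<bar>k t x - k t y\<bar>\<^sup>2 \<le> (e t)\<^sup>2"
          using var[OF t True] by (intro power_mono) auto
        then show "(k t x - k t y)\<^sup>2 \<le> (e t)\<^sup>2" by simp
      qed
      moreover have "0 \<le> (\<Sum>t\<in>\<sigma>. (k t x - k t y)\<^sup>2)"
        by (simp add: sum_nonneg)
      ultimately have "\<bar>(\<Sum>t\<in>\<sigma>. k t x * k t y) - 1\<bar> \<le> \<delta>"
        using \<delta> unfolding abs_le_iff by (simp add: algebra_simps)
      then show ?thesis
        unfolding d norm_mult norm_of_real using \<delta>0 by (intro mult_mono norm_mat_entry_le) auto
    next
      case False
      then have "mat_entry a x y = 0" using a(2) by blast
      then show ?thesis unfolding d using \<delta>0 by simp
    qed
  qed (simp add: dist_commute)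
qed

section \<open>Finitely many model blocks\<close>

text \<open>Blocks of bounded size carry, up to \<open>\<epsilon>\<close>, only finitely many configurations of the entries
  of the kernels in \<open>\<M>\<close>, so that \<open>\<beta>\<close> may identify blocks of equal configuration.\<close>

lemma block_model_exists:
  fixes S :: "'x::metric_space set" and p :: "'x \<Rightarrow> 'l" and \<M> :: "('x \<Rightarrow> 'x \<Rightarrow> complex) set"
  assumes fin: "\<And>x. x \<in> S \<Longrightarrow> finite {y\<in>S. p y = p x} \<and> card {y\<in>S. p y = p x} \<le> N"
    and dist: "\<And>x y. x \<in> S \<Longrightarrow> y \<in> S \<Longrightarrow> p x = p y \<Longrightarrow> dist x y \<le> D"
    and \<M>: "finite \<M>" "\<And>m x y. m \<in> \<M> \<Longrightarrow> cmod (m x y) \<le> B" and \<epsilon>: "\<epsilon> > 0"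
  obtains \<beta> where "block_model S p \<beta> D N"
    "\<And>m x y. m \<in> \<M> \<Longrightarrow> x \<in> S \<Longrightarrow> y \<in> S \<Longrightarrow> p x = p y \<Longrightarrow> cmod (m (\<beta> x) (\<beta> y) - m x y) \<le> \<epsilon>"
proof -
  define bl where "bl c = {y\<in>S. p y = c}" for c
  have bl: "finite (bl c) \<and> card (bl c) \<le> N" if "c \<in> p ` S" for c
    using fin that by (auto simp: bl_def)
  have "\<exists>e. bij_betw e {0..<card (bl c)} (bl c)" if "c \<in> p ` S" for c
    using bl[OF that] ex_bij_betw_nat_finite by blast
  then obtain e where e: "\<And>c. c \<in> p ` S \<Longrightarrow> bij_betw (e c) {0..<card (bl c)} (bl c)"
    by metis
  \<comment> \<open>Rounding to mesh \<open>\<epsilon> / 2\<close> in the real and in the imaginary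
    part, so that equal codes force a distance of at most \<open>\<epsilon>\<close>.\<close>
  define q where "q z = (\<lfloor>Re z / (\<epsilon> / 2)\<rfloor>, \<lfloor>Im z / (\<epsilon> / 2)\<rfloor>)" for z
  define Q where "Q = {- \<lceil>B / (\<epsilon> / 2)\<rceil> - 1..\<lceil>B / (\<epsilon> / 2)\<rceil> + 1}"
  have floorQ: "\<lfloor>r / (\<epsilon> / 2)\<rfloor> \<in> Q" if "\<bar>r\<bar> \<le> B" for r
  proof -
    have "r / (\<epsilon> / 2) \<le> B / (\<epsilon> / 2)" "- (B / (\<epsilon> / 2)) \<le> r / (\<epsilon> / 2)"
      using that \<epsilon> by (auto simp: field_simps abs_le_iff)
    then show ?thesis
      unfolding Q_def atLeastAtMost_iff by linarith
  qed
  have qQ: "q (m x y) \<in> Q \<times> Q" if "m \<in> \<M>" for m x y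
  proof -
    have "\<bar>Re (m x y)\<bar> \<le> B" "\<bar>Im (m x y)\<bar> \<le> B"
      using \<M>(2)[OF that, of x y] abs_Re_le_cmod[of "m x y"] abs_Im_le_cmod[of "m x y"] by linarith+
    then show ?thesis
      unfolding q_def using floorQ by blast
  qed
  have q_close: "cmod (z - w) \<le> \<epsilon>" if "q z = q w" for z w
  proof -
    have fl: "\<bar>r - s\<bar> \<le> \<epsilon> / 2" if "\<lfloor>r / (\<epsilon> / 2)\<rfloor> = \<lfloor>s / (\<epsilon> / 2)\<rfloor>" for r s
    proof -
      have "\<bar>r / (\<epsilon> / 2) - s / (\<epsilon> / 2)\<bar> \<le> 1"
        using that by linarith
      then have "\<bar>r - s\<bar> / (\<epsilon> / 2) \<le> 1"
        using \<epsilon> by (simp only: diff_divide_distrib[symmetric] abs_divide)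
      then show ?thesis
        using \<epsilon> by (subst (asm) pos_divide_le_eq) auto
    qed
    have "\<bar>Re z - Re w\<bar> \<le> \<epsilon> / 2" "\<bar>Im z - Im w\<bar> \<le> \<epsilon> / 2"
      using that fl unfolding q_def by blast+
    then show ?thesis
      using cmod_le[of "z - w"] by simp
  qed
  define J where "J = \<M> \<times> {..<N} \<times> {..<N}"
  \<comment> \<open>The size of the block and its rounded entries in the chosen enumeration.
    Positions beyond the block size read arbitrary points, but \<open>B\<close> bounds the kernels
    everywhere, so the codes still form a finite set.\<close>
  define code where "code c = (card (bl c), \<lambda>(m, i, j)\<in>J. q (m (e c i) (e c j)))" for c
  have "code ` p ` S \<subseteq> {..N} \<times> (J \<rightarrow>\<^sub>E Q \<times> Q)"
  proof (rule image_subsetI)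
    fix c assume c: "c \<in> p ` S"
    have "(case z of (m, i, j) \<Rightarrow> q (m (e c i) (e c j))) \<in> Q \<times> Q" if "z \<in> J" for z
    proof (cases z)
      case (fields m i j)
      then have "m \<in> \<M>" using that by (simp add: J_def)
      then show ?thesis unfolding fields prod.case by (rule qQ)
    qed
    then show "code c \<in> {..N} \<times> (J \<rightarrow>\<^sub>E Q \<times> Q)"
      unfolding code_def using bl[OF c] by (intro SigmaI) (simp_all only: restrict_PiE_iff atMost_iff, blast)
  qed
  moreover have "finite ({..N} \<times> (J \<rightarrow>\<^sub>E Q \<times> Q))"
    using \<M>(1) by (intro finite_cartesian_product finite_PiE) (auto simp: J_def Q_def)
  ultimately have finc: "finite (code ` p ` S)"
    by (rule finite_subset)
  define rep where "rep z = (SOME d. d \<in> p ` S \<and> code d = z)" for z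
  have rep: "rep (code c) \<in> p ` S \<and> code (rep (code c)) = code c" if "c \<in> p ` S" for c
    unfolding rep_def by (rule someI[of _ c]) (use that in simp)
  define r where "r c = rep (code c)" for c
  have r: "r c \<in> p ` S" "card (bl (r c)) = card (bl c)"
    "\<And>m i j. m \<in> \<M> \<Longrightarrow> i < N \<Longrightarrow> j < N \<Longrightarrow> q (m (e (r c) i) (e (r c) j)) = q (m (e c i) (e c j))"
    if c: "c \<in> p ` S" for c
  proof -
    show "r c \<in> p ` S" using rep[OF c] by (simp add: r_def)
    have cc: "code (r c) = code c" using rep[OF c] by (simp add: r_def)
    then show "card (bl (r c)) = card (bl c)" by (simp add: code_def)
    fix m i j assume "m \<in> \<M>" "i < N" "j < N"
    then have "(m, i, j) \<in> J" by (simp add: J_def)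
    moreover have "(\<lambda>(m, i, j)\<in>J. q (m (e (r c) i) (e (r c) j))) = (\<lambda>(m, i, j)\<in>J. q (m (e c i) (e c j)))"
      using cc by (simp add: code_def)
    ultimately show "q (m (e (r c) i) (e (r c) j)) = q (m (e c i) (e c j))"
      by (auto dest: fun_cong[of _ _ "(m, i, j)"])
  qed
  define idx where "idx x = inv_into {0..<card (bl (p x))} (e (p x)) x" for x
  have idx: "idx x < card (bl (p x))" "e (p x) (idx x) = x" if "x \<in> S" for x
  proof -
    have "x \<in> e (p x) ` {0..<card (bl (p x))}"
      using e[of "p x"] that by (auto simp: bij_betw_def bl_def)
    then show "idx x < card (bl (p x))" "e (p x) (idx x) = x"
      unfolding idx_def using inv_into_into[of x "e (p x)" "{0..<card (bl (p x))}"]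
        f_inv_into_f[of x "e (p x)" "{0..<card (bl (p x))}"] by simp_all
  qed
  \<comment> \<open>The point at a given position of a block goes to the point at the same position
    of the representative block; equal codes make the sizes match.\<close>
  define \<beta> where "\<beta> x = e (r (p x)) (idx x)" for x
  have \<beta>: "\<beta> x \<in> S \<and> p (\<beta> x) = r (p x)" if "x \<in> S" for x
  proof -
    have "\<beta> x \<in> bl (r (p x))"
      unfolding \<beta>_def using e[OF r(1)] r(2) idx(1)[OF that] that by (force simp: bij_betw_def)
    then show ?thesis by (simp add: bl_def)
  qed
  show ?thesis
  proof
    show "block_model S p \<beta> D N"
    proof
      show "finite (\<beta> ` S)"
      proof (rule finite_subset)
        show "\<beta> ` S \<subseteq> (\<Union>z\<in>code ` p ` S. bl (rep z))"
          using \<beta> by (auto simp: bl_def r_def)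
        show "finite (\<Union>z\<in>code ` p ` S. bl (rep z))"
          using finc rep bl by (intro finite_UN_I) auto
      qed
      fix x assume x: "x \<in> S"
      show "\<beta> x \<in> S" using \<beta>[OF x] by simp
      fix y assume y: "y \<in> S"
      show "p x = p y \<Longrightarrow> p (\<beta> x) = p (\<beta> y)" using \<beta> x y by simp
      show "x = y" if "p x = p y" "\<beta> x = \<beta> y"
      proof -
        have "inj_on (e (r (p x))) {0..<card (bl (p x))}"
          using e[OF r(1)] r(2) x by (auto simp: bij_betw_def)
        then have "idx x = idx y"
          using that idx(1)[OF x] idx(1)[OF y] unfolding \<beta>_def by (auto simp: inj_on_def)
        then show ?thesis using idx(2)[OF x] idx(2)[OF y] that by metis
      qed
    next
      fix x z assume x: "x \<in> S" and z: "z \<in> S" "p z = p (\<beta> x)"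
      then have "z \<in> bl (r (p x))" using \<beta>[OF x] by (simp add: bl_def)
      moreover have "e (r (p x)) ` {0..<card (bl (p x))} = bl (r (p x))"
        using bij_betw_imp_surj_on[OF e[OF r(1)]] r(2) x by (metis imageI)
      ultimately have "z \<in> e (r (p x)) ` {0..<card (bl (p x))}"
        by simp
      then obtain i where i: "i < card (bl (p x))" "z = e (r (p x)) i"
        by auto
      have ex: "bij_betw (e (p x)) {0..<card (bl (p x))} (bl (p x))"
        using e x by blast
      define y where "y = e (p x) i"
      have y: "y \<in> S" "p y = p x"
        using ex i(1) by (force simp: y_def bl_def bij_betw_def)+
      have "idx y = i"
        unfolding idx_def y(2) unfolding y_def using ex i(1) by (intro inv_into_f_f) (auto simp: bij_betw_def)
      then show "\<exists>y\<in>S. p y = p x \<and> \<beta> y = z"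
        using y i(2) by (intro bexI[of _ y]) (auto simp: \<beta>_def)
    qed (use fin dist in auto)
    fix m x y assume m: "m \<in> \<M>" and x: "x \<in> S" and y: "y \<in> S" and pxy: "p x = p y"
    have N: "idx x < N" "idx y < N"
      using idx(1)[OF x] idx(1)[OF y] bl x y by (meson imageI order_less_le_trans)+
    have "q (m (\<beta> x) (\<beta> y)) = q (m (e (p x) (idx x)) (e (p x) (idx y)))"
      unfolding \<beta>_def using r(3)[OF imageI[OF x, of p] m N] pxy by simp
    then have "q (m (\<beta> x) (\<beta> y)) = q (m x y)"
      using idx(2)[OF x] idx(2)[OF y] pxy by simp
    then show "cmod (m (\<beta> x) (\<beta> y) - m x y) \<le> \<epsilon>"
      by (rule q_close)
  qed
qed

section \<open>Partitions of unity from coverings\<close>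

lemma abs_sin_diff_le: "\<bar>sin x - sin y\<bar> \<le> \<bar>x - (y::real)\<bar>"
proof -
  have "\<bar>sin x - sin y\<bar> = 2 * \<bar>sin ((x - y) / 2)\<bar> * \<bar>cos ((x + y) / 2)\<bar>"
    by (simp add: sin_diff_sin abs_mult)
  also have "\<dots> \<le> 2 * \<bar>(x - y) / 2\<bar> * 1"
    by (intro mult_mono abs_sin_x_le_abs_x mult_nonneg_nonneg) auto
  finally show ?thesis by simp
qed

lemma abs_cos_diff_le: "\<bar>cos x - cos y\<bar> \<le> \<bar>x - (y::real)\<bar>"
  using abs_sin_diff_le[of "pi / 2 - x" "pi / 2 - y"] by (simp add: sin_diff abs_minus_commute)

lemma sum_half_powers_le:
  assumes "finite (\<sigma> :: nat set)" "\<And>s. s \<in> \<sigma> \<Longrightarrow> t \<le> s"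
  shows "(\<Sum>s\<in>\<sigma>. (1/2::real) ^ Suc s) \<le> (1/2) ^ t"
proof -
  obtain m where m: "\<sigma> \<subseteq> {t..<t + m}"
  proof -
    obtain n where "\<And>s. s \<in> \<sigma> \<Longrightarrow> s < n"
      using assms(1) unfolding finite_nat_set_iff_bounded by blast
    then have "\<sigma> \<subseteq> {t..<t + n}" using assms(2) by force
    then show ?thesis using that by blast
  qed
  have *: "(\<Sum>s=t..<t + m. (1/2::real) ^ Suc s) = (1/2) ^ t - (1/2) ^ (t + m)"
  proof (induction m)
    case (Suc m)
    have "(\<Sum>s=t..<t + Suc m. (1/2::real) ^ Suc s) = (1/2) ^ t - (1/2) ^ (t + m) + (1/2) ^ Suc (t + m)"
      using Suc.IH by (simp del: power_Suc)
    then show ?case by simp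
  qed simp
  have "(\<Sum>s\<in>\<sigma>. (1/2::real) ^ Suc s) \<le> (\<Sum>s=t..<t + m. (1/2) ^ Suc s)"
    using m by (intro sum_mono2) auto
  then show ?thesis
    unfolding * using zero_le_power[of "1/2::real" "t + m"] by linarith
qed

text \<open>Spherical coordinates of a unit vector, the missing coordinate being the product of all
  cosines. Adjoining a new least index leaves the old terms unchanged and takes its squared sine out
  of the missing square, which dictates induction from below.\<close>

lemma sum_sin_cos_partition:
  fixes f :: "nat \<Rightarrow> real"
  assumes "finite \<sigma>"
  shows "(\<Sum>t\<in>\<sigma>. (sin (f t) * (\<Prod>s\<in>{s\<in>\<sigma>. t < s}. cos (f s)))\<^sup>2) = 1 - (\<Prod>s\<in>\<sigma>. (cos (f s))\<^sup>2)"
  using assms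
proof (induction \<sigma> rule: finite_linorder_min_induct)
  case (insert b A)
  have "(\<Sum>t\<in>A. (sin (f t) * (\<Prod>s\<in>{s\<in>insert b A. t < s}. cos (f s)))\<^sup>2)
      = (\<Sum>t\<in>A. (sin (f t) * (\<Prod>s\<in>{s\<in>A. t < s}. cos (f s)))\<^sup>2)"
  proof (rule sum.cong)
    fix t assume "t \<in> A"
    then have "{s\<in>insert b A. t < s} = {s\<in>A. t < s}"
      using insert.hyps by auto
    then show "(sin (f t) * (\<Prod>s\<in>{s\<in>insert b A. t < s}. cos (f s)))\<^sup>2
        = (sin (f t) * (\<Prod>s\<in>{s\<in>A. t < s}. cos (f s)))\<^sup>2" by simp
  qed simp
  moreover have "{s\<in>insert b A. b < s} = A" "b \<notin> A"
    using insert.hyps by auto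
  ultimately show ?case
    using insert by (simp add: power_mult_distrib prod_power_distrib sin_squared_eq algebra_simps)
qed simp

lemma prod_diff_le_sum:
  fixes z w :: "'i \<Rightarrow> real"
  assumes "\<And>i. i \<in> I \<Longrightarrow> \<bar>z i\<bar> \<le> 1" "\<And>i. i \<in> I \<Longrightarrow> \<bar>w i\<bar> \<le> 1"
  shows "\<bar>(\<Prod>i\<in>I. z i) - (\<Prod>i\<in>I. w i)\<bar> \<le> (\<Sum>i\<in>I. \<bar>z i - w i\<bar>)"
  using norm_prod_diff[of I z w] assms by simp

text \<open>\<open>p t\<close> labels the blocks in the support of \<open>k t\<close> and
  \<open>D t\<close> bounds their diameters; only the variation must be uniform in its dependence on
  \<open>\<sigma>\<close>. The factor \<open>(1/2) ^ t\<close> makes all variations together at most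
  \<open>2 * \<delta>\<close>, whatever \<open>\<sigma>\<close> is.\<close>

definition controlled_partition ::
    "real \<Rightarrow> real \<Rightarrow> nat set \<Rightarrow> (nat \<Rightarrow> 'x::metric_space \<Rightarrow> real) \<Rightarrow> (nat \<Rightarrow> 'x \<Rightarrow> 'l) \<Rightarrow> (nat \<Rightarrow> real) \<Rightarrow> bool" where
  "controlled_partition R \<delta> \<sigma> k p D \<longleftrightarrow>
     (\<forall>t x. \<bar>k t x\<bar> \<le> 1) \<and> (\<forall>x. (\<Sum>t\<in>\<sigma>. (k t x)\<^sup>2) = 1) \<and>
     (\<forall>t\<in>\<sigma>. (\<forall>x y. dist x y \<le> R \<longrightarrow> \<bar>k t x - k t y\<bar> \<le> \<delta> * (1/2) ^ t) \<and>
       (\<forall>x y. k t x \<noteq> 0 \<longrightarrow> k t y \<noteq> 0 \<longrightarrow> dist x y \<le> R \<longrightarrow> p t x = p t y) \<and>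
       (\<forall>x y. k t x \<noteq> 0 \<longrightarrow> k t y \<noteq> 0 \<longrightarrow> p t x = p t y \<longrightarrow> dist x y \<le> D t))"

text \<open>The order of the factors matters: the weight with index \<open>t\<close> only involves coverings with
  index \<open>\<ge> t\<close>, hence its variation is controlled by a quantity depending on \<open>t\<close> alone.\<close>

lemma partition_from_cover:
  assumes R: "R \<ge> 0" and \<delta>: "\<delta> > 0"
  shows "\<exists>g :: nat \<Rightarrow> nat. inj g \<and> (\<forall>\<sigma> (\<U> :: nat \<Rightarrow> 'x::metric_space set set). finite \<sigma> \<longrightarrow>
      (\<forall>t\<in>\<sigma>. uniformly_bounded (\<U> (g t)) \<and> r_disjoint (real (g t)) (\<U> (g t))) \<longrightarrow>
      (\<Union>t\<in>\<sigma>. \<Union>(\<U> (g t))) = UNIV \<longrightarrow>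
      (\<exists>k (p :: nat \<Rightarrow> 'x \<Rightarrow> 'x set) D. controlled_partition R \<delta> \<sigma> k p D))"
proof -
  \<comment> \<open>The width of the slope on which the angle drops from \<open>pi / 2\<close> to 0:
    over a distance \<open>R\<close> the angle then changes by at most
    \<open>\<delta> * (1/2) ^ Suc t\<close>. The summand 1 excludes width 0.\<close>
  define r where "r t = 1 + pi * R * 2 ^ t / \<delta>" for t :: nat
  have r1: "r t \<ge> 1" for t
    using R \<delta> by (simp add: r_def)
  have rvar: "(pi / 2) / r t * R \<le> \<delta> * (1/2) ^ Suc t" for t
  proof -
    have "pi * R * 2 ^ t / \<delta> \<le> r t" by (simp add: r_def)
    then have "pi * R * 2 ^ t \<le> r t * \<delta>"
      using \<delta> by (simp add: field_simps)
    then have "pi * R \<le> r t * \<delta> * (1/2) ^ t"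
      by (simp add: power_one_over field_simps)
    then show ?thesis
      using r1[of t] by (simp add: field_simps)
  qed
  have rmono: "mono r"
    unfolding r_def using R \<delta> by (intro monoI add_left_mono divide_right_mono mult_left_mono power_increasing) auto
  \<comment> \<open>Supports reach out by less than \<open>r t\<close> from the sets of the
    covering, so a gap of \<open>2 * r t + R\<close> keeps points with different labels more than
    \<open>R\<close> apart. The summand \<open>t\<close> makes \<open>g\<close> strictly
    increasing.\<close>
  define g where "g t = nat \<lceil>2 * r t + R\<rceil> + t" for t
  have "strict_mono g"
  proof (rule strict_monoI)
    fix s t :: nat assume "s < t"
    then have "r s \<le> r t" using rmono by (simp add: monoD)
    then have "nat \<lceil>2 * r s + R\<rceil> \<le> nat \<lceil>2 * r t + R\<rceil>"
      by (intro nat_mono ceiling_mono) simp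
    then show "g s < g t" using \<open>s < t\<close> unfolding g_def by linarith
  qed
  then have "inj g" by (rule strict_mono_imp_inj_on)
  have gr: "2 * r t + R \<le> real (g t)" for t
    unfolding g_def using real_nat_ceiling_ge[of "2 * r t + R"] by simp
  show ?thesis
  proof (rule exI[of _ g], intro conjI \<open>inj g\<close> allI impI)
    fix \<sigma> and \<U> :: "nat \<Rightarrow> 'x set set"
    assume \<sigma>: "finite \<sigma>" and \<U>: "\<forall>t\<in>\<sigma>. uniformly_bounded (\<U> (g t)) \<and> r_disjoint (real (g t)) (\<U> (g t))"
      and cov: "(\<Union>t\<in>\<sigma>. \<Union>(\<U> (g t))) = UNIV"
    define W where "W t = \<Union>(\<U> (g t))" for t
    \<comment> \<open>The case \<open>W t = {}\<close> is separate because \<open>infdist\<close> to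
      the empty set is 0 and would produce the angle \<open>pi / 2\<close> everywhere.\<close>
    define f where "f t x = (if W t = {} then 0 else (pi / 2) * max 0 (1 - infdist x (W t) / r t))" for t x
    have f_W: "f t x = pi / 2" if "x \<in> W t" for t x
      using that by (auto simp: f_def)
    have f_lip: "\<bar>f t x - f t y\<bar> \<le> \<delta> * (1/2) ^ Suc t" if "dist x y \<le> R" for t x y
    proof (cases "W t = {}")
      case False
      have "\<bar>infdist x (W t) - infdist y (W t)\<bar> / r t \<le> R / r t"
        using infdist_triangle_abs[of x "W t" y] that r1[of t] by (intro divide_right_mono) auto
      then have "\<bar>infdist x (W t) / r t - infdist y (W t) / r t\<bar> \<le> R / r t"
        using r1[of t] by (simp flip: diff_divide_distrib add: abs_divide)
      then have "\<bar>max 0 (1 - infdist x (W t) / r t) - max 0 (1 - infdist y (W t) / r t)\<bar> \<le> R / r t"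
        by linarith
      then have "(pi / 2) * \<bar>max 0 (1 - infdist x (W t) / r t) - max 0 (1 - infdist y (W t) / r t)\<bar> \<le> (pi / 2) * (R / r t)"
        by (intro mult_left_mono) auto
      moreover have "\<bar>f t x - f t y\<bar> = (pi / 2) * \<bar>max 0 (1 - infdist x (W t) / r t) - max 0 (1 - infdist y (W t) / r t)\<bar>"
      proof -
        have "f t x - f t y = (pi / 2) * (max 0 (1 - infdist x (W t) / r t) - max 0 (1 - infdist y (W t) / r t))"
          using False by (simp add: f_def right_diff_distrib)
        then show ?thesis
          by (simp only: abs_mult) simp
      qed
      ultimately show ?thesis
        using rvar[of t] by simp
    qed (use \<delta> in \<open>simp add: f_def\<close>)
    define k where "k t x = sin (f t x) * (\<Prod>s\<in>{s\<in>\<sigma>. t < s}. cos (f s x))" for t x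
    have k1: "\<bar>k t x\<bar> \<le> 1" for t x
    proof -
      have "\<bar>\<Prod>s\<in>{s\<in>\<sigma>. t < s}. cos (f s x)\<bar> \<le> 1"
        unfolding abs_prod by (intro prod_le_1) auto
      then show ?thesis
        unfolding k_def abs_mult by (intro mult_le_one) auto
    qed
    have ksum: "(\<Sum>t\<in>\<sigma>. (k t x)\<^sup>2) = 1" for x
    proof -
      have "x \<in> (\<Union>t\<in>\<sigma>. W t)"
        using cov by (simp add: W_def)
      then obtain t where "t \<in> \<sigma>" "x \<in> W t"
        by blast
      then have "(\<Prod>s\<in>\<sigma>. (cos (f s x))\<^sup>2) = 0"
        using \<sigma> by (intro prod_zero bexI[of _ t]) (auto simp: f_W)
      then show ?thesis
        unfolding k_def using sum_sin_cos_partition[OF \<sigma>, of "\<lambda>t. f t x"] by simp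
    qed
    have kvar: "\<bar>k t x - k t y\<bar> \<le> \<delta> * (1/2) ^ t" if t: "t \<in> \<sigma>" and xy: "dist x y \<le> R" for t x y
    proof -
      define z where "z x s = (if s = t then sin (f s x) else cos (f s x))" for x s
      have kz: "k t x = (\<Prod>s\<in>insert t {s\<in>\<sigma>. t < s}. z x s)" for x
      proof -
        have "(\<Prod>s\<in>{s\<in>\<sigma>. t < s}. z x s) = (\<Prod>s\<in>{s\<in>\<sigma>. t < s}. cos (f s x))"
          by (rule prod.cong) (auto simp: z_def)
        then show ?thesis using \<sigma> by (simp add: k_def z_def)
      qed
      have "\<bar>k t x - k t y\<bar> \<le> (\<Sum>s\<in>insert t {s\<in>\<sigma>. t < s}. \<bar>z x s - z y s\<bar>)"
        unfolding kz by (rule prod_diff_le_sum) (auto simp: z_def)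
      also have "\<dots> \<le> (\<Sum>s\<in>insert t {s\<in>\<sigma>. t < s}. \<delta> * (1/2) ^ Suc s)"
      proof (rule sum_mono)
        fix s
        have "\<bar>z x s - z y s\<bar> \<le> \<bar>f s x - f s y\<bar>"
          by (simp add: z_def abs_sin_diff_le abs_cos_diff_le)
        then show "\<bar>z x s - z y s\<bar> \<le> \<delta> * (1/2) ^ Suc s"
          using f_lip[OF xy, of s] by linarith
      qed
      also have "\<dots> \<le> \<delta> * (1/2) ^ t"
        unfolding sum_distrib_left[symmetric] using \<sigma> \<delta>
        by (intro mult_left_mono sum_half_powers_le) auto
      finally show ?thesis .
    qed
    \<comment> \<open>The label of a point is a set of the covering that comes within
      \<open>r t\<close> of it; such a set exists wherever \<open>k t\<close> does not
      vanish.\<close>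
    define p where "p t x = (SOME U. U \<in> \<U> (g t) \<and> (\<exists>w\<in>U. dist x w < r t))" for t x
    have p: "p t x \<in> \<U> (g t) \<and> (\<exists>w\<in>p t x. dist x w < r t)" if "k t x \<noteq> 0" for t x
    proof -
      have "f t x \<noteq> 0" using that by (auto simp: k_def)
      then have W: "W t \<noteq> {}" and "infdist x (W t) / r t < 1"
        by (auto simp: f_def max_def split: if_splits)
      then have "infdist x (W t) < r t"
        using r1[of t] by (simp add: divide_less_eq)
      then obtain w where "w \<in> W t" "dist x w < r t"
        unfolding infdist_notempty[OF W] using W by (subst (asm) cINF_less_iff) auto
      then have "\<exists>U. U \<in> \<U> (g t) \<and> (\<exists>w\<in>U. dist x w < r t)"
        by (auto simp: W_def)
      from someI_ex[OF this] show ?thesis by (simp add: p_def)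
    qed
    have psep: "p t x = p t y" if t: "t \<in> \<sigma>" and k: "k t x \<noteq> 0" "k t y \<noteq> 0" and xy: "dist x y \<le> R" for t x y
    proof (rule ccontr)
      assume ne: "p t x \<noteq> p t y"
      obtain w where w: "w \<in> p t x" "dist x w < r t" using p[OF k(1)] by blast
      obtain v where v: "v \<in> p t y" "dist y v < r t" using p[OF k(2)] by blast
      have "real (g t) \<le> dist w v"
        using \<U> t ne w v p[OF k(1)] p[OF k(2)] unfolding r_disjoint_def by blast
      moreover have "dist w v \<le> dist x w + dist x y + dist y v"
        by (metis add.commute add.left_commute add_left_mono dist_commute dist_triangle dist_triangle_le)
      ultimately show False
        using gr[of t] w v xy by linarith
    qed
    have "\<forall>t\<in>\<sigma>. \<exists>B. \<forall>U\<in>\<U> (g t). \<forall>x\<in>U. \<forall>y\<in>U. dist x y \<le> B"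
      using \<U> by (auto simp: uniformly_bounded_def)
    then obtain B where B: "\<And>t U x y. t \<in> \<sigma> \<Longrightarrow> U \<in> \<U> (g t) \<Longrightarrow> x \<in> U \<Longrightarrow> y \<in> U \<Longrightarrow> dist x y \<le> B t"
      by metis
    have pdist: "dist x y \<le> B t + 2 * r t" if t: "t \<in> \<sigma>" and k: "k t x \<noteq> 0" "k t y \<noteq> 0" and xy: "p t x = p t y" for t x y
    proof -
      obtain w where w: "w \<in> p t x" "dist x w < r t" using p[OF k(1)] by blast
      obtain v where v: "v \<in> p t x" "dist y v < r t" using p[OF k(2)] xy by auto
      have "dist w v \<le> B t"
        using B[OF t] w v p[OF k(1)] by blast
      moreover have "dist x y \<le> dist x w + dist w v + dist y v"
        by (metis add.assoc add_left_mono dist_commute dist_triangle dist_triangle_le)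
      ultimately show ?thesis using w v by linarith
    qed
    show "\<exists>k (p :: nat \<Rightarrow> 'x \<Rightarrow> 'x set) D. controlled_partition R \<delta> \<sigma> k p D"
      unfolding controlled_partition_def
      by (intro exI[of _ k] exI[of _ p] exI[of _ "\<lambda>t. B t + 2 * r t"])
        (use k1 ksum kvar psep pdist in blast)
  qed
qed


section \<open>Monotonicity of Ord\<close>

text \<open>\<open>g\<close> maps the link of \<open>M\<close> at \<open>a\<close> into the link of
  \<open>M'\<close> at \<open>g a\<close>; injectivity keeps \<open>g a\<close> out of the image of
  \<open>\<tau>\<close>. Both sets change in the induction, so both are generalised.\<close>

lemma Ord_le_image:
  fixes \<alpha> :: "'o::wellorder"
  assumes "inj g" "\<And>\<sigma>. \<sigma> \<in> M \<Longrightarrow> g ` \<sigma> \<in> M'" "Ord_le M' \<alpha>"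
  shows "Ord_le M \<alpha>"
  using assms(2,3)
proof (induction \<alpha> arbitrary: M M' rule: less_induct)
  case (less \<alpha>)
  show ?case
  proof (cases "\<exists>\<beta>. \<beta> < \<alpha>")
    case False
    then have "M' = {}"
      using less.prems(2) Ord_le.simps[of M' \<alpha>] by simp
    then have "M = {}" using less.prems(1) by blast
    then show ?thesis using False Ord_le.simps[of M \<alpha>] by simp
  next
    case True
    have "\<exists>\<beta><\<alpha>. Ord_le (Ord_link M a) \<beta>" for a
    proof -
      obtain \<beta> where \<beta>: "\<beta> < \<alpha>" "Ord_le (Ord_link M' (g a)) \<beta>"
        using less.prems(2) True Ord_le.simps[of M' \<alpha>] by auto
      have "g ` \<tau> \<in> Ord_link M' (g a)" if \<tau>: "\<tau> \<in> Ord_link M a" for \<tau>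
      proof -
        have "g ` insert a \<tau> \<in> M'"
          using \<tau> less.prems(1) by (simp only: Ord_link_def mem_Collect_eq)
        then show ?thesis
          using \<tau> \<open>inj g\<close> by (auto simp: Ord_link_def Fin_def inj_image_mem_iff)
      qed
      then show ?thesis
        using less.IH[OF \<beta>(1) _ \<beta>(2)] \<beta>(1) by blast
    qed
    then show ?thesis using True Ord_le.simps[of M \<alpha>] by simp
  qed
qed

section \<open>The approximating maps\<close>

context block_model
begin

context
  fixes h :: "'x operator \<Rightarrow> 'b" and k :: "'b \<Rightarrow> 'x operator"
  assumes hk: "\<And>T. T \<in> model \<Longrightarrow> k (h T) = T"
begin

interpretation M: operator_subalgebra model
  by (rule operator_subalgebra_block_ops)

abbreviation coords :: "'b star_alg" where "coords \<equiv> transport h k (operator_alg model)"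

lemma linear_map_spread: "linear_map coords (operator_alg roe_ops) (\<lambda>y. spread (k y))"
  unfolding linear_map_def
  by (auto simp: hk M.add M.scale M.complex_linear spread_add spread_scale intro: spread_in_roe)

lemma positive_mat_spread_coords:
  "positive_mat coords n x \<Longrightarrow> positive_mat (operator_alg roe_ops) n (\<lambda>i j. spread (k (x i j)))"
  by (rule positive_mat_spread, rule positive_mat_transportD[OF M.cstar_algebra]) (auto simp: hk)

lemma completely_positive_spread: "completely_positive coords (operator_alg roe_ops) (\<lambda>y. spread (k y))"
  unfolding completely_positive_def using linear_map_spread positive_mat_spread_coords by blast

lemma contractive_spread: "contractive coords (operator_alg roe_ops) (\<lambda>y. spread (k y))"
  unfolding contractive_def by (auto simp: hk M.complex_linear intro: norm_spread)

text \<open>Multiplicativity of \<open>spread\<close> on the model carries vanishing products over.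
  Each summand map is even a homomorphism; only their sum over the indices fails to be one in
  general.\<close>

lemma order_zero_spread: "order_zero coords (operator_alg roe_ops) (\<lambda>y. spread (k y))"
  unfolding order_zero_def
proof (intro conjI completely_positive_spread allI impI; elim conjE)
  fix a b assume pos: "positive coords a" "positive coords b"
    and ab: "a \<otimes>\<^bsub>coords\<^esub> b = \<zero>\<^bsub>coords\<^esub>" "b \<otimes>\<^bsub>coords\<^esub> a = \<zero>\<^bsub>coords\<^esub>"
  have "k c \<in> model" if "positive coords c" for c
    using that by (auto simp: positive_def hk M.comp M.adj)
  then have *: "k a \<in> model" "k b \<in> model"
    using pos by auto
  have "k a o\<^sub>L k b = 0" "k b o\<^sub>L k a = 0"
    using arg_cong[OF ab(1), of k] arg_cong[OF ab(2), of k] * by (auto simp: hk M.comp M.zero)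
  then show "spread (k a) \<otimes>\<^bsub>operator_alg roe_ops\<^esub> spread (k b) = \<zero>\<^bsub>operator_alg roe_ops\<^esub>"
    "spread (k b) \<otimes>\<^bsub>operator_alg roe_ops\<^esub> spread (k a) = \<zero>\<^bsub>operator_alg roe_ops\<^esub>"
    using spread_comp[OF *] spread_comp[OF *(2,1)] by (auto simp: spread_zero)
qed

end

end

section \<open>Choosing models and approximants under bounded geometry\<close>

lemma bounded_geometryD:
  assumes "bounded_geometry TYPE('x::metric_space)"
  obtains N where "\<And>x::'x. finite (cball x r) \<and> card (cball x r) \<le> N"
proof -
  \<comment> \<open>Bounded geometry speaks of positive radii only, whereas \<open>r\<close> is an
    arbitrary real.\<close>
  have "max r 1 > 0" by simp
  then obtain N where N: "\<And>x::'x. finite (cball x (max r 1)) \<and> card (cball x (max r 1)) \<le> N"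
    using assms unfolding bounded_geometry_def by blast
  have "finite (cball x r) \<and> card (cball x r) \<le> N" for x :: 'x
  proof -
    have "cball x r \<subseteq> cball x (max r 1)" by (simp add: subset_cball)
    then show ?thesis
      using N[of x] card_mono finite_subset le_trans by meson
  qed
  then show ?thesis using that by blast
qed

text \<open>Three uses of \<open>e\<close> are provided for: closeness of weights, closeness of
  weighted entries, and the product \<open>real N * e\<close>, which is what the Schur test makes of
  an entrywise error on blocks of at most \<open>N\<close> points.\<close>

lemma weighted_block_model_exists:
  fixes \<kappa> :: "'x::metric_space \<Rightarrow> real" and p :: "'x \<Rightarrow> 'l" and \<F> :: "'x operator set"
  assumes bg: "bounded_geometry TYPE('x)" and "finite \<F>" and \<kappa>: "\<And>x. \<bar>\<kappa> x\<bar> \<le> 1"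
    and dist: "\<And>x y. \<kappa> x \<noteq> 0 \<Longrightarrow> \<kappa> y \<noteq> 0 \<Longrightarrow> p x = p y \<Longrightarrow> dist x y \<le> D" and \<epsilon>: "\<epsilon> > 0"
  shows "\<exists>\<beta> N e. block_model {x. \<kappa> x \<noteq> 0} p \<beta> D N \<and> 0 \<le> e \<and> e \<le> \<epsilon> \<and> real N * e \<le> \<epsilon> \<and>
    (\<forall>x. \<kappa> x \<noteq> 0 \<longrightarrow> \<bar>\<kappa> (\<beta> x) - \<kappa> x\<bar> \<le> e) \<and>
    (\<forall>a\<in>\<F>. \<forall>x y. \<kappa> x \<noteq> 0 \<longrightarrow> \<kappa> y \<noteq> 0 \<longrightarrow> p x = p y \<longrightarrow>
      cmod (of_real (\<kappa> (\<beta> x)) * mat_entry a (\<beta> x) (\<beta> y) * of_real (\<kappa> (\<beta> y))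
        - of_real (\<kappa> x) * mat_entry a x y * of_real (\<kappa> y)) \<le> e)"
proof -
  let ?S = "{x. \<kappa> x \<noteq> 0}"
  obtain N where N: "\<And>x::'x. finite (cball x D) \<and> card (cball x D) \<le> N"
    using bounded_geometryD[OF bg] by blast
  have blk: "finite {y\<in>?S. p y = p x} \<and> card {y\<in>?S. p y = p x} \<le> N" if "x \<in> ?S" for x
  proof -
    have "{y\<in>?S. p y = p x} \<subseteq> cball x D"
      using dist that by auto
    then show ?thesis
      using N[of x] card_mono finite_subset le_trans by meson
  qed
  \<comment> \<open>The block size \<open>N\<close> depends on \<open>D\<close> alone and is fixed
    before the precision, so \<open>e\<close> can absorb it.\<close>
  define e where "e = \<epsilon> / (real N + 1)"
  have e: "e > 0" "e \<le> \<epsilon>" "real N * e \<le> \<epsilon>"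
    using \<epsilon> by (auto simp: e_def field_simps)
  define m where "m a x y = of_real (\<kappa> x) * mat_entry a x y * of_real (\<kappa> y)" for a x y
  \<comment> \<open>The weight joins as a kernel that ignores its second argument, so that
    \<open>\<beta>\<close> almost preserves the weight as well.\<close>
  define \<M> where "\<M> = insert (\<lambda>x y. of_real (\<kappa> x)) (m ` \<F>)"
  define B where "B = 1 + (\<Sum>a\<in>\<F>. norm a)"
  have "cmod (f x y) \<le> B" if f: "f \<in> \<M>" for f x y
  proof -
    consider "f = (\<lambda>x y. of_real (\<kappa> x))" | a where "a \<in> \<F>" "f = m a"
      using f by (auto simp: \<M>_def)
    then show ?thesis
    proof cases
      case 1
      then show ?thesis
        using \<kappa>[of x] sum_nonneg[of \<F> norm] by (simp add: B_def)
    next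
      case 2
      have "cmod (m a x y) \<le> 1 * norm a * 1"
        unfolding m_def norm_mult norm_of_real
        by (intro mult_mono \<kappa> norm_mat_entry_le mult_nonneg_nonneg) auto
      also have "\<dots> \<le> B"
        using member_le_sum[OF 2(1), of norm] \<open>finite \<F>\<close> by (simp add: B_def)
      finally show ?thesis using 2 by simp
    qed
  qed
  note mB = this
  have fM: "finite \<M>" using \<open>finite \<F>\<close> by (simp add: \<M>_def)
  have "\<exists>\<beta>. block_model ?S p \<beta> D N \<and> (\<forall>f\<in>\<M>. \<forall>x\<in>?S. \<forall>y\<in>?S. p x = p y \<longrightarrow>
    cmod (f (\<beta> x) (\<beta> y) - f x y) \<le> e)"
  proof (rule block_model_exists[of ?S p N D \<M> B e])
    show "finite {y\<in>?S. p y = p x} \<and> card {y\<in>?S. p y = p x} \<le> N" if "x \<in> ?S" for x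
      by (rule blk[OF that])
    show "cmod (f x y) \<le> B" if "f \<in> \<M>" for f x y
      by (rule mB[OF that])
    show "dist x y \<le> D" if "x \<in> ?S" "y \<in> ?S" "p x = p y" for x y
      using dist that by auto
  qed (use fM e(1) in blast)+
  then obtain \<beta> where \<beta>: "block_model ?S p \<beta> D N"
    "\<And>f x y. f \<in> \<M> \<Longrightarrow> x \<in> ?S \<Longrightarrow> y \<in> ?S \<Longrightarrow> p x = p y \<Longrightarrow> cmod (f (\<beta> x) (\<beta> y) - f x y) \<le> e"
    by blast
  have "\<bar>\<kappa> (\<beta> x) - \<kappa> x\<bar> \<le> e" if "\<kappa> x \<noteq> 0" for x
    using \<beta>(2)[of "\<lambda>x y. of_real (\<kappa> x)" x x] that by (simp add: \<M>_def flip: of_real_diff)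
  moreover have "cmod (m a (\<beta> x) (\<beta> y) - m a x y) \<le> e"
    if "a \<in> \<F>" "\<kappa> x \<noteq> 0" "\<kappa> y \<noteq> 0" "p x = p y" for a x y
    using \<beta>(2)[of "m a" x y] that by (simp add: \<M>_def)
  ultimately show ?thesis
    using \<beta>(1) e unfolding m_def by (intro exI[of _ \<beta>] exI[of _ N] exI[of _ e]) auto
qed

lemma finite_propagation_approx:
  fixes \<F> :: "'x::metric_space operator set"
  assumes "finite \<F>" "\<F> \<subseteq> roe_ops" "\<eta> > 0"
  shows "\<exists>ap R. R \<ge> 0 \<and> (\<forall>a\<in>\<F>. complex_linear (ap a) \<and> ap a \<in> roe_ops \<and>
    (\<forall>x y. mat_entry (ap a) x y \<noteq> 0 \<longrightarrow> dist x y \<le> R) \<and> norm (a - ap a) < \<eta>)"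
proof -
  have "\<forall>a\<in>\<F>. \<exists>b R. complex_linear b \<and> (\<forall>x y. mat_entry b x y \<noteq> 0 \<longrightarrow> dist x y \<le> R) \<and> norm (a - b) < \<eta>"
  proof
    fix a assume "a \<in> \<F>"
    then have "a \<in> roe_ops" using assms(2) by blast
    then obtain b where "complex_linear b" "finite_propagation b" "dist b a < \<eta>"
      using assms(3) unfolding closure_approachable by blast
    then show "\<exists>b R. complex_linear b \<and> (\<forall>x y. mat_entry b x y \<noteq> 0 \<longrightarrow> dist x y \<le> R) \<and> norm (a - b) < \<eta>"
      unfolding finite_propagation_def by (metis dist_commute dist_norm)
  qed
  then obtain ap r where ap: "\<And>a. a \<in> \<F> \<Longrightarrow> complex_linear (ap a)"
    "\<And>a x y. a \<in> \<F> \<Longrightarrow> mat_entry (ap a) x y \<noteq> 0 \<Longrightarrow> dist x y \<le> r a" "\<And>a. a \<in> \<F> \<Longrightarrow> norm (a - ap a) < \<eta>"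
    by metis
  define R where "R = (\<Sum>a\<in>\<F>. \<bar>r a\<bar>)"
  have rR: "r a \<le> R" if "a \<in> \<F>" for a
    using member_le_sum[OF that, of "\<lambda>a. \<bar>r a\<bar>"] assms(1) by (simp add: R_def)
  have dist: "dist x y \<le> R" if "a \<in> \<F>" "mat_entry (ap a) x y \<noteq> 0" for a x y
    using ap(2)[OF that] rR[OF that(1)] by linarith
  have "ap a \<in> roe_ops" if "a \<in> \<F>" for a
  proof (rule subsetD[OF closure_subset], intro CollectI conjI ap(1)[OF that])
    show "finite_propagation (ap a)"
      unfolding finite_propagation_def using dist[OF that] by blast
  qed
  moreover have "R \<ge> 0" by (simp add: R_def sum_nonneg)
  ultimately show ?thesis
    using ap dist by (intro exI[of _ ap] exI[of _ R]) blast
qed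

lemma half_power_less_inverse: "t > 0 \<Longrightarrow> (1/2::real) ^ t < 1 / real t"
  using of_nat_less_two_power[of t, where 'a = real]
  by (simp add: power_one_over field_simps)

text \<open>By contraposition: a covering at the scales \<open>g t\<close>,
  \<open>t \<in> \<sigma>\<close>, yields a triple whose absence would put \<open>\<sigma>\<close>
  into \<open>nudim_set\<close>. The approximants, \<open>R\<close> and \<open>\<delta>\<close>, and
  hence \<open>g\<close>, are settled before \<open>\<sigma>\<close> appears.\<close>

lemma nudim_set_image_asdim_set:
  fixes \<F> :: "'x::metric_space operator set"
  assumes bg: "bounded_geometry TYPE('x)" and q: "q \<ge> 1"
    and \<F>: "finite \<F>" "\<F> \<subseteq> car uniform_Roe"
  shows "\<exists>g. inj g \<and> (\<forall>\<sigma>\<in>nudim_set uniform_Roe \<F> q. g ` \<sigma> \<in> asdim_set TYPE('x))"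
proof -
  let ?A = "operator_alg (roe_ops :: 'x operator set)"
  interpret A: operator_subalgebra "roe_ops :: 'x operator set"
    by (rule operator_subalgebra_roe)
  have \<F>A: "\<F> \<subseteq> roe_ops"
    using \<F>(2) by (simp add: uniform_Roe_eq)
  define Q where "Q = real q"
  have Q: "Q \<ge> 1" using q by (simp add: Q_def)
  \<comment> \<open>Error budget: the approximation enters with a factor 3 and the remaining errors
    amount to \<open>3 * \<delta>'\<close>, in total less than \<open>9 / (16 * Q)\<close>.\<close>
  define \<eta> where "\<eta> = 1 / (8 * Q)"
  have \<eta>: "\<eta> > 0" "\<eta> < 1 / Q" using Q by (auto simp: \<eta>_def field_simps)
  obtain ap R where R: "R \<ge> 0" and ap: "\<And>a. a \<in> \<F> \<Longrightarrow> complex_linear (ap a)" "\<And>a. a \<in> \<F> \<Longrightarrow> ap a \<in> roe_ops"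
    "\<And>a x y. a \<in> \<F> \<Longrightarrow> mat_entry (ap a) x y \<noteq> 0 \<Longrightarrow> dist x y \<le> R"
    "\<And>a. a \<in> \<F> \<Longrightarrow> norm (a - ap a) < \<eta>"
    using finite_propagation_approx[OF \<F>(1) \<F>A \<eta>(1)] by blast
  obtain K0 where K0: "\<And>x::'x. finite (cball x R) \<and> card (cball x R) \<le> K0"
    using bounded_geometryD[OF bg] by blast
  define K where "K = max 1 K0"
  have K: "\<And>x::'x. finite (cball x R) \<and> card (cball x R) \<le> K" "real K \<ge> 1"
    using K0 max.coboundedI2[of _ K0 1] by (auto simp: K_def)
  define B where "B = 1 + (\<Sum>a\<in>\<F>. norm (ap a))"
  have B: "B \<ge> 1" by (simp add: B_def sum_nonneg)
  have apB: "norm (ap a) \<le> B" if "a \<in> \<F>" for a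
    using member_le_sum[OF that, of "\<lambda>a. norm (ap a)"] \<F>(1) by (simp add: B_def)
  \<comment> \<open>The denominator cancels \<open>K\<close> from the Schur test over
    \<open>R\<close>-balls and two factors \<open>B\<close>, as the product estimate involves the
    norms of two approximants.\<close>
  define \<delta> where "\<delta> = 1 / (16 * Q * real K * B\<^sup>2)"
  define \<delta>' where "\<delta>' = 1 / (16 * Q)"
  have B2: "B\<^sup>2 \<ge> B" using B by (simp add: power2_eq_square)
  have \<delta>0: "\<delta> > 0" using Q K(2) B by (simp add: \<delta>_def)
  have \<delta>K: "real K * (\<delta> * B\<^sup>2) = \<delta>'"
    using Q K(2) B by (simp add: \<delta>_def \<delta>'_def)
  have \<delta>': "\<delta>' > 0" "\<delta>' \<le> 1 / 16" using Q by (auto simp: \<delta>'_def field_simps)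
  have \<delta>le: "\<delta> \<le> \<delta>'"
  proof -
    have "\<delta> * 1 \<le> \<delta> * (real K * B\<^sup>2)"
      using \<delta>0 K(2) B B2 mult_mono[of 1 "real K" 1 "B\<^sup>2"] by (intro mult_left_mono) auto
    then show ?thesis using \<delta>K by (simp add: mult_ac)
  qed
  obtain g where g: "inj g" and part: "\<forall>\<sigma> (\<U> :: nat \<Rightarrow> 'x set set). finite \<sigma> \<longrightarrow>
      (\<forall>t\<in>\<sigma>. uniformly_bounded (\<U> (g t)) \<and> r_disjoint (real (g t)) (\<U> (g t))) \<longrightarrow>
      (\<Union>t\<in>\<sigma>. \<Union>(\<U> (g t))) = UNIV \<longrightarrow>
      (\<exists>k (p :: nat \<Rightarrow> 'x \<Rightarrow> 'x set) D. controlled_partition R \<delta> \<sigma> k p D)"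
    using partition_from_cover[OF R \<delta>0] by (elim exE conjE)
  show ?thesis
  proof (rule exI[of _ g], intro conjI g ballI, rule ccontr)
    fix \<sigma> assume nud: "\<sigma> \<in> nudim_set (uniform_Roe :: 'x operator star_alg) \<F> q"
      and nas: "g ` \<sigma> \<notin> asdim_set TYPE('x)"
    have \<sigma>: "finite \<sigma>" "\<sigma> \<noteq> {}" and \<sigma>q: "\<And>t. t \<in> \<sigma> \<Longrightarrow> q \<le> t"
      using nud by (auto simp: nudim_set_def Fin_def)
    have "g ` \<sigma> \<in> Fin UNIV" using \<sigma> by (auto simp: Fin_def)
    then have "\<exists>\<U> :: nat \<Rightarrow> 'x set set.
        (\<forall>t\<in>g ` \<sigma>. uniformly_bounded (\<U> t) \<and> r_disjoint (real t) (\<U> t)) \<and> (\<Union>t\<in>g ` \<sigma>. \<Union>(\<U> t)) = UNIV"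
      using nas unfolding asdim_set_def mem_Collect_eq by (simp only: simp_thms not_not)
    then obtain \<U> :: "nat \<Rightarrow> 'x set set" where
      "\<forall>t\<in>g ` \<sigma>. uniformly_bounded (\<U> t) \<and> r_disjoint (real t) (\<U> t)" "(\<Union>t\<in>g ` \<sigma>. \<Union>(\<U> t)) = UNIV"
      by (elim exE conjE)
    then have \<U>: "\<forall>t\<in>\<sigma>. uniformly_bounded (\<U> (g t)) \<and> r_disjoint (real (g t)) (\<U> (g t))"
      "(\<Union>t\<in>\<sigma>. \<Union>(\<U> (g t))) = UNIV"
      by auto
    obtain k :: "nat \<Rightarrow> 'x \<Rightarrow> real" and p :: "nat \<Rightarrow> 'x \<Rightarrow> 'x set" and D
      where kpD: "controlled_partition R \<delta> \<sigma> k p D"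
      using part[THEN spec[of _ \<sigma>], THEN spec[of _ \<U>], THEN mp, THEN mp, THEN mp, OF \<sigma>(1) \<U>]
      by (elim exE)
    have k1: "\<And>t x. \<bar>k t x\<bar> \<le> 1" and ksum: "\<And>x. (\<Sum>t\<in>\<sigma>. (k t x)\<^sup>2) = 1"
      and kvar: "\<And>t x y. t \<in> \<sigma> \<Longrightarrow> dist x y \<le> R \<Longrightarrow> \<bar>k t x - k t y\<bar> \<le> \<delta> * (1/2) ^ t"
      and ksep: "\<And>t x y. t \<in> \<sigma> \<Longrightarrow> k t x \<noteq> 0 \<Longrightarrow> k t y \<noteq> 0 \<Longrightarrow> dist x y \<le> R \<Longrightarrow> p t x = p t y"
      and kdist: "\<And>t x y. t \<in> \<sigma> \<Longrightarrow> k t x \<noteq> 0 \<Longrightarrow> k t y \<noteq> 0 \<Longrightarrow> p t x = p t y \<Longrightarrow> dist x y \<le> D t"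
      using kpD unfolding controlled_partition_def by blast+
    have half_sum: "(\<Sum>t\<in>\<sigma>. (1/2::real) ^ t) \<le> 2"
      using sum_half_powers_le[OF \<sigma>(1), of 0] by (simp add: sum_divide_distrib[symmetric])
    define S where "S t = {x. k t x \<noteq> 0}" for t
    define good where "good t \<beta> N e \<longleftrightarrow> block_model (S t) (p t) \<beta> (D t) N \<and> 0 \<le> e \<and> e \<le> \<delta>' * (1/2) ^ t \<and>
      real N * e \<le> \<delta>' * (1/2) ^ t \<and>
      (\<forall>x. k t x \<noteq> 0 \<longrightarrow> \<bar>k t (\<beta> x) - k t x\<bar> \<le> e) \<and>
      (\<forall>a\<in>ap ` \<F>. \<forall>x y. k t x \<noteq> 0 \<longrightarrow> k t y \<noteq> 0 \<longrightarrow> p t x = p t y \<longrightarrow>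
        cmod (of_real (k t (\<beta> x)) * mat_entry a (\<beta> x) (\<beta> y) * of_real (k t (\<beta> y))
          - of_real (k t x) * mat_entry a x y * of_real (k t y)) \<le> e)" for t \<beta> N e
    have "\<forall>t\<in>\<sigma>. \<exists>\<beta> N e. good t \<beta> N e"
      unfolding S_def good_def
      by (intro ballI weighted_block_model_exists[OF bg]) (use \<F>(1) k1 kdist \<delta>'(1) in auto)
    then obtain \<beta> N e where good: "\<And>t. t \<in> \<sigma> \<Longrightarrow> good t (\<beta> t) (N t) (e t)"
      by metis
    have bm: "\<And>t. t \<in> \<sigma> \<Longrightarrow> block_model (S t) (p t) (\<beta> t) (D t) (N t)"
      and e: "\<And>t. t \<in> \<sigma> \<Longrightarrow> 0 \<le> e t" "\<And>t. t \<in> \<sigma> \<Longrightarrow> e t \<le> \<delta>' * (1/2) ^ t"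
        "\<And>t. t \<in> \<sigma> \<Longrightarrow> real (N t) * e t \<le> \<delta>' * (1/2) ^ t"
      and kclose: "\<And>t x. t \<in> \<sigma> \<Longrightarrow> k t x \<noteq> 0 \<Longrightarrow> \<bar>k t (\<beta> t x) - k t x\<bar> \<le> e t"
      and aclose: "\<And>t a x y. t \<in> \<sigma> \<Longrightarrow> a \<in> \<F> \<Longrightarrow> k t x \<noteq> 0 \<Longrightarrow> k t y \<noteq> 0 \<Longrightarrow> p t x = p t y \<Longrightarrow>
        cmod (of_real (k t (\<beta> t x)) * mat_entry (ap a) (\<beta> t x) (\<beta> t y) * of_real (k t (\<beta> t y))
          - of_real (k t x) * mat_entry (ap a) x y * of_real (k t y)) \<le> e t"
      using good unfolding good_def by blast+
    define C where "C t = block_ops (\<beta> t ` S t) (p t)" for t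
    define P where "P t = block_model.compress (S t) (p t) (\<beta> t)" for t
    define G where "G t = block_model.spread (S t) (p t) (\<beta> t)" for t
    have subalg: "operator_subalgebra (C t)" for t
      unfolding C_def by (rule operator_subalgebra_block_ops)
    have "\<forall>t\<in>\<sigma>. \<exists>(h :: 'x operator \<Rightarrow> nat \<Rightarrow> complex) u. (\<forall>T\<in>C t. u (h T) = T) \<and>
        cstar_algebra (transport h u (operator_alg (C t))) \<and>
        finite_dimensional (transport h u (operator_alg (C t)))"
    proof
      fix t assume "t \<in> \<sigma>"
      then have fin: "finite (\<beta> t ` S t)" using block_model.finite_range[OF bm] by blast
      show "\<exists>(h :: 'x operator \<Rightarrow> nat \<Rightarrow> complex) u. (\<forall>T\<in>C t. u (h T) = T) \<and>
        cstar_algebra (transport h u (operator_alg (C t))) \<and>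
        finite_dimensional (transport h u (operator_alg (C t)))"
        unfolding C_def by (rule block_ops_coordinates[OF fin, of "p t"]) blast
    qed
    then obtain h :: "nat \<Rightarrow> 'x operator \<Rightarrow> nat \<Rightarrow> complex" and u where
      hu: "\<And>t T. t \<in> \<sigma> \<Longrightarrow> T \<in> C t \<Longrightarrow> u t (h t T) = T"
      and Fcs: "\<And>t. t \<in> \<sigma> \<Longrightarrow> cstar_algebra (transport (h t) (u t) (operator_alg (C t)))"
      and Ffd: "\<And>t. t \<in> \<sigma> \<Longrightarrow> finite_dimensional (transport (h t) (u t) (operator_alg (C t)))"
      by (simp add: bchoice_iff) blast
    define F where "F t = transport (h t) (u t) (operator_alg (C t))" for t
    define \<psi> where "\<psi> a = (\<lambda>t\<in>\<sigma>. h t (P t (k t) a))" for a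
    define \<phi> where "\<phi> x = (\<Sum>t\<in>\<sigma>. G t (u t (x t)))" for x :: "nat \<Rightarrow> nat \<Rightarrow> complex"
    have PC: "P t (k t) a \<in> C t" if "t \<in> \<sigma>" "complex_linear a" for t a
      unfolding P_def C_def using block_model.compress_in_model[OF bm[OF that(1)] k1 that(2)] .
    have uh: "u t (h t (P t (k t) a)) = P t (k t) a" if "t \<in> \<sigma>" "complex_linear a" for t a
      using hu PC that by blast
    have Ccl: "complex_linear T" if "T \<in> C t" for t T
      using operator_subalgebra.complex_linear[OF subalg that] .
    have G0: "G t 0 = 0" if "t \<in> \<sigma>" for t
      unfolding G_def using block_model.spread_zero[OF bm[OF that]] .
    have \<phi>\<psi>: "\<phi> (\<psi> a) = (\<Sum>t\<in>\<sigma>. G t (P t (k t) a))" if "complex_linear a" for a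
      unfolding \<phi>_def \<psi>_def using that by (intro sum.cong) (auto simp: uh)
    have F_lin: "linear_map (F t) ?A (\<lambda>y. G t (u t y))"
      and F_cp: "positive_mat (F t) n x \<Longrightarrow> positive_mat ?A n (\<lambda>i j. G t (u t (x i j)))"
      and F_contr: "contractive (F t) ?A (\<lambda>y. G t (u t y))"
      and F_oz: "order_zero (F t) ?A (\<lambda>y. G t (u t y))" if t: "t \<in> \<sigma>" for t n x
      using block_model.linear_map_spread[OF bm[OF t], of "u t" "h t"]
        block_model.positive_mat_spread_coords[OF bm[OF t], of "u t" "h t" n x]
        block_model.contractive_spread[OF bm[OF t], of "u t" "h t"]
        block_model.order_zero_spread[OF bm[OF t], of "u t" "h t"] hu[OF t]
      unfolding F_def G_def C_def by auto
    have incl: "\<phi> \<circ> summand_incl \<sigma> F t = (\<lambda>y. G t (u t y))" if t: "t \<in> \<sigma>" for t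
    proof
      fix y
      have "G s (u s (summand_incl \<sigma> F t y s)) = (if s = t then G t (u t y) else 0)" if s: "s \<in> \<sigma>" for s
        using hu[OF s operator_subalgebra.zero[OF subalg]] s
        by (auto simp: summand_incl_def F_def G0)
      then show "(\<phi> \<circ> summand_incl \<sigma> F t) y = G t (u t y)"
        using t \<sigma>(1) by (simp add: \<phi>_def)
    qed
    have cond_\<phi>: "completely_positive (direct_sum \<sigma> F) ?A \<phi>"
      unfolding completely_positive_def
    proof (intro conjI allI impI)
      have lin: "G t (u t y) \<in> roe_ops" "G t (u t (y \<oplus>\<^bsub>F t\<^esub> z)) = G t (u t y) + G t (u t z)"
        "G t (u t (c \<odot>\<^bsub>F t\<^esub> y)) = scale_operator c (G t (u t y))"
        if "t \<in> \<sigma>" "y \<in> car (F t)" "z \<in> car (F t)" for t y z c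
        using F_lin[OF that(1)] that(2,3) by (auto simp: linear_map_def)
      show "linear_map (direct_sum \<sigma> F) ?A \<phi>"
        unfolding linear_map_def
      proof (intro conjI ballI allI)
        fix x assume x: "x \<in> car (direct_sum \<sigma> F)"
        then have x': "x t \<in> car (F t)" if "t \<in> \<sigma>" for t using that by auto
        show "\<phi> x \<in> car ?A"
          unfolding \<phi>_def operator_alg_simps using lin(1)[OF _ x' x'] by (intro A.sum) auto
        show "\<phi> (c \<odot>\<^bsub>direct_sum \<sigma> F\<^esub> x) = c \<odot>\<^bsub>?A\<^esub> \<phi> x" for c
        proof -
          have "\<phi> (c \<odot>\<^bsub>direct_sum \<sigma> F\<^esub> x) = (\<Sum>t\<in>\<sigma>. scale_operator c (G t (u t (x t))))"
            unfolding \<phi>_def using lin(3)[OF _ x' x'] by (intro sum.cong) auto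
          also have "\<dots> = scale_operator c (\<phi> x)"
            unfolding \<phi>_def
            by (rule linear_sum[OF bounded_linear.linear[OF bounded_linear_scale_operator], symmetric])
          finally show ?thesis by simp
        qed
        fix y assume y: "y \<in> car (direct_sum \<sigma> F)"
        then have y': "y t \<in> car (F t)" if "t \<in> \<sigma>" for t using that by auto
        show "\<phi> (x \<oplus>\<^bsub>direct_sum \<sigma> F\<^esub> y) = \<phi> x \<oplus>\<^bsub>?A\<^esub> \<phi> y"
          unfolding \<phi>_def operator_alg_simps sum.distrib[symmetric]
          using lin(2) x' y' by (intro sum.cong) auto
      qed
      fix n x assume x: "positive_mat (direct_sum \<sigma> F) n x"
      show "positive_mat ?A n (\<lambda>i j. \<phi> (x i j))"
        unfolding \<phi>_def
        by (rule A.positive_mat_sum[OF id_in_roe \<sigma>(1)], rule F_cp[OF _ positive_mat_direct_sumD[OF x]])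
    qed
    have cond_\<psi>: "completely_positive ?A (direct_sum \<sigma> F) \<psi>"
      unfolding completely_positive_def
    proof (intro conjI allI impI)
      show "linear_map ?A (direct_sum \<sigma> F) \<psi>"
        unfolding linear_map_def
      proof (intro conjI ballI allI)
        fix a assume "a \<in> car ?A"
        then have a: "complex_linear a" by (simp only: operator_alg_simps A.complex_linear)
        show "\<psi> a \<in> car (direct_sum \<sigma> F)"
          using PC a by (auto simp: \<psi>_def F_def)
        show "\<psi> (c \<odot>\<^bsub>?A\<^esub> a) = c \<odot>\<^bsub>direct_sum \<sigma> F\<^esub> \<psi> a" for c
        proof -
          have "P t (k t) (scale_operator c a) = scale_operator c (P t (k t) a)" if "t \<in> \<sigma>" for t
            unfolding P_def using block_model.compress_scale[OF bm[OF that] k1 a] .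
          then show ?thesis
            by (auto simp: \<psi>_def F_def fun_eq_iff uh a)
        qed
        fix b assume "b \<in> car ?A"
        then have b: "complex_linear b" by (simp only: operator_alg_simps A.complex_linear)
        have "P t (k t) (a + b) = P t (k t) a + P t (k t) b" if "t \<in> \<sigma>" for t
          unfolding P_def using block_model.compress_add[OF bm[OF that] k1 a b] .
        then show "\<psi> (a \<oplus>\<^bsub>?A\<^esub> b) = \<psi> a \<oplus>\<^bsub>direct_sum \<sigma> F\<^esub> \<psi> b"
          by (auto simp: \<psi>_def F_def fun_eq_iff uh a b)
      qed
      fix n x assume x: "positive_mat ?A n x"
      show "positive_mat (direct_sum \<sigma> F) n (\<lambda>i j. \<psi> (x i j))"
      proof (rule positive_mat_direct_sumI)
        fix t assume t: "t \<in> \<sigma>"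
        have "positive_mat (operator_alg (C t)) n (\<lambda>i j. P t (k t) (x i j))"
          unfolding P_def C_def using block_model.positive_mat_compress[OF bm[OF t] k1 x] .
        then have "positive_mat (F t) n (\<lambda>i j. h t (P t (k t) (x i j)))"
          unfolding F_def using hu[OF t]
          by (intro positive_mat_transportI[OF operator_subalgebra.cstar_algebra[OF subalg]]) auto
        then show "positive_mat (F t) n (\<lambda>i j. \<psi> (x i j) t)"
          using t by (simp add: \<psi>_def)
      qed (simp add: \<psi>_def)
    qed
    have nrmF: "nrm (F t) (\<psi> a t) \<le> norm a" if "t \<in> \<sigma>" "complex_linear a" for t a
    proof -
      have "norm (P t (k t) a) \<le> norm a"
        unfolding P_def by (rule block_model.norm_compress[OF bm[OF that(1)] k1])
      then show ?thesis using that by (simp add: \<psi>_def F_def uh)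
    qed
    have contr_\<psi>: "contractive ?A (direct_sum \<sigma> F) \<psi>"
      unfolding contractive_def
    proof
      fix a assume "a \<in> car ?A"
      then have "complex_linear a" by (simp only: operator_alg_simps A.complex_linear)
      then have "\<forall>t\<in>\<sigma>. nrm (F t) (\<psi> a t) \<le> norm a" using nrmF by blast
      then show "nrm (direct_sum \<sigma> F) (\<psi> a) \<le> nrm ?A a"
        using \<sigma> by (simp only: direct_sum_simps operator_alg_simps, intro Max.boundedI) auto
    qed
    have Q1: "1 / Q = 16 * \<delta>'" "\<eta> = 2 * \<delta>'" by (auto simp: \<delta>'_def \<eta>_def)
    have cond1: "\<exists>a'\<in>car ?A. \<exists>b'\<in>car ?A. nrm ?A (a \<ominus>\<^bsub>?A\<^esub> a') < 1 / real q \<and> nrm ?A (b \<ominus>\<^bsub>?A\<^esub> b') < 1 / real q \<and>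
        nrm (F t) (\<psi> a' t \<otimes>\<^bsub>F t\<^esub> \<psi> b' t) < 1 / real t + nrm ?A (a' \<otimes>\<^bsub>?A\<^esub> b')"
      if t: "t \<in> \<sigma>" and a: "a \<in> \<F>" and b: "b \<in> \<F>" for t a b
    \<comment> \<open>The freedom to move \<open>a\<close> and \<open>b\<close> by less than
      \<open>1 / q\<close> is what allows finite propagation here.\<close>
    proof (rule bexI[of _ "ap a"], rule bexI[of _ "ap b"], intro conjI)
      show "nrm ?A (a \<ominus>\<^bsub>?A\<^esub> ap a) < 1 / real q" "nrm ?A (b \<ominus>\<^bsub>?A\<^esub> ap b) < 1 / real q"
        using ap(4)[OF a] ap(4)[OF b] \<eta>(2) by (auto simp: Q_def)
      have "nrm (F t) (\<psi> (ap a) t \<otimes>\<^bsub>F t\<^esub> \<psi> (ap b) t) = norm (P t (k t) (ap a) o\<^sub>L P t (k t) (ap b))"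
        using t ap(1) a b hu[OF t operator_subalgebra.comp[OF subalg PC PC]]
        by (simp add: \<psi>_def F_def uh)
      also have "\<dots> \<le> norm (ap a o\<^sub>L ap b) + norm (ap a) * (real K * (2 * (\<delta> * (1/2) ^ t) * norm (ap b)))"
        unfolding P_def
      proof (rule block_model.norm_compress_comp[OF bm[OF t] k1 _ ap(1)[OF a] _ ap(1)[OF b]])
        show "mat_entry (ap a) x y \<noteq> 0 \<Longrightarrow> dist x y \<le> R" "mat_entry (ap b) x y \<noteq> 0 \<Longrightarrow> dist x y \<le> R" for x y
          using ap(3) a b by auto
        show "x \<in> S t \<Longrightarrow> y \<in> S t \<Longrightarrow> dist x y \<le> R \<Longrightarrow> p t x = p t y" for x y
          using ksep[OF t] by (auto simp: S_def)
      qed (use K(1) kvar[OF t] \<delta>0 in \<open>auto simp: S_def\<close>)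
      also have "norm (ap a) * (real K * (2 * (\<delta> * (1/2) ^ t) * norm (ap b)))
          \<le> B * (real K * (2 * (\<delta> * (1/2) ^ t) * B))"
        using apB[OF a] apB[OF b] \<delta>0 B by (intro mult_mono mult_nonneg_nonneg) auto
      also have "\<dots> = 2 * (real K * (\<delta> * B\<^sup>2)) * (1/2) ^ t"
        by (simp add: power2_eq_square)
      also have "\<dots> \<le> 1 * (1/2) ^ t"
        unfolding \<delta>K using \<delta>' by (intro mult_right_mono) auto
      \<comment> \<open>Here \<open>t > 0\<close> because \<open>1 \<le> q \<le> t\<close>.\<close>
      also have "\<dots> < 1 / real t"
        using half_power_less_inverse[of t] \<sigma>q[OF t] q by simp
      finally show "nrm (F t) (\<psi> (ap a) t \<otimes>\<^bsub>F t\<^esub> \<psi> (ap b) t) < 1 / real t + nrm ?A (ap a \<otimes>\<^bsub>?A\<^esub> ap b)"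
        by simp
    qed (use ap(2) a b in auto)
    have cond2: "norm (\<phi> (\<psi> a) - a) < 1 / Q" if a: "a \<in> \<F>" for a
    proof -
      have cla: "complex_linear a" using a \<F>A A.complex_linear by blast
      note cl0 = ap(1)[OF a]
      define d where "d = a - ap a"
      have cld: "complex_linear d" unfolding d_def using cla cl0 by blast
      \<comment> \<open>The weight as it comes back from the model, read at
        \<open>\<beta> t x\<close> instead of \<open>x\<close>. The squares no longer sum to 1, but
        closeness keeps the sum below \<open>1 + 4 * \<delta>' \<le> 2\<close>.\<close>
      define \<kappa> where "\<kappa> t x = (if x \<in> S t then k t (\<beta> t x) else 0)" for t x
      have \<kappa>1: "\<bar>\<kappa> t x\<bar> \<le> 1" for t x using k1 by (simp add: \<kappa>_def)
      have \<kappa>2: "(\<Sum>t\<in>\<sigma>. (\<kappa> t x)\<^sup>2) \<le> 2" for x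
      proof -
        have "(\<kappa> t x)\<^sup>2 \<le> (k t x)\<^sup>2 + 2 * (\<delta>' * (1/2) ^ t)" if t: "t \<in> \<sigma>" for t
        proof (cases "k t x = 0")
          case True
          then show ?thesis using \<delta>'(1) by (simp add: \<kappa>_def S_def)
        next
          case False
          have "(\<kappa> t x)\<^sup>2 - (k t x)\<^sup>2 = (\<kappa> t x + k t x) * (\<kappa> t x - k t x)"
            by (simp add: power2_eq_square square_diff_square_factored)
          also have "\<dots> \<le> \<bar>\<kappa> t x + k t x\<bar> * \<bar>\<kappa> t x - k t x\<bar>"
            by (metis abs_ge_self abs_mult)
          also have "\<dots> \<le> 2 * (\<delta>' * (1/2) ^ t)"
          proof (rule mult_mono)
            show "\<bar>\<kappa> t x + k t x\<bar> \<le> 2" using \<kappa>1[of t x] k1[of t x] by linarith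
            show "\<bar>\<kappa> t x - k t x\<bar> \<le> \<delta>' * (1/2) ^ t"
              using kclose[OF t False] e(2)[OF t] False by (simp add: \<kappa>_def S_def)
          qed auto
          finally show ?thesis by simp
        qed
        then have "(\<Sum>t\<in>\<sigma>. (\<kappa> t x)\<^sup>2) \<le> (\<Sum>t\<in>\<sigma>. (k t x)\<^sup>2 + 2 * (\<delta>' * (1/2) ^ t))"
          by (rule sum_mono)
        also have "\<dots> = 1 + 2 * (\<delta>' * (\<Sum>t\<in>\<sigma>. (1/2) ^ t))"
          by (simp add: sum.distrib ksum sum_distrib_left)
        also have "\<dots> \<le> 1 + 2 * (\<delta>' * 2)"
          using half_sum \<delta>'(1) by (intro add_left_mono mult_left_mono) auto
        finally show ?thesis using \<delta>'(2) by linarith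
      qed
      have 1: "norm (\<Sum>t\<in>\<sigma>. G t (P t (k t) d)) \<le> norm d * 2"
      proof -
        have "G t (P t (k t) d) = mult_op (\<kappa> t) o\<^sub>L G t (P t (\<lambda>_. 1) d) o\<^sub>L mult_op (\<kappa> t)" if "t \<in> \<sigma>" for t
          unfolding G_def P_def \<kappa>_def using block_model.spread_compress_weight[OF bm[OF that] k1 cld] .
        moreover have "norm (G t (P t (\<lambda>_. 1) d)) \<le> norm d" if t: "t \<in> \<sigma>" for t
        proof -
          have one: "\<bar>1::real\<bar> \<le> 1" by simp
          have "norm (G t (P t (\<lambda>_. 1) d)) \<le> norm (P t (\<lambda>_. 1) d)"
            unfolding G_def P_def
            by (rule block_model.norm_spread[OF bm[OF t] block_model.complex_linear_compress[OF bm[OF t] one cld]])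
          also have "\<dots> \<le> norm d"
            unfolding P_def by (rule block_model.norm_compress[OF bm[OF t] one])
          finally show ?thesis .
        qed
        ultimately show ?thesis
          using norm_sum_mult_op_conj[OF \<sigma>(1) \<kappa>1 \<kappa>2, of "\<lambda>t. G t (P t (\<lambda>_. 1) d)" "norm d"] by simp
      qed
      have 2: "norm (\<Sum>t\<in>\<sigma>. G t (P t (k t) (ap a)) - (mult_op (k t) o\<^sub>L ap a o\<^sub>L mult_op (k t))) \<le> 2 * \<delta>'"
      proof -
        have "norm (G t (P t (k t) (ap a)) - (mult_op (k t) o\<^sub>L ap a o\<^sub>L mult_op (k t))) \<le> \<delta>' * (1/2) ^ t"
          if t: "t \<in> \<sigma>" for t
        proof -
          have "norm (G t (P t (k t) (ap a)) - (mult_op (k t) o\<^sub>L ap a o\<^sub>L mult_op (k t))) \<le> real (N t) * e t"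
            unfolding G_def P_def
          proof (rule block_model.norm_spread_compress_diff[OF bm[OF t] k1 _ cl0])
            show "x \<in> S t \<Longrightarrow> y \<in> S t \<Longrightarrow> mat_entry (ap a) x y \<noteq> 0 \<Longrightarrow> p t x = p t y" for x y
              using ksep[OF t] ap(3)[OF a] by (auto simp: S_def)
          qed (use aclose[OF t a] e(1)[OF t] in \<open>auto simp: S_def\<close>)
          then show ?thesis using e(3)[OF t] by linarith
        qed
        then have "norm (\<Sum>t\<in>\<sigma>. G t (P t (k t) (ap a)) - (mult_op (k t) o\<^sub>L ap a o\<^sub>L mult_op (k t)))
            \<le> (\<Sum>t\<in>\<sigma>. \<delta>' * (1/2) ^ t)"
          by (rule sum_norm_le)
        also have "\<dots> \<le> \<delta>' * 2"
          unfolding sum_distrib_left[symmetric] using half_sum \<delta>'(1) by (intro mult_left_mono) auto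
        finally show ?thesis by simp
      qed
      have 3: "norm ((\<Sum>t\<in>\<sigma>. mult_op (k t) o\<^sub>L ap a o\<^sub>L mult_op (k t)) - ap a) \<le> \<delta>'"
      proof -
        have "(\<Sum>t\<in>\<sigma>. (\<delta> * (1/2) ^ t)\<^sup>2) \<le> (\<Sum>t\<in>\<sigma>. \<delta> * (1/2) ^ t)"
        proof (rule sum_mono)
          fix t
          have "\<delta> * (1/2) ^ t \<le> 1 * 1"
            using \<delta>0 \<delta>le \<delta>'(2) by (intro mult_mono power_le_one) auto
          then show "(\<delta> * (1/2) ^ t)\<^sup>2 \<le> \<delta> * (1/2) ^ t"
            using \<delta>0 by (simp add: power2_eq_square mult_left_le)
        qed
        also have "\<dots> \<le> \<delta> * 2"
          unfolding sum_distrib_left[symmetric] using half_sum \<delta>0 by (intro mult_left_mono) auto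
        finally have "(\<Sum>t\<in>\<sigma>. (\<delta> * (1/2) ^ t)\<^sup>2) \<le> 2 * \<delta>" by simp
        from norm_partition_average[OF \<sigma>(1) k1 ksum cl0 ap(3)[OF a] K(1) kvar this]
        have "norm ((\<Sum>t\<in>\<sigma>. mult_op (k t) o\<^sub>L ap a o\<^sub>L mult_op (k t)) - ap a) \<le> real K * (\<delta> * norm (ap a))" .
        also have "\<dots> \<le> real K * (\<delta> * B\<^sup>2)"
          using apB[OF a] B2 \<delta>0 by (intro mult_left_mono) auto
        finally show ?thesis using \<delta>K by simp
      qed
      have split: "G t (P t (k t) a) = G t (P t (k t) d) + G t (P t (k t) (ap a))" if t: "t \<in> \<sigma>" for t
      proof -
        have "P t (k t) (d + ap a) = P t (k t) d + P t (k t) (ap a)"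
          unfolding P_def using block_model.compress_add[OF bm[OF t] k1 cld cl0] .
        moreover have "G t (P t (k t) d + P t (k t) (ap a)) = G t (P t (k t) d) + G t (P t (k t) (ap a))"
          unfolding G_def using block_model.spread_add[OF bm[OF t] Ccl[OF PC[OF t cld]] Ccl[OF PC[OF t cl0]]] .
        ultimately show ?thesis by (simp add: d_def)
      qed
      \<comment> \<open>The compressed remainder, the replacement of blocks by their models, the
        averaging over the partition, and the remainder itself.\<close>
      have "\<phi> (\<psi> a) - a = (\<Sum>t\<in>\<sigma>. G t (P t (k t) d))
          + (\<Sum>t\<in>\<sigma>. G t (P t (k t) (ap a)) - (mult_op (k t) o\<^sub>L ap a o\<^sub>L mult_op (k t)))
          + ((\<Sum>t\<in>\<sigma>. mult_op (k t) o\<^sub>L ap a o\<^sub>L mult_op (k t)) - ap a) - d"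
        unfolding \<phi>\<psi>[OF cla] using split by (simp add: sum.distrib sum_subtractf d_def)
      also have "norm \<dots> \<le> norm d * 2 + 2 * \<delta>' + \<delta>' + norm d"
        by (intro order_trans[OF norm_triangle_ineq4] add_mono norm_triangle_le 1 2 3) auto
      also have "\<dots> < 1 / Q"
        using ap(4)[OF a] Q1 \<delta>'(1) by (simp add: d_def)
      finally show ?thesis .
    qed
    have "\<exists>(F :: nat \<Rightarrow> (nat \<Rightarrow> complex) star_alg) \<psi> \<phi>.
        (\<forall>t\<in>\<sigma>. cstar_algebra (F t) \<and> finite_dimensional (F t)) \<and>
        completely_positive ?A (direct_sum \<sigma> F) \<psi> \<and>
        contractive ?A (direct_sum \<sigma> F) \<psi> \<and>
        completely_positive (direct_sum \<sigma> F) ?A \<phi> \<and>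
        (\<forall>t\<in>\<sigma>. contractive (F t) ?A (\<phi> \<circ> summand_incl \<sigma> F t) \<and>
               order_zero (F t) ?A (\<phi> \<circ> summand_incl \<sigma> F t)) \<and>
        (\<forall>t\<in>\<sigma>. \<forall>a\<in>\<F>. \<forall>b\<in>\<F>. \<exists>a'\<in>car ?A. \<exists>b'\<in>car ?A.
           nrm ?A (a \<ominus>\<^bsub>?A\<^esub> a') < 1 / real q \<and> nrm ?A (b \<ominus>\<^bsub>?A\<^esub> b') < 1 / real q \<and>
           nrm (F t) (\<psi> a' t \<otimes>\<^bsub>F t\<^esub> \<psi> b' t) < 1 / real t + nrm ?A (a' \<otimes>\<^bsub>?A\<^esub> b')) \<and>
        (\<forall>a\<in>\<F>. nrm ?A (\<phi> (\<psi> a) \<ominus>\<^bsub>?A\<^esub> a) < 1 / real q)"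
    proof (intro exI[of _ F] exI[of _ \<psi>] exI[of _ \<phi>] conjI ballI)
      show "cstar_algebra (F t)" "finite_dimensional (F t)" if "t \<in> \<sigma>" for t
        unfolding F_def using Fcs Ffd that by auto
      show "contractive (F t) ?A (\<phi> \<circ> summand_incl \<sigma> F t)" "order_zero (F t) ?A (\<phi> \<circ> summand_incl \<sigma> F t)"
        if "t \<in> \<sigma>" for t
        unfolding incl[OF that] using F_contr F_oz that by auto
      show "nrm ?A (\<phi> (\<psi> a) \<ominus>\<^bsub>?A\<^esub> a) < 1 / real q" if "a \<in> \<F>" for a
        using cond2[OF that] by (simp add: Q_def)
    qed (use cond_\<psi> contr_\<psi> cond_\<phi> cond1 in auto)
    then show False
      using nud unfolding nudim_set_def uniform_Roe_eq by blast
  qed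
qed

theorem theoremD:
  fixes \<alpha> :: "'o::wellorder"
  assumes "discrete (UNIV :: 'x::metric_space set)"
    and "bounded_geometry TYPE('x)"
    and "trasdim_eq TYPE('x) \<alpha>"
  shows "trnudim_le (uniform_Roe :: 'x operator star_alg) \<alpha>"
  unfolding trnudim_le_def
proof (intro allI impI, elim conjE)
  fix q :: nat and \<F> :: "'x operator set"
  assume \<F>: "q \<ge> 1" "finite \<F>" "\<F> \<subseteq> car uniform_Roe"
  \<comment> \<open>\<open>g\<close> varies with \<open>\<F>\<close> and \<open>q\<close>; this
    suffices, as \<open>trnudim_le\<close> bounds \<open>Ord\<close> separately for each
    pair.\<close>
  obtain g where g: "inj g" "\<forall>\<sigma>\<in>nudim_set uniform_Roe \<F> q. g ` \<sigma> \<in> asdim_set TYPE('x)"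
    using nudim_set_image_asdim_set[OF assms(2) \<F>] by (elim exE conjE)
  have "Ord_le (asdim_set TYPE('x)) \<alpha>"
    using assms(3) by (simp add: trasdim_eq_def Ord_eq_def)
  from Ord_le_image[OF g(1) bspec[OF g(2)] this] show "Ord_le (nudim_set (uniform_Roe :: 'x operator star_alg) \<F> q) \<alpha>"
    .
qed

end
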